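(* Let $G$ be a compact Hausdorff group with normalized Haar measure $m_G$, let $(\Phi,\Psi)$ be a pair of complementary Young functions both satisfying the $\Delta_2$-condition, and let $\mu\in M(G)$ with $\mu(G)\neq0$. Then: (i) for every $f\in L^\Phi(G)$, $\|f\|_{\nu_{\Phi,\mu}}\le\|f\|_\Phi\|\mu\|$; (ii) the inclusion $\imath:L^\Phi(G)\to L^1(\nu_{\Phi,\mu})$ is continuous, with operator norm satisfying $|\mu(G)|\le\|\imath\|\le\|\mu\|$.
   Context: $M(G)$: bounded complex Radon measures on $G$ with total variation norm $\|\mu\|$. Young function: convex $\Phi:[0,\infty]\to[0,\infty]$, $\Phi(0)=0$, $\lim_{x\to\infty}\Phi(x)=\infty$; complementary $\Psi(y)=\sup\{xy-\Phi(x):x\ge0\}$; $\Delta_2$: $\exists K,x_0>0$, $\Phi(2x)\le K\Phi(x)$ for $x\ge x_0$. $L^\Phi(G)$ has the Luxemburg norm $\|f\|_\Phi=\inf\{k>0:\int_G\Phi(|f|/k)dm_G\le1\}$; its dual $L^\Psi(G)$ has the Orlicz norm $\|g\|^o_\Psi=\sup\{\int_G|gh|\,dm_G:\int_G\Phi(|h|)dm_G\le1\}$, duality $\langle f,g\rangle=\int_Gfg\,dm_G$. $\mu*f(t)=\int_Gf(s^{-1}t)\,d\mu(s)$; $\nu_{\Phi,\mu}:\mathcal{B}(G)\to L^\Phi(G)$, $\nu_{\Phi,\mu}(A)=\mu*\chi_A$. For a vector measure $\nu$ with values in a Banach space $X$, $L^1(\nu)$ is the space (modulo $\nu$-a.e.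 equality) of measurable $f$ with $f\in L^1(|\langle\nu,x'\rangle|)$ for all $x'\in X'$ and such that for each Borel $A$ there is a unique $x_A\in X$ with $\int_Af\,d\langle\nu,x'\rangle=\langle x_A,x'\rangle$ for all $x'$; norm $\|f\|_\nu=\sup_{\|x'\|\le1}\int_G|f|\,d|\langle\nu,x'\rangle|$. Since $\mu(G)\ne0$, $\nu_{\Phi,\mu}$-null sets coincide with $m_G$-null sets. *)

theory Defs
  imports "HOL-Analysis.Analysis"
begin

text \<open>The group is a type of class topological_group_add (the group operation is
written additively but need NOT be commutative; s^{-1} t is written - s + t).
Compact Hausdorff: t2_space plus compactness of UNIV.\<close>

definition radon_measure :: "'a::topological_space measure \<Rightarrow> bool" where
  "radon_measure M \<longleftrightarrow>
     sets M = sets borel \<and> emeasure M (space M) < \<infinity> \<and>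
     (\<forall>A\<in>sets borel. emeasure M A = (INF U\<in>{U. open U \<and> A \<subseteq> U}. emeasure M U)) \<and>
     (\<forall>U. open U \<longrightarrow> emeasure M U = (SUP K\<in>{K. compact K \<and> K \<subseteq> U}. emeasure M K))"

definition normalized_haar_measure :: "'g::topological_group_add measure \<Rightarrow> bool" where
  "normalized_haar_measure m \<longleftrightarrow>
     radon_measure m \<and> emeasure m UNIV = 1 \<and>
     (\<forall>s. \<forall>A\<in>sets borel. emeasure m ((\<lambda>x. s + x) ` A) = emeasure m A)"

definition complex_measure :: "'a measure \<Rightarrow> ('a set \<Rightarrow> complex) \<Rightarrow> bool" where
  "complex_measure M \<nu> \<longleftrightarrow>
     (\<forall>A::nat \<Rightarrow> 'a set. range A \<subseteq> sets M \<longrightarrow> disjoint_family A \<longrightarrow>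
        (\<lambda>n. \<nu> (A n)) sums \<nu> (\<Union>n. A n))"

definition cm_var :: "'a measure \<Rightarrow> ('a set \<Rightarrow> complex) \<Rightarrow> 'a measure" where
  "cm_var M \<nu> = measure_of (space M) (sets M)
     (\<lambda>A. SUP P\<in>{P. finite P \<and> disjoint P \<and> P \<subseteq> sets M \<and> \<Union>P = A}.
            (\<Sum>B\<in>P. ennreal (cmod (\<nu> B))))"

definition cm_norm :: "'a measure \<Rightarrow> ('a set \<Rightarrow> complex) \<Rightarrow> real" where
  "cm_norm M \<nu> = measure (cm_var M \<nu>) (space M)"

definition jordan_pos :: "'a measure \<Rightarrow> ('a set \<Rightarrow> real) \<Rightarrow> 'a measure" where
  "jordan_pos M \<rho> = measure_of (space M) (sets M)
     (\<lambda>A. ennreal ((measure (cm_var M (\<lambda>B. complex_of_real (\<rho> B))) A + \<rho> A) / 2))"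

definition jordan_neg :: "'a measure \<Rightarrow> ('a set \<Rightarrow> real) \<Rightarrow> 'a measure" where
  "jordan_neg M \<rho> = measure_of (space M) (sets M)
     (\<lambda>A. ennreal ((measure (cm_var M (\<lambda>B. complex_of_real (\<rho> B))) A - \<rho> A) / 2))"

definition cm_integral :: "'a measure \<Rightarrow> ('a set \<Rightarrow> complex) \<Rightarrow> ('a \<Rightarrow> complex) \<Rightarrow> complex" where
  "cm_integral M \<nu> f =
     ((\<integral>x. f x \<partial>jordan_pos M (\<lambda>A. Re (\<nu> A))) - (\<integral>x. f x \<partial>jordan_neg M (\<lambda>A. Re (\<nu> A))))
     + \<i> * ((\<integral>x. f x \<partial>jordan_pos M (\<lambda>A. Im (\<nu> A))) - (\<integral>x. f x \<partial>jordan_neg M (\<lambda>A. Im (\<nu> A))))"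

text \<open>A Young function is represented as Phi :: real => ennreal, only its values on
[0,\<infinity>) matter; Phi(\<infinity>) = \<infinity> is implicit via the limit condition.\<close>
definition young_function :: "(real \<Rightarrow> ennreal) \<Rightarrow> bool" where
  "young_function \<Phi> \<longleftrightarrow>
     \<Phi> 0 = 0 \<and>
     (\<forall>x y t. 0 \<le> x \<longrightarrow> 0 \<le> y \<longrightarrow> 0 \<le> t \<longrightarrow> t \<le> 1 \<longrightarrow>
        \<Phi> (t * x + (1 - t) * y) \<le> ennreal t * \<Phi> x + ennreal (1 - t) * \<Phi> y) \<and>
     (\<Phi> \<longlongrightarrow> \<infinity>) at_top"

text \<open>Complementary function Psi(y) = sup{x y - Phi(x) : x \<ge> 0} (the sup is \<ge> 0,
terms with Phi(x) = \<infinity> contribute 0 via truncated subtraction in ennreal).\<close>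
definition complementary_young :: "(real \<Rightarrow> ennreal) \<Rightarrow> (real \<Rightarrow> ennreal)" where
  "complementary_young \<Phi> = (\<lambda>y. SUP x\<in>{0..}. ennreal (x * y) - \<Phi> x)"

definition delta2 :: "(real \<Rightarrow> ennreal) \<Rightarrow> bool" where
  "delta2 \<Phi> \<longleftrightarrow> (\<exists>K x0. K > 0 \<and> x0 > 0 \<and> (\<forall>x\<ge>x0. \<Phi> (2 * x) \<le> ennreal K * \<Phi> x))"

definition orlicz_space :: "(real \<Rightarrow> ennreal) \<Rightarrow> 'a measure \<Rightarrow> ('a \<Rightarrow> complex) set" where
  "orlicz_space \<Phi> m = {f \<in> borel_measurable m.
      \<exists>k>0. (\<integral>\<^sup>+ x. \<Phi> (cmod (f x) / k) \<partial>m) \<le> 1}"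

definition luxemburg_norm :: "(real \<Rightarrow> ennreal) \<Rightarrow> 'a measure \<Rightarrow> ('a \<Rightarrow> complex) \<Rightarrow> real" where
  "luxemburg_norm \<Phi> m f = Inf {k. k > 0 \<and> (\<integral>\<^sup>+ x. \<Phi> (cmod (f x) / k) \<partial>m) \<le> 1}"

text \<open>Orlicz norm on L^Psi, defined through Phi as in the paper:
  sup{ \<integral>|g h| : \<integral> Phi(|h|) \<le> 1 }.\<close>
definition orlicz_norm :: "(real \<Rightarrow> ennreal) \<Rightarrow> 'a measure \<Rightarrow> ('a \<Rightarrow> complex) \<Rightarrow> ennreal" where
  "orlicz_norm \<Phi> m g = (SUP h\<in>{h \<in> borel_measurable m. (\<integral>\<^sup>+ x. \<Phi> (cmod (h x)) \<partial>m) \<le> 1}.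
       \<integral>\<^sup>+ x. ennreal (cmod (g x * h x)) \<partial>m)"

definition convolution :: "('g::topological_group_add set \<Rightarrow> complex) \<Rightarrow> ('g \<Rightarrow> complex) \<Rightarrow> 'g \<Rightarrow> complex" where
  "convolution \<mu> f t = cm_integral borel \<mu> (\<lambda>s. f (- s + t))"

definition vmeasure :: "('g::topological_group_add set \<Rightarrow> complex) \<Rightarrow> 'g set \<Rightarrow> ('g \<Rightarrow> complex)" where
  "vmeasure \<mu> A = convolution \<mu> (indicator A)"

definition scalar_vmeasure :: "'g::topological_group_add measure \<Rightarrow> ('g set \<Rightarrow> complex) \<Rightarrow> ('g \<Rightarrow> complex) \<Rightarrow> 'g set \<Rightarrow> complex" where
  "scalar_vmeasure m \<mu> g A = (\<integral>t. vmeasure \<mu> A t * g t \<partial>m)"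

definition dual_space :: "(real \<Rightarrow> ennreal) \<Rightarrow> 'a measure \<Rightarrow> ('a \<Rightarrow> complex) set" where
  "dual_space \<Phi> m = orlicz_space (complementary_young \<Phi>) m"

definition dual_ball :: "(real \<Rightarrow> ennreal) \<Rightarrow> 'a measure \<Rightarrow> ('a \<Rightarrow> complex) set" where
  "dual_ball \<Phi> m = {g \<in> dual_space \<Phi> m. orlicz_norm \<Phi> m g \<le> 1}"

definition vm_L1 :: "(real \<Rightarrow> ennreal) \<Rightarrow> 'g::topological_group_add measure \<Rightarrow> ('g set \<Rightarrow> complex) \<Rightarrow> ('g \<Rightarrow> complex) \<Rightarrow> bool" where
  "vm_L1 \<Phi> m \<mu> f \<longleftrightarrow>
     f \<in> borel_measurable borel \<and>
     (\<forall>g\<in>dual_space \<Phi> m. integrable (cm_var borel (scalar_vmeasure m \<mu> g)) f) \<and>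
     (\<forall>A\<in>sets borel. \<exists>xA\<in>orlicz_space \<Phi> m.
        (\<forall>g\<in>dual_space \<Phi> m.
            cm_integral borel (scalar_vmeasure m \<mu> g) (\<lambda>x. indicator A x * f x) = (\<integral>t. xA t * g t \<partial>m)) \<and>
        (\<forall>y\<in>orlicz_space \<Phi> m.
            (\<forall>g\<in>dual_space \<Phi> m.
               cm_integral borel (scalar_vmeasure m \<mu> g) (\<lambda>x. indicator A x * f x) = (\<integral>t. y t * g t \<partial>m))
            \<longrightarrow> (AE t in m. y t = xA t)))"

definition vm_norm :: "(real \<Rightarrow> ennreal) \<Rightarrow> 'g::topological_group_add measure \<Rightarrow> ('g set \<Rightarrow> complex) \<Rightarrow> ('g \<Rightarrow> complex) \<Rightarrow> ennreal" where
  "vm_norm \<Phi> m \<mu> f = (SUP g\<in>dual_ball \<Phi> m.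
       \<integral>\<^sup>+ x. ennreal (cmod (f x)) \<partial>cm_var borel (scalar_vmeasure m \<mu> g))"

definition inclusion_norm :: "(real \<Rightarrow> ennreal) \<Rightarrow> 'g::topological_group_add measure \<Rightarrow> ('g set \<Rightarrow> complex) \<Rightarrow> ennreal" where
  "inclusion_norm \<Phi> m \<mu> = (SUP f\<in>{f \<in> orlicz_space \<Phi> m. luxemburg_norm \<Phi> m f \<le> 1}. vm_norm \<Phi> m \<mu> f)"

end

theory Submission
  imports Defs "HOL-Probability.Probability"
begin

text \<open>Write \<open>|\<mu>|\<close> for the variation of \<open>\<mu>\<close> and \<open>\<nu>\<^sub>g\<close> for the scalar measure paired with \<open>g\<close>. Pointwise
  \<open>|\<mu> * \<chi>\<^sub>A| \<le> |\<mu>| * \<chi>\<^sub>A\<close>, so the variation of \<open>\<nu>\<^sub>g\<close> is dominated by the positive measure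
  \<open>A \<mapsto> \<integral> |g| (|\<mu>| * \<chi>\<^sub>A) dm\<close>, and \<open>\<integral> |f| d|\<nu>\<^sub>g| \<le> \<integral> |g| (|\<mu>| * |f|) dm\<close>. By Jensen and Fubini
  \<open>|\<mu>| * |f| / (k \<parallel>\<mu>\<parallel>)\<close> is admissible in the Orlicz norm of \<open>g\<close> whenever \<open>\<integral> \<Phi>(|f| / k) dm \<le> 1\<close>, which
  gives the upper bound; constants give the lower one. The vector \<open>x\<^sub>A\<close> in the definition of
  \<open>L\<^sup>1(\<nu>)\<close> is \<open>\<mu> * (\<chi>\<^sub>A f)\<close>. The Fubini step \<open>\<integral> |\<mu>| * F dm \<le> \<parallel>\<mu>\<parallel> \<integral> F dm\<close> cannot be quoted for
  product measures, because the group need not be second countable; it is obtained from regularity.\<close>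

subsection \<open>Total variation\<close>

text \<open>The sharp constant can only come from comparing variations set by set: integrals against
  a complex measure are assembled from four Jordan parts, and bounding these separately costs a
  factor 4. That lossy bound is reserved for integrability, for majorants in limits and for
  membership in the Orlicz space, where constants do not matter. All of this is driven by one
  positive measure that dominates the complex one, with no density or polar decomposition. Of Fubini
  only an inequality is required, and it survives each approximation: from continuous functions up
  to open sets, then from open sets down to Borel sets. A second delicate point is that a Young
  function may take the value infinity and jump at the right end of the interval where it is finite.
  Jensen and the normalising constant \<open>d\<close> of the lower bound are therefore used after
  shrinking by a factor \<open>r < 1\<close>, which is later removed or absorbed into a
  constant.\<close>

definition variation :: "'a measure \<Rightarrow> ('a set \<Rightarrow> complex) \<Rightarrow> 'a set \<Rightarrow> ennreal" where
  "variation M \<nu> A = (SUP P\<in>{P. finite P \<and> disjoint P \<and> P \<subseteq> sets M \<and> \<Union>P = A}.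
            (\<Sum>B\<in>P. ennreal (cmod (\<nu> B))))"

lemma cm_var_eq: "cm_var M \<nu> = measure_of (space M) (sets M) (variation M \<nu>)"
  by (simp add: cm_var_def variation_def[abs_def])

lemma sets_cm_var[simp, measurable_cong]: "sets (cm_var M \<nu>) = sets M"
  by (simp add: cm_var_eq)

lemma space_cm_var[simp]: "space (cm_var M \<nu>) = space M"
  by (simp add: cm_var_eq)

lemma complex_measureD:
  "complex_measure M \<nu> \<Longrightarrow> range A \<subseteq> sets M \<Longrightarrow> disjoint_family A \<Longrightarrow> (\<lambda>n::nat. \<nu> (A n)) sums \<nu> (\<Union>n. A n)"
  unfolding complex_measure_def by blast

lemma complex_measure_empty:
  assumes "complex_measure M \<nu>" shows "\<nu> {} = 0"
proof -
  have "(\<lambda>n::nat. \<nu> {}) sums \<nu> (\<Union>n::nat. {})"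
    by (rule complex_measureD[OF assms]) (auto simp: disjoint_family_on_def)
  then have "(\<lambda>n::nat. \<nu> {}) \<longlonglongrightarrow> 0" by (intro summable_LIMSEQ_zero) (rule sums_summable)
  then show ?thesis by (simp add: LIMSEQ_const_iff)
qed

lemma variation_upper:
  assumes "finite P" "disjoint P" "P \<subseteq> sets M" "\<Union>P = A"
  shows "(\<Sum>B\<in>P. ennreal (cmod (\<nu> B))) \<le> variation M \<nu> A"
  unfolding variation_def using assms by (intro SUP_upper) auto

lemma variation_ge: "A \<in> sets M \<Longrightarrow> ennreal (cmod (\<nu> A)) \<le> variation M \<nu> A"
  using variation_upper[of "{A}" M A \<nu>] by (simp add: disjoint_def)

lemma variation_empty:
  assumes "\<nu> {} = 0" shows "variation M \<nu> {} = 0"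
proof -
  have "(\<Sum>B\<in>P. ennreal (cmod (\<nu> B))) \<le> 0" if "\<Union>P = {}" for P
    using that assms by (intro sum_nonpos) auto
  then show ?thesis unfolding variation_def by (intro antisym SUP_least) auto
qed

text \<open>A partition of \<open>A\<close> and a partition of \<open>B\<close> together partition
  the union. The only cell they can share is the empty set, which has mass 0, so merging them loses
  nothing.\<close>

lemma variation_superadd:
  assumes \<nu>: "\<nu> {} = 0" and "A \<in> sets M" "B \<in> sets M" "A \<inter> B = {}"
  shows "variation M \<nu> A + variation M \<nu> B \<le> variation M \<nu> (A \<union> B)"
proof -
  let ?p = "\<lambda>A. {P. finite P \<and> disjoint P \<and> P \<subseteq> sets M \<and> \<Union>P = A}"
  let ?s = "\<lambda>P. \<Sum>B\<in>P. ennreal (cmod (\<nu> B))"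
  have ne: "?p A \<noteq> {}" "?p B \<noteq> {}"
  proof -
    have "{A} \<in> ?p A" "{B} \<in> ?p B" using assms(2,3) by auto
    then show "?p A \<noteq> {}" "?p B \<noteq> {}" by (metis (lifting) empty_iff)+
  qed
  have *: "?s P + ?s Q \<le> variation M \<nu> (A \<union> B)" if "P \<in> ?p A" "Q \<in> ?p B" for P Q
  proof -
    have PQ: "x \<inter> y = {}" if "x \<in> P" "y \<in> Q" for x y
    proof -
      have "x \<subseteq> A" "y \<subseteq> B" using that \<open>P \<in> ?p A\<close> \<open>Q \<in> ?p B\<close> by auto
      then show ?thesis using assms(4) by blast
    qed
    then have "?s (P \<inter> Q) = 0" 
    proof (intro sum.neutral ballI)
      fix x assume "x \<in> P \<inter> Q"
      then have "x = {}" using PQ[of x x] by simp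
      then show "ennreal (cmod (\<nu> x)) = 0" using \<nu> by simp
    qed
    then have "?s P + ?s Q = ?s (P \<union> Q)"
      using sum.union_inter[of P Q "\<lambda>B. ennreal (cmod (\<nu> B))"] that by simp
    also have "\<dots> \<le> variation M \<nu> (A \<union> B)"
    proof (rule variation_upper)
      show "disjoint (P \<union> Q)"
      proof (rule disjointI)
        fix x y assume "x \<in> P \<union> Q" "y \<in> P \<union> Q" "x \<noteq> y"
        moreover have "disjoint P" "disjoint Q" using that by auto
        ultimately show "x \<inter> y = {}"
          using PQ[of x y] PQ[of y x] disjointD[of P x y] disjointD[of Q x y] by auto
      qed
    qed (use that in auto)
    finally show ?thesis .
  qed
  have "variation M \<nu> A + variation M \<nu> B = (SUP P\<in>?p A. SUP Q\<in>?p B. ?s P + ?s Q)"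
    unfolding variation_def
    by (subst ennreal_SUP_add_left[OF ne(1), symmetric], simp only: ennreal_SUP_add_right[OF ne(2)])
  also have "\<dots> \<le> variation M \<nu> (A \<union> B)"
    using * by (intro SUP_least) blast
  finally show ?thesis .
qed

lemma variation_mono:
  assumes \<nu>: "\<nu> {} = 0" and "A \<in> sets M" "B \<in> sets M" "A \<subseteq> B"
  shows "variation M \<nu> A \<le> variation M \<nu> B"
proof -
  have "variation M \<nu> A \<le> variation M \<nu> A + variation M \<nu> (B - A)" by simp
  also have "\<dots> \<le> variation M \<nu> (A \<union> (B - A))"
    using assms by (intro variation_superadd) auto
  also have "A \<union> (B - A) = B" using assms by auto
  finally show ?thesis .
qed

lemma cmod_sums_le:
  fixes f :: "nat \<Rightarrow> complex"
  assumes "f sums x"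
  shows "ennreal (cmod x) \<le> (\<Sum>n. ennreal (cmod (f n)))"
proof (rule LIMSEQ_le_const2)
  show "(\<lambda>n. ennreal (cmod (\<Sum>i<n. f i))) \<longlonglongrightarrow> ennreal (cmod x)"
    using assms unfolding sums_def by (intro tendsto_ennrealI tendsto_norm)
  have "ennreal (cmod (\<Sum>i<n. f i)) \<le> (\<Sum>n. ennreal (cmod (f n)))" for n
  proof -
    have "ennreal (cmod (\<Sum>i<n. f i)) \<le> (\<Sum>i<n. ennreal (cmod (f i)))"
      by (subst sum_ennreal) (auto intro!: ennreal_leI norm_sum)
    also have "\<dots> \<le> (\<Sum>n. ennreal (cmod (f n)))" by (rule sum_le_suminf) auto
    finally show ?thesis .
  qed
  then show "\<exists>N. \<forall>n\<ge>N. ennreal (cmod (\<Sum>i<n. f i)) \<le> (\<Sum>n. ennreal (cmod (f n)))" by blast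
qed

text \<open>One inequality is superadditivity on finite unions followed by monotonicity. For the
  other, each cell of a finite partition of the union is cut along the \<open>A i\<close>;
  additivity of \<open>\<nu>\<close> on the cell bounds its mass by the sum over its traces, and the
  traces on \<open>A i\<close> partition \<open>A i\<close>.\<close>

lemma variation_countably_additive:
  assumes \<nu>: "complex_measure M \<nu>"
  shows "countably_additive (sets M) (variation M \<nu>)"
proof (rule countably_additiveI)
  fix A :: "nat \<Rightarrow> 'a set"
  assume A: "range A \<subseteq> sets M" "disjoint_family A" "(\<Union>i. A i) \<in> sets M"
  note e = complex_measure_empty[OF \<nu>]
  let ?v = "variation M \<nu>"
  have fin: "(\<Sum>i<n. ?v (A i)) \<le> ?v (\<Union>i<n. A i)" for n
  proof (induction n)
    case 0 then show ?case by simp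
  next
    case (Suc n)
    have "(\<Sum>i<Suc n. ?v (A i)) \<le> ?v (\<Union>i<n. A i) + ?v (A n)" using Suc by simp
    also have "\<dots> \<le> ?v ((\<Union>i<n. A i) \<union> A n)"
    proof (intro variation_superadd e)
      have "A i \<inter> A n = {}" if "i < n" for i
        using disjoint_family_onD[OF A(2), of i n] that by simp
      then show "(\<Union>i<n. A i) \<inter> A n = {}" by auto
    qed (use A(1) in auto)
    also have "(\<Union>i<n. A i) \<union> A n = (\<Union>i<Suc n. A i)" by (auto simp: lessThan_Suc)
    finally show ?case .
  qed
  show "(\<Sum>i. ?v (A i)) = ?v (\<Union>i. A i)"
  proof (rule antisym)
    show "(\<Sum>i. ?v (A i)) \<le> ?v (\<Union>i. A i)"
      unfolding suminf_eq_SUP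
    proof (rule SUP_least)
      fix n
      have "?v (\<Union>i<n. A i) \<le> ?v (\<Union>i. A i)" using A by (intro variation_mono e) auto
      with fin[of n] show "(\<Sum>i<n. ?v (A i)) \<le> ?v (\<Union>i. A i)" by simp
    qed
    show "?v (\<Union>i. A i) \<le> (\<Sum>i. ?v (A i))"
      unfolding variation_def[of _ _ "\<Union>i. A i"]
    proof (rule SUP_least)
      fix P assume "P \<in> {P. finite P \<and> disjoint P \<and> P \<subseteq> sets M \<and> \<Union>P = \<Union>(range A)}"
      then have P: "finite P" "disjoint P" "P \<subseteq> sets M" "\<Union>P = \<Union>(range A)" by auto
      have "ennreal (cmod (\<nu> B)) \<le> (\<Sum>i. ennreal (cmod (\<nu> (B \<inter> A i))))" if "B \<in> P" for B
      proof (rule cmod_sums_le)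
        have "(\<lambda>i. \<nu> (B \<inter> A i)) sums \<nu> (\<Union>i. B \<inter> A i)"
          using A P that by (intro complex_measureD[OF \<nu>]) (auto simp: disjoint_family_on_def)
        moreover have "(\<Union>i. B \<inter> A i) = B" using P that by blast
        ultimately show "(\<lambda>i. \<nu> (B \<inter> A i)) sums \<nu> B" by simp
      qed
      then have "(\<Sum>B\<in>P. ennreal (cmod (\<nu> B))) \<le> (\<Sum>B\<in>P. \<Sum>i. ennreal (cmod (\<nu> (B \<inter> A i))))"
        by (intro sum_mono)
      also have "\<dots> = (\<Sum>i. \<Sum>B\<in>P. ennreal (cmod (\<nu> (B \<inter> A i))))"
        by (rule suminf_sum[symmetric]) auto
      also have "\<dots> \<le> (\<Sum>i. ?v (A i))"
      proof (rule suminf_le)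
        fix i
        \<comment> \<open>Distinct cells can have the same trace only if that trace is empty, so
          passing from the indexed sum to a sum over the set of traces drops only zeros.\<close>
        have "(\<Sum>B\<in>P. ennreal (cmod (\<nu> (B \<inter> A i)))) = (\<Sum>C\<in>(\<lambda>B. B \<inter> A i) ` P. ennreal (cmod (\<nu> C)))"
        proof (rule sum.reindex_nontrivial[symmetric, unfolded o_def])
          fix x y assume "x \<in> P" "y \<in> P" "x \<noteq> y" "x \<inter> A i = y \<inter> A i"
          then have "x \<inter> A i = {}" using disjointD[OF P(2), of x y] by blast
          then show "ennreal (cmod (\<nu> (x \<inter> A i))) = 0" using e by simp
        qed fact
        also have "\<dots> \<le> ?v (A i)"
        proof (rule variation_upper)
          show "disjoint ((\<lambda>B. B \<inter> A i) ` P)"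
            by (rule disjointI) (use disjointD[OF P(2)] in blast)
        qed (use P A in auto)
        finally show "(\<Sum>B\<in>P. ennreal (cmod (\<nu> (B \<inter> A i)))) \<le> ?v (A i)" .
      qed auto
      finally show "(\<Sum>B\<in>P. ennreal (cmod (\<nu> B))) \<le> (\<Sum>i. ?v (A i))" .
    qed
  qed
qed

text \<open>\<open>measure_of\<close> yields the zero measure unless its set function is countably
  additive; only the preceding additivity result gives \<open>cm_var\<close> its intended
  values.\<close>

lemma emeasure_cm_var:
  assumes "complex_measure M \<nu>" "A \<in> sets M"
  shows "emeasure (cm_var M \<nu>) A = variation M \<nu> A"
  unfolding cm_var_eq
  using assms variation_countably_additive[OF assms(1)]
    variation_empty[of \<nu> M, OF complex_measure_empty[OF assms(1)]]
  by (intro emeasure_measure_of_sigma) (auto simp: positive_def sets.sigma_algebra_axioms)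

lemma cmod_le_cm_var:
  assumes "complex_measure M \<nu>" "A \<in> sets M"
  shows "ennreal (cmod (\<nu> A)) \<le> emeasure (cm_var M \<nu>) A"
  using assms by (simp add: emeasure_cm_var variation_ge)

text \<open>Summing the hypothesis over a partition costs nothing because \<open>N\<close> is
  additive. This minimality bounds a variation without computing it.\<close>

lemma cm_var_least:
  assumes \<nu>: "complex_measure M \<nu>" and A: "A \<in> sets M" and s: "sets N = sets M"
    and le: "\<And>A. A \<in> sets M \<Longrightarrow> ennreal (cmod (\<nu> A)) \<le> emeasure N A"
  shows "emeasure (cm_var M \<nu>) A \<le> emeasure N A"
  unfolding emeasure_cm_var[OF \<nu> A] variation_def
proof (rule SUP_least)
  fix P assume "P \<in> {P. finite P \<and> disjoint P \<and> P \<subseteq> sets M \<and> \<Union>P = A}"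
  then have P: "finite P" "disjoint P" "P \<subseteq> sets M" "\<Union>P = A" by auto
  have "(\<Sum>B\<in>P. ennreal (cmod (\<nu> B))) \<le> (\<Sum>B\<in>P. emeasure N B)"
    using P le by (intro sum_mono) auto
  also have "\<dots> = emeasure N (\<Union>B\<in>P. B)"
    using P s by (intro sum_emeasure) (auto simp: disjoint_family_on_def disjoint_def)
  finally show "(\<Sum>B\<in>P. ennreal (cmod (\<nu> B))) \<le> emeasure N A" using P by simp
qed

lemma le_measureI:
  assumes "sets N = sets M" "\<And>A. A \<in> sets M \<Longrightarrow> emeasure M A \<le> emeasure N A"
  shows "M \<le> N"
  using assms sets_eq_imp_space_eq[OF assms(1)] le_measure[of M N]
  by (metis emeasure_notin_sets le_fun_def order_refl)

subsection \<open>Jordan parts and the integral of a complex measure\<close>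

lemma complex_measure_bounded:
  assumes "complex_measure M \<nu>" "finite_measure (cm_var M \<nu>)" "A \<in> sets M"
  shows "cmod (\<nu> A) \<le> measure (cm_var M \<nu>) A"
  using cmod_le_cm_var[OF assms(1,3)] finite_measure.emeasure_eq_measure[OF assms(2)] by simp

lemma complex_measure_Re:
  assumes "complex_measure M \<nu>"
  shows "complex_measure M (\<lambda>B. complex_of_real (Re (\<nu> B)))"
  unfolding complex_measure_def
  by (auto intro!: sums_of_real sums_Re complex_measureD[OF assms])

lemma complex_measure_Im:
  assumes "complex_measure M \<nu>"
  shows "complex_measure M (\<lambda>B. complex_of_real (Im (\<nu> B)))"
  unfolding complex_measure_def
  by (auto intro!: sums_of_real sums_Im complex_measureD[OF assms])

text \<open>The sign \<open>s\<close> treats both Jordan parts at once. Since the variation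
  dominates the absolute value of \<open>\<rho>\<close>, the half sum is nonnegative, so
  \<open>ennreal\<close> truncates nothing and additivity carries over.\<close>

lemma emeasure_jordan_part:
  fixes \<rho> :: "'a set \<Rightarrow> real"
  assumes \<rho>: "complex_measure M (\<lambda>B. complex_of_real (\<rho> B))"
    and V: "finite_measure (cm_var M (\<lambda>B. complex_of_real (\<rho> B)))"
    and s: "\<bar>s\<bar> = 1" and A: "A \<in> sets M"
  shows "emeasure (measure_of (space M) (sets M)
     (\<lambda>A. ennreal ((measure (cm_var M (\<lambda>B. complex_of_real (\<rho> B))) A + s * \<rho> A) / 2))) A
    = ennreal ((measure (cm_var M (\<lambda>B. complex_of_real (\<rho> B))) A + s * \<rho> A) / 2)"
proof (rule emeasure_measure_of_sigma)
  let ?V = "cm_var M (\<lambda>B. complex_of_real (\<rho> B))"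
  interpret finite_measure ?V by fact
  have e: "\<rho> {} = 0" using complex_measure_empty[OF \<rho>] by simp
  have nn: "0 \<le> (measure ?V A + s * \<rho> A) / 2" if "A \<in> sets M" for A
  proof -
    have "cmod (complex_of_real (\<rho> A)) \<le> measure ?V A"
      by (rule complex_measure_bounded[OF \<rho> V that])
    then have "\<bar>s * \<rho> A\<bar> \<le> measure ?V A"
      unfolding abs_mult s by (simp only: norm_of_real mult_1)
    moreover have "\<bar>x\<bar> \<le> y \<Longrightarrow> 0 \<le> (y + x) / 2" for x y :: real by simp
    ultimately show ?thesis by blast
  qed
  show "positive (sets M) (\<lambda>A. ennreal ((measure ?V A + s * \<rho> A) / 2))"
    by (simp add: positive_def e)
  show "countably_additive (sets M) (\<lambda>A. ennreal ((measure ?V A + s * \<rho> A) / 2))"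
  proof (rule countably_additiveI)
    fix A :: "nat \<Rightarrow> 'a set"
    assume A: "range A \<subseteq> sets M" "disjoint_family A" "(\<Union>i. A i) \<in> sets M"
    have "(\<lambda>i. measure ?V (A i)) sums measure ?V (\<Union>i. A i)"
      using A by (intro finite_measure_UNION) auto
    moreover have "(\<lambda>i. \<rho> (A i)) sums \<rho> (\<Union>i. A i)"
      using complex_measureD[OF \<rho> A(1,2)] by (simp add: sums_of_real_iff)
    ultimately have "(\<lambda>i. (measure ?V (A i) + s * \<rho> (A i)) / 2) sums
      ((measure ?V (\<Union>i. A i) + s * \<rho> (\<Union>i. A i)) / 2)"
      by (intro sums_divide sums_add sums_mult)
    then have "(\<lambda>i. ennreal ((measure ?V (A i) + s * \<rho> (A i)) / 2)) sums
      ennreal ((measure ?V (\<Union>i. A i) + s * \<rho> (\<Union>i. A i)) / 2)"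
      using A nn by (subst sums_ennreal) auto
    then show "(\<Sum>i. ennreal ((measure ?V (A i) + s * \<rho> (A i)) / 2)) =
      ennreal ((measure ?V (\<Union>i. A i) + s * \<rho> (\<Union>i. A i)) / 2)"
      by (rule sums_unique[symmetric])
  qed
qed (use A sets.sigma_algebra_axioms in auto)

lemma emeasure_jordan:
  fixes \<rho> :: "'a set \<Rightarrow> real"
  assumes \<rho>: "complex_measure M (\<lambda>B. complex_of_real (\<rho> B))"
    and V: "finite_measure (cm_var M (\<lambda>B. complex_of_real (\<rho> B)))"
    and A: "A \<in> sets M"
  shows "emeasure (jordan_pos M \<rho>) A = ennreal ((measure (cm_var M (\<lambda>B. complex_of_real (\<rho> B))) A + \<rho> A) / 2)"
    and "emeasure (jordan_neg M \<rho>) A = ennreal ((measure (cm_var M (\<lambda>B. complex_of_real (\<rho> B))) A - \<rho> A) / 2)"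
  using emeasure_jordan_part[OF \<rho> V _ A, of 1] emeasure_jordan_part[OF \<rho> V _ A, of "-1"]
  by (simp_all add: jordan_pos_def jordan_neg_def)

lemma sets_jordan[simp, measurable_cong]:
  "sets (jordan_pos M \<rho>) = sets M" "sets (jordan_neg M \<rho>) = sets M"
  by (simp_all add: jordan_pos_def jordan_neg_def)

lemma space_jordan[simp]:
  "space (jordan_pos M \<rho>) = space M" "space (jordan_neg M \<rho>) = space M"
  by (simp_all add: jordan_pos_def jordan_neg_def)

text \<open>One finite positive \<open>L\<close> above \<open>\<nu>\<close> makes the variation
  finite and controls all four Jordan parts, so a single integrability condition with respect to
  \<open>L\<close> suffices. It is used with \<open>L\<close> the variation of \<open>\<mu>\<close>,
  and with \<open>L\<close> a weighted convolution for the scalar measures.\<close>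

locale dominated_cm =
  fixes M :: "'a measure" and \<nu> :: "'a set \<Rightarrow> complex" and L :: "'a measure"
  assumes cm: "complex_measure M \<nu>"
    and sets_L: "sets L = sets M"
    and fin_L: "finite_measure L"
    and dom: "A \<in> sets M \<Longrightarrow> ennreal (cmod (\<nu> A)) \<le> emeasure L A"
begin

lemma cm_var_le: "cm_var M \<nu> \<le> L"
proof (rule le_measureI)
  fix A assume "A \<in> sets (cm_var M \<nu>)"
  then show "emeasure (cm_var M \<nu>) A \<le> emeasure L A"
    using dom by (intro cm_var_least[OF cm _ sets_L]) simp_all
qed (simp add: sets_L)

lemma finite_cm_var: "finite_measure (cm_var M \<nu>)"
proof (rule finite_measureI)
  have "emeasure (cm_var M \<nu>) (space M) \<le> emeasure L (space M)"
    by (rule le_measureD3[OF cm_var_le]) (simp add: sets_L)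
  also have "\<dots> < \<infinity>" using finite_measure.emeasure_finite[OF fin_L] by (simp add: less_top[symmetric])
  finally show "emeasure (cm_var M \<nu>) (space (cm_var M \<nu>)) \<noteq> \<infinity>" by simp
qed

lemma dominated_part:
  assumes "complex_measure M (\<lambda>B. complex_of_real (\<rho> B))" "\<And>A. A \<in> sets M \<Longrightarrow> \<bar>\<rho> A\<bar> \<le> cmod (\<nu> A)"
  shows "dominated_cm M (\<lambda>B. complex_of_real (\<rho> B)) L"
proof (rule dominated_cm.intro)
  fix A assume A: "A \<in> sets M"
  have "ennreal (cmod (complex_of_real (\<rho> A))) \<le> ennreal (cmod (\<nu> A))"
    using assms(2)[OF A] by (intro ennreal_leI) simp
  then show "ennreal (cmod (complex_of_real (\<rho> A))) \<le> emeasure L A"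
    using dom[OF A] by (rule order_trans)
qed (fact assms(1) sets_L fin_L)+

lemma dominated_Re: "dominated_cm M (\<lambda>B. complex_of_real (Re (\<nu> B))) L"
  and dominated_Im: "dominated_cm M (\<lambda>B. complex_of_real (Im (\<nu> B))) L"
  by (rule dominated_part, rule complex_measure_Re[OF cm], rule abs_Re_le_cmod,
      rule dominated_part, rule complex_measure_Im[OF cm], rule abs_Im_le_cmod)

end

lemma (in finite_measure) finite_measure_mono_sets:
  assumes "N \<le> M" "sets N = sets M" shows "finite_measure N"
proof (rule finite_measureI)
  have "emeasure N (space N) \<le> emeasure M (space N)" using assms by (simp add: le_measureD3)
  also have "\<dots> < \<infinity>" by (simp add: less_top[symmetric])
  finally show "emeasure N (space N) \<noteq> \<infinity>" by simp
qed

lemma jordan_le: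
  fixes \<rho> :: "'a set \<Rightarrow> real"
  assumes "dominated_cm M (\<lambda>B. complex_of_real (\<rho> B)) L"
  shows "jordan_pos M \<rho> \<le> L" "jordan_neg M \<rho> \<le> L"
proof -
  interpret dominated_cm M "\<lambda>B. complex_of_real (\<rho> B)" L by fact
  let ?V = "cm_var M (\<lambda>B. complex_of_real (\<rho> B))"
  interpret V: finite_measure ?V by (rule finite_cm_var)
  have b: "\<bar>\<rho> A\<bar> \<le> measure ?V A" if "A \<in> sets M" for A
    using complex_measure_bounded[OF cm finite_cm_var that] by simp
  have "emeasure (jordan_pos M \<rho>) A \<le> emeasure L A \<and> emeasure (jordan_neg M \<rho>) A \<le> emeasure L A"
    if A: "A \<in> sets M" for A
  proof -
    have "ennreal ((measure ?V A + \<rho> A) / 2) \<le> emeasure ?V A"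
      "ennreal ((measure ?V A - \<rho> A) / 2) \<le> emeasure ?V A"
      using b[OF A] by (auto simp: V.emeasure_eq_measure intro!: ennreal_leI)
    moreover have "emeasure ?V A \<le> emeasure L A"
      by (rule le_measureD3[OF cm_var_le]) (simp add: sets_L)
    ultimately show ?thesis
      unfolding emeasure_jordan[OF cm finite_cm_var A] by (blast intro: order_trans)
  qed
  then show "jordan_pos M \<rho> \<le> L" "jordan_neg M \<rho> \<le> L"
    by (auto intro!: le_measureI simp: sets_L)
qed

lemma measure_jordan_diff:
  fixes \<rho> :: "'a set \<Rightarrow> real"
  assumes "dominated_cm M (\<lambda>B. complex_of_real (\<rho> B)) L" and A: "A \<in> sets M"
  shows "measure (jordan_pos M \<rho>) A - measure (jordan_neg M \<rho>) A = \<rho> A"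
proof -
  interpret dominated_cm M "\<lambda>B. complex_of_real (\<rho> B)" L by fact
  have "\<bar>\<rho> A\<bar> \<le> measure (cm_var M (\<lambda>B. complex_of_real (\<rho> B))) A"
    using complex_measure_bounded[OF cm finite_cm_var A] by simp
  then show ?thesis
    by (simp add: measure_def emeasure_jordan[OF cm finite_cm_var A] enn2real_ennreal)
      (simp add: field_simps)
qed

section \<open>Integrals with respect to a dominated complex measure\<close>

lemma integrable_mono_measure:
  fixes f :: "'a \<Rightarrow> 'b::{banach, second_countable_topology}"
  assumes "N \<le> M" "sets N = sets M" "integrable M f"
  shows "integrable N f"
proof (rule integrableI_bounded)
  show "f \<in> borel_measurable N"
    using borel_measurable_integrable[OF assms(3)] by (subst measurable_cong_sets[OF assms(2) refl])
  have "(\<integral>\<^sup>+x. norm (f x) \<partial>N) \<le> (\<integral>\<^sup>+x. norm (f x) \<partial>M)"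
    by (rule nn_integral_mono_measure) fact+
  also have "\<dots> < \<infinity>" using assms(3) by (simp add: integrable_iff_bounded)
  finally show "(\<integral>\<^sup>+x. norm (f x) \<partial>N) < \<infinity>" .
qed

lemma norm_integral_mono_measure:
  fixes f :: "'a \<Rightarrow> 'b::{banach, second_countable_topology}"
  assumes "N \<le> M" "sets N = sets M"
  shows "ennreal (norm (\<integral>x. f x \<partial>N)) \<le> (\<integral>\<^sup>+x. norm (f x) \<partial>M)"
\<comment> \<open>For a nonintegrable \<open>f\<close> the Bochner integral is 0 by default and the
  bound is trivial.\<close>
proof (cases "integrable N f")
  case True
  have "ennreal (norm (\<integral>x. f x \<partial>N)) \<le> (\<integral>\<^sup>+x. norm (f x) \<partial>N)"
    by (rule integral_norm_bound_ennreal) fact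
  also have "\<dots> \<le> (\<integral>\<^sup>+x. norm (f x) \<partial>M)" by (rule nn_integral_mono_measure) fact+
  finally show ?thesis .
qed (simp add: not_integrable_integral_eq)

context dominated_cm
begin

abbreviation "jp \<equiv> jordan_pos M (\<lambda>A. Re (\<nu> A))"
abbreviation "jn \<equiv> jordan_neg M (\<lambda>A. Re (\<nu> A))"
abbreviation "kp \<equiv> jordan_pos M (\<lambda>A. Im (\<nu> A))"
abbreviation "kn \<equiv> jordan_neg M (\<lambda>A. Im (\<nu> A))"

lemma parts_le: "jp \<le> L" "jn \<le> L" "kp \<le> L" "kn \<le> L"
  by (rule jordan_le[OF dominated_Re] jordan_le[OF dominated_Im])+

lemma integrable_parts:
  fixes f :: "'a \<Rightarrow> 'b::{banach, second_countable_topology}"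
  assumes "integrable L f"
  shows "integrable jp f" "integrable jn f" "integrable kp f" "integrable kn f"
  by (rule integrable_mono_measure[OF _ _ assms], rule parts_le, simp add: sets_L)+

lemma cm_integral_indicator:
  assumes A: "A \<in> sets M"
  shows "cm_integral M \<nu> (indicator A) = \<nu> A"
proof -
  have i: "(\<integral>x. (indicator A x :: complex) \<partial>N) = complex_of_real (measure N A)"
    if "sets N = sets M" for N
  proof -
    have "A \<in> sets N" using that A by simp
    then have "(\<integral>x. complex_of_real (indicator A x) \<partial>N) = complex_of_real (measure N A)"
      by (simp add: integral_complex_of_real sets.Int_space_eq2)
    then show ?thesis by (simp add: of_real_indicator)
  qed
  have "complex_of_real (Re (\<nu> A)) + \<i> * complex_of_real (Im (\<nu> A)) = \<nu> A"
    by (rule complex_eq[symmetric])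
  then show ?thesis
    unfolding cm_integral_def
    by (simp add: i measure_jordan_diff[OF dominated_Re A] measure_jordan_diff[OF dominated_Im A]
      flip: of_real_diff)
qed

lemma cm_integral_add:
  assumes "integrable L f" "integrable L g"
  shows "cm_integral M \<nu> (\<lambda>x. f x + g x) = cm_integral M \<nu> f + cm_integral M \<nu> g"
  unfolding cm_integral_def using integrable_parts[OF assms(1)] integrable_parts[OF assms(2)]
  by simp (simp add: algebra_simps)

lemma cm_integral_mult_right:
  shows "cm_integral M \<nu> (\<lambda>x. f x * c) = cm_integral M \<nu> f * c"
  unfolding cm_integral_def by (simp add: distrib_right left_diff_distrib mult.assoc)

text \<open>Each of the four Jordan parts lies below \<open>L\<close> and contributes one copy of
  the integral; hence the constant 4.\<close>

lemma cmod_cm_integral_le: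
  "ennreal (cmod (cm_integral M \<nu> f)) \<le> 4 * (\<integral>\<^sup>+x. cmod (f x) \<partial>L)"
proof -
  let ?I = "\<integral>\<^sup>+x. cmod (f x) \<partial>L"
  have b: "ennreal (cmod (\<integral>x. f x \<partial>jp)) \<le> ?I" "ennreal (cmod (\<integral>x. f x \<partial>jn)) \<le> ?I"
    "ennreal (cmod (\<integral>x. f x \<partial>kp)) \<le> ?I" "ennreal (cmod (\<integral>x. f x \<partial>kn)) \<le> ?I"
    by (intro norm_integral_mono_measure parts_le; simp add: sets_L)+
  have "cmod (a - b + \<i> * (c - d)) \<le> cmod a + cmod b + (cmod c + cmod d)" for a b c d
    by (rule norm_triangle_le) (simp add: norm_mult add_mono norm_triangle_ineq4)
  then have "ennreal (cmod (cm_integral M \<nu> f)) \<le> ennreal (cmod (\<integral>x. f x \<partial>jp) + cmod (\<integral>x. f x \<partial>jn)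
      + (cmod (\<integral>x. f x \<partial>kp) + cmod (\<integral>x. f x \<partial>kn)))"
    unfolding cm_integral_def by (rule ennreal_leI)
  also have "\<dots> \<le> ?I + ?I + (?I + ?I)"
    using b by (simp add: ennreal_plus add_mono del: ennreal_plus[symmetric])
  also have "\<dots> = 4 * ?I" by (simp only: mult_2[symmetric]) (simp add: mult.assoc[symmetric])
  finally show ?thesis .
qed

lemma cm_integral_dominated_convergence:
  assumes f: "f \<in> borel_measurable M" and s: "\<And>i. s i \<in> borel_measurable M"
    and w: "integrable L w" and lim: "\<And>x. x \<in> space M \<Longrightarrow> (\<lambda>i. s i x) \<longlonglongrightarrow> f x"
    and b: "\<And>i x. x \<in> space M \<Longrightarrow> cmod (s i x) \<le> w x"
  shows "(\<lambda>i. cm_integral M \<nu> (s i)) \<longlonglongrightarrow> cm_integral M \<nu> f"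
proof -
  have "(\<lambda>i. \<integral>x. s i x \<partial>N) \<longlonglongrightarrow> (\<integral>x. f x \<partial>N)" if "sets N = sets M" "integrable N w" for N
  proof (rule integral_dominated_convergence[where w = w])
    have sp: "space N = space M" using that(1) by (rule sets_eq_imp_space_eq)
    show "f \<in> borel_measurable N" "s i \<in> borel_measurable N" for i
      using f s by (simp_all only: measurable_cong_sets[OF that(1) refl])
    show "AE x in N. (\<lambda>i. s i x) \<longlonglongrightarrow> f x" "AE x in N. norm (s i x) \<le> w x" for i
      by (rule AE_I2, simp only: sp lim b)+
  qed fact
  then show ?thesis
    unfolding cm_integral_def
    by (intro tendsto_add tendsto_diff tendsto_mult tendsto_const; simp add: integrable_parts[OF w])
qed

end

subsection \<open>Measurability of convolutions\<close>

text \<open>Reduces measurability of a parametrised integral to its values on sets; no joint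
  measurability in the parameter and the variable enters.\<close>

lemma kernel_nn_integral_measurable:
  assumes K: "\<And>t. sets (K t) = sets N" "\<And>A. A \<in> sets N \<Longrightarrow> (\<lambda>t. emeasure (K t) A) \<in> borel_measurable M"
    and f: "f \<in> borel_measurable N"
  shows "(\<lambda>t. \<integral>\<^sup>+x. f x \<partial>K t) \<in> borel_measurable M"
  using f
proof induct
  case (cong f g)
  have "(\<integral>\<^sup>+x. f x \<partial>K t) = (\<integral>\<^sup>+x. g x \<partial>K t)" for t
    using cong sets_eq_imp_space_eq[OF K(1)] by (intro nn_integral_cong) simp
  with cong show ?case by simp
next
  case (set B)
  then show ?case using K by simp
next
  case (mult f c)
  then show ?case using K(1) by (subst nn_integral_cmult) (simp_all cong: measurable_cong_sets)
next
  case (add f g)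
  then show ?case using K(1) by (subst nn_integral_add) (simp_all cong: measurable_cong_sets)
next
  case (seq F)
  then have "(\<lambda>t. SUP i. \<integral>\<^sup>+x. F i x \<partial>K t) \<in> borel_measurable M" by simp
  moreover have "(\<integral>\<^sup>+x. (SUP i. F i) x \<partial>K t) = (SUP i. \<integral>\<^sup>+x. F i x \<partial>K t)" for t
    unfolding SUP_apply using seq K(1)
    by (intro nn_integral_monotone_convergence_SUP) (simp_all cong: measurable_cong_sets)
  ultimately show ?case by simp
qed

lemma kernel_integral_measurable:
  fixes f :: "'a \<Rightarrow> 'b::{banach, second_countable_topology}"
  assumes K: "\<And>t. sets (K t) = sets N" "\<And>t. finite_measure (K t)"
      "\<And>A. A \<in> sets N \<Longrightarrow> (\<lambda>t. emeasure (K t) A) \<in> borel_measurable M"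
    and f: "f \<in> borel_measurable N"
  shows "(\<lambda>t. \<integral>x. f x \<partial>K t) \<in> borel_measurable M"
proof -
  from borel_measurable_implies_sequence_metric[OF f, of 0]
  obtain F where F: "\<And>i. simple_function N (F i)"
    "\<And>x. x \<in> space N \<Longrightarrow> (\<lambda>i. F i x) \<longlonglongrightarrow> f x"
    "\<And>i x. x \<in> space N \<Longrightarrow> norm (F i x) \<le> 2 * norm (f x)"
    unfolding norm_conv_dist by blast
  have sp: "space (K t) = space N" for t using K(1) by (rule sets_eq_imp_space_eq)
  have "(\<lambda>t. \<integral>\<^sup>+x. norm (f x) \<partial>K t) \<in> borel_measurable M"
    using f by (intro kernel_nn_integral_measurable[OF K(1,3)]) auto
  moreover have int: "integrable (K t) f \<longleftrightarrow> (\<integral>\<^sup>+x. norm (f x) \<partial>K t) < \<infinity>" for t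
    using f by (simp add: integrable_iff_bounded measurable_cong_sets[OF K(1) refl])
  ultimately have I[measurable]: "Measurable.pred M (\<lambda>t. integrable (K t) f)"
    by simp
  \<comment> \<open>Where \<open>f\<close> is not integrable the integrals of the approximants need
    not converge. Setting them to 0 there matches the default value of the integral of
    \<open>f\<close>, so the limit is correct for every \<open>t\<close>.\<close>
  define G where "G i t = (if integrable (K t) f then \<integral>x. F i x \<partial>K t else 0)" for i t
  have "G i \<in> borel_measurable M" for i
  proof -
    have *: "(\<integral>x. F i x \<partial>K t) = (\<Sum>y\<in>F i ` space N. measure (K t) {x\<in>space N. F i x = y} *\<^sub>R y)" for t
    proof -
      have s: "simple_function (K t) (F i)" using F(1)[of i] K(1)[of t] sp[of t] by (simp add: simple_function_def)
      have "(\<integral>x. F i x \<partial>K t) = Bochner_Integration.simple_bochner_integral (K t) (F i)"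
        using s finite_measure.emeasure_finite[OF K(2)]
        by (subst simple_bochner_integrable_eq_integral) (auto simp: simple_bochner_integrable.simps)
      then show ?thesis unfolding simple_bochner_integral_def by (simp add: sp)
    qed
    have "(\<lambda>t. measure (K t) {x\<in>space N. F i x = y}) \<in> borel_measurable M" for y
    proof -
      have "{x\<in>space N. F i x = y} \<in> sets N"
        using simple_functionD(2)[OF F(1)[of i], of "{y}"] by (simp add: vimage_def Int_def conj_commute)
      from K(3)[OF this] show ?thesis unfolding measure_def by measurable
    qed
    then show ?thesis unfolding G_def * by measurable
  qed
  moreover have "(\<lambda>i. G i t) \<longlonglongrightarrow> (\<integral>x. f x \<partial>K t)" for t
  proof (cases "integrable (K t) f")
    case True
    have "(\<lambda>i. \<integral>x. F i x \<partial>K t) \<longlonglongrightarrow> (\<integral>x. f x \<partial>K t)"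
    proof (rule integral_dominated_convergence[where w="\<lambda>x. 2 * norm (f x)"])
      show "F i \<in> borel_measurable (K t)" for i
        using borel_measurable_simple_function[OF F(1)] by (simp add: measurable_cong_sets[OF K(1) refl])
    qed (use True F(2,3) sp in auto)
    then show ?thesis using True by (simp add: G_def)
  qed (simp add: G_def not_integrable_integral_eq)
  ultimately show ?thesis
    by (rule borel_measurable_LIMSEQ_metric)
qed

text \<open>The tube lemma for conditions depending on a parameter. It takes the place of uniform
  continuity in the semicontinuity and Riemann sum arguments.\<close>

lemma open_Ball_compact:
  assumes "compact K" "open W"
  shows "open {t. \<forall>s\<in>K. (t, s) \<in> W}"
proof (subst open_subopen, safe)
  fix t assume "\<forall>s\<in>K. (t, s) \<in> W"
  then have "{t} \<times> K \<subseteq> W" by auto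
  from Elementary_Topology.tube_lemma[OF assms this]
  obtain X where "t \<in> X" "open X" "X \<times> K \<subseteq> W" by blast
  then show "\<exists>T. open T \<and> t \<in> T \<and> T \<subseteq> {t. \<forall>s\<in>K. (t, s) \<in> W}" by blast
qed

lemma translate_borel_measurable[measurable]:
  fixes t :: "'g::topological_group_add"
  shows "(\<lambda>s. - s + t) \<in> borel_measurable borel" "(\<lambda>s. t + s) \<in> borel_measurable borel"
  by (rule borel_measurable_continuous_onI,
      intro continuous_on_add continuous_on_minus continuous_on_id continuous_on_const)+

lemma translate_set_borel:
  fixes t :: "'g::topological_group_add"
  assumes "A \<in> sets borel" shows "{s. - s + t \<in> A} \<in> sets borel"
  using measurable_sets[OF translate_borel_measurable(1)[of t] assms] by (simp add: vimage_def)

lemma radonD: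
  assumes "radon_measure R"
  shows "sets R = sets borel" "space R = UNIV" "finite_measure R"
proof -
  show s: "sets R = sets borel" using assms by (simp add: radon_measure_def)
  show "space R = UNIV" using sets_eq_imp_space_eq[OF s] by simp
  show "finite_measure R" using assms by (intro finite_measureI) (auto simp: radon_measure_def)
qed

lemma radon_open_superset:
  assumes R: "radon_measure R" and A: "A \<in> sets borel" and e: "e > 0"
  obtains U where "open U" "A \<subseteq> U" "measure R U < measure R A + e"
proof -
  interpret finite_measure R by (rule radonD[OF R])
  have "(INF U\<in>{U. open U \<and> A \<subseteq> U}. emeasure R U) = emeasure R A"
    using R A unfolding radon_measure_def by metis
  also have "\<dots> < ennreal (measure R A + e)"
    using e by (simp add: emeasure_eq_measure ennreal_less_iff)
  finally obtain U where "open U" "A \<subseteq> U" "emeasure R U < ennreal (measure R A + e)"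
    by (auto simp: INF_less_iff)
  then show ?thesis using that by (auto simp: emeasure_eq_measure ennreal_less_iff)
qed

lemma radon_compact_subset:
  assumes R: "radon_measure R" and U: "open U" and c: "c < emeasure R U"
  obtains K where "compact K" "K \<subseteq> U" "c < emeasure R K"
proof -
  have "c < (SUP K\<in>{K. compact K \<and> K \<subseteq> U}. emeasure R K)"
    using R U c unfolding radon_measure_def by metis
  then show ?thesis using that by (auto simp: less_SUP_iff)
qed

text \<open>The set of all \<open>s\<close> with \<open>- s + t \<in> K\<close> is
  \<open>t + - K\<close>, which stays inside an open \<open>U\<close> for parameters near
  \<open>t\<close> because \<open>K\<close> is compact. \<open>P\<close> need not be known to be
  regular: an open \<open>U\<close> chosen for \<open>R\<close> also serves \<open>P\<close>, since
  the excess of \<open>U\<close> has smaller \<open>P\<close>-mass than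
  \<open>R\<close>-mass.\<close>

lemma translate_upper_semicontinuous:
  fixes P R :: "'g::{topological_group_add, t2_space} measure"
  assumes comp: "compact (UNIV :: 'g set)" and R: "radon_measure R"
    and P: "P \<le> R" "sets P = sets borel" and K: "closed K"
  shows "open {t. emeasure P {s. - s + t \<in> K} < c}"
proof (subst open_subopen, safe)
  let ?S = "\<lambda>t. {s. - s + t \<in> K}"
  fix t assume lt: "emeasure P (?S t) < c"
  interpret R: finite_measure R by (rule radonD[OF R])
  have "finite_measure P" by (rule R.finite_measure_mono_sets) (simp_all add: P radonD[OF R])
  then interpret P: finite_measure P .
  have S: "?S t \<in> sets borel" using K by (intro translate_set_borel) auto
  \<comment> \<open>The room between the value at \<open>t\<close> and \<open>c\<close>; if
    \<open>c\<close> is infinite, any positive \<open>e\<close> will do.\<close>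
  have "\<exists>e>0. ennreal (measure P (?S t) + e) \<le> c"
  proof (cases c)
    case (real r)
    then show ?thesis using lt
      by (intro exI[of _ "r - measure P (?S t)"]) (auto simp: P.emeasure_eq_measure ennreal_less_iff)
  qed (auto intro: exI[of _ 1])
  then obtain e where e: "e > 0" "ennreal (measure P (?S t) + e) \<le> c" by blast
  obtain U where U: "open U" "?S t \<subseteq> U" "measure R U < measure R (?S t) + e"
    using radon_open_superset[OF R S e(1)] .
  have "emeasure P (U - ?S t) \<le> emeasure R (U - ?S t)"
    by (rule le_measureD3[OF P(1)]) (simp add: P radonD[OF R])
  then have "measure P (U - ?S t) \<le> measure R (U - ?S t)"
    by (simp add: P.emeasure_eq_measure R.emeasure_eq_measure)
  moreover have "measure R (U - ?S t) = measure R U - measure R (?S t)"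
    using U S by (intro R.finite_measure_Diff) (auto simp: radonD[OF R])
  moreover have "measure P (U - ?S t) = measure P U - measure P (?S t)"
    using U S P by (intro P.finite_measure_Diff) auto
  ultimately have "measure P U < measure P (?S t) + e" using U by linarith
  then have PU: "emeasure P U < c"
    using e(2) by (simp add: P.emeasure_eq_measure) (metis ennreal_less_iff measure_nonneg less_le_trans)
  have Kc: "compact K" using K compact_Int_closed[OF comp K] by simp
  \<comment> \<open>With \<open>k = - s + t\<close> one has \<open>s = t + - k\<close>, so
    containment of the translate in \<open>U\<close> is a condition on all \<open>k \<in> K\<close>
    that is open in \<open>t\<close>.\<close>
  let ?W = "(\<lambda>p::'g \<times> 'g. fst p + - snd p) -` U"
  have "open ?W" using U(1) by (intro open_vimage continuous_intros)
  then have "open {t'. \<forall>k\<in>K. (t', k) \<in> ?W}" by (rule open_Ball_compact[OF Kc])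
  moreover have "t \<in> {t'. \<forall>k\<in>K. (t', k) \<in> ?W}"
    using U(2) by (auto simp: minus_add add.assoc[symmetric] subset_iff)
  moreover have "{t'. \<forall>k\<in>K. (t', k) \<in> ?W} \<subseteq> {t. emeasure P (?S t) < c}"
  proof safe
    fix t' assume *: "\<forall>k\<in>K. (t', k) \<in> ?W"
    have "?S t' \<subseteq> U"
    proof safe
      fix s assume "- s + t' \<in> K"
      with * have "t' + - (- s + t') \<in> U" by auto
      then show "s \<in> U" by (simp add: minus_add add.assoc[symmetric])
    qed
    then have "emeasure P (?S t') \<le> emeasure P U" using U P by (intro emeasure_mono) auto
    with PU show "emeasure P (?S t') < c" by simp
  qed
  ultimately show "\<exists>T. open T \<and> t \<in> T \<and> T \<subseteq> {t. emeasure P (?S t) < c}" by blast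
qed

text \<open>On a group that is not second countable the map \<open>(s, t) \<mapsto> - s + t\<close> need not be measurable for the
  product sigma-algebra; measurability comes from semicontinuity on closed sets and Dynkin's lemma.\<close>

lemma translate_emeasure_measurable:
  fixes P R :: "'g::{topological_group_add, t2_space} measure"
  assumes comp: "compact (UNIV :: 'g set)" and R: "radon_measure R"
    and P: "P \<le> R" "sets P = sets borel" and A: "A \<in> sets borel"
  shows "(\<lambda>t. emeasure P {s. - s + t \<in> A}) \<in> borel_measurable borel"
proof -
  interpret R: finite_measure R by (rule radonD[OF R])
  have "finite_measure P" by (rule R.finite_measure_mono_sets) (simp_all add: P radonD[OF R])
  then interpret P: finite_measure P .
  have spP: "space P = UNIV" using sets_eq_imp_space_eq[OF P(2)] by simp
  have bs: "sigma_sets UNIV (Collect closed :: 'g set set) = sets borel"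
    unfolding borel_eq_closed by simp
  have A': "A \<in> sigma_sets UNIV (Collect closed :: 'g set set)" using A bs by simp
  have 1: "Int_stable (Collect closed :: 'g set set)" by (auto simp: Int_stable_def)
  have 2: "(Collect closed :: 'g set set) \<subseteq> Pow UNIV" by simp
  show ?thesis using 1 2 A'
  proof (induction rule: sigma_sets_induct_disjoint)
    case (basic K)
    then show ?case
      using translate_upper_semicontinuous[OF comp R P] by (intro borel_measurableI_less) auto
  next
    case empty
    show ?case by simp
  next
    case (compl B)
    have "B \<in> sets borel" using compl bs by simp
    then have "emeasure P {s. - s + t \<in> UNIV - B} = emeasure P UNIV - emeasure P {s. - s + t \<in> B}" for t
      using emeasure_compl[of "{s. - s + t \<in> B}" P] translate_set_borel[of B t] P.emeasure_finite P
      by (simp add: spP Compl_eq_Diff_UNIV[symmetric] Collect_neg_eq)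
    then show ?case using compl by simp
  next
    case (union B)
    have B: "B i \<in> sets borel" for i using union bs by blast
    have "emeasure P {s. - s + t \<in> (\<Union>i. B i)} = (\<Sum>i. emeasure P {s. - s + t \<in> B i})" for t
    proof -
      have "(\<Sum>i. emeasure P {s. - s + t \<in> B i}) = emeasure P (\<Union>i. {s. - s + t \<in> B i})"
      proof (rule suminf_emeasure)
        show "range (\<lambda>i. {s. - s + t \<in> B i}) \<subseteq> sets P" using translate_set_borel[OF B] P by auto
        show "disjoint_family (\<lambda>i. {s. - s + t \<in> B i})"
          using union(1) by (auto simp: disjoint_family_on_def)
      qed
      also have "(\<Union>i. {s. - s + t \<in> B i}) = {s. - s + t \<in> (\<Union>i. B i)}" by auto
      finally show ?thesis by simp
    qed
    then show ?case using union by simp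
  qed
qed

text \<open>The kernel is the image of \<open>P\<close> under \<open>s \<mapsto> - s + t\<close>.
  Allowing any \<open>P\<close> below a Radon measure covers the Jordan parts of
  \<open>\<mu>\<close> without discussing their own regularity.\<close>

lemma conv_nn_integral_measurable:
  fixes P R :: "'g::{topological_group_add, t2_space} measure"
  assumes comp: "compact (UNIV :: 'g set)" and R: "radon_measure R"
    and P: "P \<le> R" "sets P = sets borel" and F: "F \<in> borel_measurable borel"
  shows "(\<lambda>t. \<integral>\<^sup>+s. F (- s + t) \<partial>P) \<in> borel_measurable borel"
proof -
  have m: "(\<lambda>s. - s + t) \<in> P \<rightarrow>\<^sub>M borel" for t by (simp add: measurable_cong_sets[OF P(2) refl])
  have "(\<lambda>t. \<integral>\<^sup>+x. F x \<partial>distr P borel (\<lambda>s. - s + t)) \<in> borel_measurable borel"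
  proof (rule kernel_nn_integral_measurable[OF _ _ F])
    fix A :: "'g set" assume "A \<in> sets borel"
    then show "(\<lambda>t. emeasure (distr P borel (\<lambda>s. - s + t)) A) \<in> borel_measurable borel"
      using translate_emeasure_measurable[OF comp R P] sets_eq_imp_space_eq[OF P(2)]
      by (simp add: emeasure_distr[OF m] vimage_def)
  qed simp
  then show ?thesis using F by (simp add: nn_integral_distr[OF m])
qed

lemma conv_integral_measurable:
  fixes P R :: "'g::{topological_group_add, t2_space} measure"
    and F :: "'g \<Rightarrow> 'b::{banach, second_countable_topology}"
  assumes comp: "compact (UNIV :: 'g set)" and R: "radon_measure R"
    and P: "P \<le> R" "sets P = sets borel" and F: "F \<in> borel_measurable borel"
  shows "(\<lambda>t. \<integral>s. F (- s + t) \<partial>P) \<in> borel_measurable borel"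
proof -
  interpret R: finite_measure R by (rule radonD[OF R])
  have "finite_measure P" by (rule R.finite_measure_mono_sets) (simp_all add: P radonD[OF R])
  then interpret P: finite_measure P .
  have m: "(\<lambda>s. - s + t) \<in> P \<rightarrow>\<^sub>M borel" for t by (simp add: measurable_cong_sets[OF P(2) refl])
  have "(\<lambda>t. \<integral>x. F x \<partial>distr P borel (\<lambda>s. - s + t)) \<in> borel_measurable borel"
  proof (rule kernel_integral_measurable[OF _ _ _ F])
    fix A :: "'g set" assume "A \<in> sets borel"
    then show "(\<lambda>t. emeasure (distr P borel (\<lambda>s. - s + t)) A) \<in> borel_measurable borel"
      using translate_emeasure_measurable[OF comp R P] sets_eq_imp_space_eq[OF P(2)]
      by (simp add: emeasure_distr[OF m] vimage_def)
  qed (simp_all add: P.finite_measure_distr[OF m])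
  then show ?thesis using F by (simp add: integral_distr[OF m])
qed

subsection \<open>Fubini for convolutions with Haar measure\<close>

text \<open>The weight is left open because two choices occur: \<open>|g|\<close> gives the sharp
  norm bound, while \<open>1 + |g|\<close> makes a finite weighted integral control the unweighted
  convolution as well.\<close>

definition weighted_conv :: "'g::topological_group_add measure \<Rightarrow> 'g measure \<Rightarrow> ('g \<Rightarrow> ennreal) \<Rightarrow> 'g measure" where
  "weighted_conv m P w = measure_of UNIV (sets borel) (\<lambda>A. \<integral>\<^sup>+t. w t * emeasure P {s. - s + t \<in> A} \<partial>m)"

lemma sets_weighted_conv[simp, measurable_cong]: "sets (weighted_conv m P w) = sets borel"
  and space_weighted_conv[simp]: "space (weighted_conv m P w) = UNIV"
  using sets.sigma_sets_eq[of "borel :: 'a measure"] by (simp_all add: weighted_conv_def)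

lemma ennreal_mult_le_epsilon:
  fixes x y c :: ennreal
  assumes c: "c < top" and le: "\<And>e::real. e > 0 \<Longrightarrow> x \<le> c * (y + ennreal e)"
  shows "x \<le> c * y"
proof (rule ennreal_le_epsilon)
  fix e :: real assume e: "0 < e"
  obtain r where r: "c = ennreal r" "r \<ge> 0" using c by (cases c) auto
  \<comment> \<open>Dividing by \<open>r + 1\<close> instead of \<open>r\<close> covers
    \<open>c = 0\<close>.\<close>
  have "e / (r + 1) > 0" using e r by simp
  from le[OF this] have "x \<le> c * y + c * ennreal (e / (r + 1))" by (simp add: distrib_left)
  also have "c * ennreal (e / (r + 1)) \<le> ennreal e"
    using e r by (simp add: ennreal_mult'[symmetric] field_simps)
  finally show "x \<le> c * y + ennreal e" by (simp add: add_left_mono)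
qed

locale haar_radon =
  fixes m P :: "'g::{topological_group_add, t2_space} measure"
  assumes compact_group: "compact (UNIV :: 'g set)"
    and haar: "normalized_haar_measure m"
    and radon: "radon_measure P"
begin

lemma radon_m: "radon_measure m"
  using haar by (simp add: normalized_haar_measure_def)

sublocale m: prob_space m
  by (rule prob_spaceI) (use haar radonD(2)[OF radon_m] in \<open>simp add: normalized_haar_measure_def\<close>)

sublocale P: finite_measure P
  by (rule radonD(3)[OF radon])

lemma sets_m[simp, measurable_cong]: "sets m = sets borel" and space_m[simp]: "space m = UNIV"
  by (rule radonD[OF radon_m])+

lemma sets_P[simp, measurable_cong]: "sets P = sets borel" and space_P[simp]: "space P = UNIV"
  by (rule radonD[OF radon])+

lemma emeasure_translate:
  assumes A: "A \<in> sets borel" shows "emeasure m {t. - s + t \<in> A} = emeasure m A"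
proof -
  have "{t. - s + t \<in> A} = (\<lambda>x. s + x) ` A"
  proof safe
    fix t assume "- s + t \<in> A"
    then show "t \<in> (+) s ` A" by (intro image_eqI[of _ _ "- s + t"]) (simp_all add: add.assoc[symmetric])
  qed (simp add: add.assoc[symmetric])
  then show ?thesis using haar A by (simp add: normalized_haar_measure_def)
qed

lemma nn_integral_translate:
  assumes F: "F \<in> borel_measurable borel"
  shows "(\<integral>\<^sup>+t. F (- s + t) \<partial>m) = (\<integral>\<^sup>+t. F t \<partial>m)"
proof -
  have mt: "(\<lambda>t. - s + t) \<in> m \<rightarrow>\<^sub>M borel"
    using translate_borel_measurable(2)[of "- s"] by (simp add: measurable_cong_sets[OF sets_m refl])
  have "distr m borel (\<lambda>t. - s + t) = m"
    by (rule measure_eqI) (simp_all add: emeasure_distr[OF mt] vimage_def emeasure_translate)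
  then have "(\<integral>\<^sup>+t. F t \<partial>m) = (\<integral>\<^sup>+t. F t \<partial>distr m borel (\<lambda>t. - s + t))" by simp
  also have "\<dots> = (\<integral>\<^sup>+t. F (- s + t) \<partial>m)"
    by (rule nn_integral_distr[OF mt]) (simp add: F)
  finally show ?thesis by simp
qed

definition cv :: "('g \<Rightarrow> ennreal) \<Rightarrow> 'g \<Rightarrow> ennreal" where
  "cv F t = (\<integral>\<^sup>+s. F (- s + t) \<partial>P)"

lemma translate_P[measurable]: "(\<lambda>s. - s + t) \<in> P \<rightarrow>\<^sub>M borel"
  using translate_borel_measurable(1)[of t] by (simp add: measurable_cong_sets[OF sets_P refl])

lemma cv_measurable[measurable]: "F \<in> borel_measurable borel \<Longrightarrow> cv F \<in> borel_measurable borel"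
  unfolding cv_def by (rule conv_nn_integral_measurable[OF compact_group radon order_refl sets_P])

lemma cv_measurable_m: "F \<in> borel_measurable borel \<Longrightarrow> cv F \<in> borel_measurable m"
  using cv_measurable[of F] by (simp add: measurable_cong_sets[OF sets_m refl])

lemma cv_indicator: "A \<in> sets borel \<Longrightarrow> cv (indicator A) t = emeasure P {s. - s + t \<in> A}"
proof -
  assume "A \<in> sets borel"
  then have "{s. - s + t \<in> A} \<in> sets P" using translate_set_borel[of A t] by simp
  moreover have "cv (indicator A) t = (\<integral>\<^sup>+s. indicator {s. - s + t \<in> A} s \<partial>P)"
    unfolding cv_def by (rule nn_integral_cong) (simp add: indicator_def)
  ultimately show ?thesis by simp
qed

lemma cv_mono: "(\<And>x. F x \<le> G x) \<Longrightarrow> cv F t \<le> cv G t"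
  unfolding cv_def by (rule nn_integral_mono) simp

lemma emeasure_translate_measurable[measurable]:
  "A \<in> sets borel \<Longrightarrow> (\<lambda>t. emeasure P {s. - s + t \<in> A}) \<in> borel_measurable m"
  using translate_emeasure_measurable[OF compact_group radon order_refl sets_P]
  by (simp add: measurable_cong_sets[OF sets_m refl])

lemma emeasure_weighted_conv:
  assumes w: "w \<in> borel_measurable m" and A: "A \<in> sets borel"
  shows "emeasure (weighted_conv m P w) A = (\<integral>\<^sup>+t. w t * emeasure P {s. - s + t \<in> A} \<partial>m)"
  unfolding weighted_conv_def
proof (rule emeasure_measure_of_sigma)
  show "sigma_algebra (UNIV :: 'g set) (sets borel)"
    using sets.sigma_algebra_axioms[of "borel :: 'g measure"] by simp
  show "positive (sets borel) (\<lambda>A. \<integral>\<^sup>+t. w t * emeasure P {s. - s + t \<in> A} \<partial>m)"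
    by (simp add: positive_def)
  show "countably_additive (sets borel) (\<lambda>A. \<integral>\<^sup>+t. w t * emeasure P {s. - s + t \<in> A} \<partial>m)"
  proof (rule countably_additiveI)
    fix B :: "nat \<Rightarrow> 'g set"
    assume B: "range B \<subseteq> sets borel" "disjoint_family B" "(\<Union>i. B i) \<in> sets borel"
    have "(\<Sum>i. \<integral>\<^sup>+t. w t * emeasure P {s. - s + t \<in> B i} \<partial>m)
        = (\<integral>\<^sup>+t. (\<Sum>i. w t * emeasure P {s. - s + t \<in> B i}) \<partial>m)"
      using B w by (intro nn_integral_suminf[symmetric] borel_measurable_times) auto
    also have "\<dots> = (\<integral>\<^sup>+t. w t * emeasure P {s. - s + t \<in> (\<Union>i. B i)} \<partial>m)"
    proof (rule nn_integral_cong)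
      fix t
      have "(\<Sum>i. emeasure P {s. - s + t \<in> B i}) = emeasure P (\<Union>i. {s. - s + t \<in> B i})"
      proof (rule suminf_emeasure)
        show "range (\<lambda>i. {s. - s + t \<in> B i}) \<subseteq> sets P" using translate_set_borel[of _ t] B(1) by auto
        show "disjoint_family (\<lambda>i. {s. - s + t \<in> B i})"
          using B(2) by (auto simp: disjoint_family_on_def)
      qed
      also have "(\<Union>i. {s. - s + t \<in> B i}) = {s. - s + t \<in> (\<Union>i. B i)}" by auto
      finally show "(\<Sum>i. w t * emeasure P {s. - s + t \<in> B i}) = w t * emeasure P {s. - s + t \<in> (\<Union>i. B i)}"
        by simp
    qed
    finally show "(\<Sum>i. \<integral>\<^sup>+t. w t * emeasure P {s. - s + t \<in> B i} \<partial>m)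
      = (\<integral>\<^sup>+t. w t * emeasure P {s. - s + t \<in> (\<Union>i. B i)} \<partial>m)" .
  qed
qed fact

text \<open>True on indicators by construction of the measure, and both sides are additive and
  continuous from below in \<open>F\<close>. This interchange needs measurability in
  \<open>t\<close> alone.\<close>

lemma nn_integral_weighted_conv:
  assumes w: "w \<in> borel_measurable m" and F: "F \<in> borel_measurable borel"
  shows "(\<integral>\<^sup>+x. F x \<partial>weighted_conv m P w) = (\<integral>\<^sup>+t. w t * cv F t \<partial>m)"
  using F
proof induct
  case (cong f g)
  then have "f = g" by auto
  with cong show ?case by simp
next
  case (set A)
  then show ?case by (simp add: emeasure_weighted_conv[OF w] cv_indicator)
next
  case (mult f c)
  have "cv (\<lambda>x. c * f x) t = c * cv f t" for t
    unfolding cv_def using mult by (intro nn_integral_cmult) simp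
  moreover have "(\<lambda>t. w t * cv f t) \<in> borel_measurable m"
    using w cv_measurable_m[OF mult(2)] by simp
  ultimately show ?case
    using mult by (simp add: nn_integral_cmult mult.left_commute[of _ c])
next
  case (add f g)
  have "cv (\<lambda>x. g x + f x) t = cv g t + cv f t" for t
    unfolding cv_def using add by (intro nn_integral_add) simp_all
  moreover have "(\<lambda>t. w t * cv f t) \<in> borel_measurable m" "(\<lambda>t. w t * cv g t) \<in> borel_measurable m"
    using w cv_measurable_m[OF add(1)] cv_measurable_m[OF add(4)] by simp_all
  ultimately show ?case
    using add by (simp add: nn_integral_add distrib_left)
next
  case (seq U)
  have cvU: "cv (SUP i. U i) t = (SUP i. cv (U i) t)" for t
    unfolding cv_def SUP_apply
  proof (rule nn_integral_monotone_convergence_SUP)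
    show "incseq (\<lambda>i s. U i (- s + t))" using seq(4) by (auto simp: incseq_def le_fun_def)
    show "(\<lambda>s. U i (- s + t)) \<in> borel_measurable P" for i using seq(1)[of i] by simp
  qed
  have "(\<integral>\<^sup>+x. (SUP i. U i) x \<partial>weighted_conv m P w) = (SUP i. \<integral>\<^sup>+x. U i x \<partial>weighted_conv m P w)"
    unfolding SUP_apply using seq by (intro nn_integral_monotone_convergence_SUP) simp_all
  also have "\<dots> = (SUP i. \<integral>\<^sup>+t. w t * cv (U i) t \<partial>m)" using seq by simp
  also have "\<dots> = (\<integral>\<^sup>+t. (SUP i. w t * cv (U i) t) \<partial>m)"
  proof (rule nn_integral_monotone_convergence_SUP[symmetric])
    show "incseq (\<lambda>i t. w t * cv (U i) t)"
      using seq(4) by (auto simp: incseq_def le_fun_def intro!: mult_left_mono cv_mono)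
    show "(\<lambda>t. w t * cv (U i) t) \<in> borel_measurable m" for i
      using w cv_measurable_m[OF seq(1)] by simp
  qed
  also have "\<dots> = (\<integral>\<^sup>+t. w t * cv (SUP i. U i) t \<partial>m)"
    by (simp add: cvU SUP_mult_left_ennreal)
  finally show ?case .
qed

text \<open>Fubini for a continuous integrand by Riemann sums: the translates of \<open>\<phi>\<close> are uniformly close
  for nearby translation parameters.\<close>

lemma conv_continuous_le:
  fixes \<phi> :: "'g \<Rightarrow> real"
  assumes \<phi>: "continuous_on UNIV \<phi>" "\<And>x. 0 \<le> \<phi> x"
  shows "(\<integral>\<^sup>+t. cv (\<lambda>x. ennreal (\<phi> x)) t \<partial>m) \<le> emeasure P UNIV * (\<integral>\<^sup>+t. ennreal (\<phi> t) \<partial>m)"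
proof (rule ennreal_mult_le_epsilon)
  show "emeasure P UNIV < top" using P.emeasure_finite[of UNIV] by (simp add: less_top[symmetric])
  fix e :: real assume e: "e > 0"
  let ?J = "(\<integral>\<^sup>+t. ennreal (\<phi> t) \<partial>m) + ennreal e"
  have \<phi>m: "\<phi> \<in> borel_measurable borel" using \<phi>(1) by (rule borel_measurable_continuous_onI)
  have cont: "continuous_on S (\<lambda>x. \<phi> (f x))" if "continuous_on S f" for f :: "'c::topological_space \<Rightarrow> 'g" and S
    using continuous_on_compose2[OF \<phi>(1) that] by simp
  \<comment> \<open>The translates for \<open>s\<close> and \<open>s0\<close> are compared for all
    \<open>t\<close> at once; compactness of the group in the \<open>t\<close> variable makes this
    an open condition on \<open>s\<close>.\<close>
  define V where "V s0 = {s. \<forall>t\<in>UNIV. (s, t) \<in> {p. \<phi> (- fst p + snd p) < \<phi> (- s0 + snd p) + e}}" for s0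
  have "open (V s0)" for s0
    unfolding V_def
    by (intro open_Ball_compact compact_group open_Collect_less cont continuous_intros)
  moreover have "s0 \<in> V s0" for s0 using e by (simp add: V_def)
  ultimately obtain I where I: "finite I" "UNIV \<subseteq> (\<Union>i\<in>I. V i)"
    using compactE_image[OF compact_group, of UNIV V] by (metis UNIV_I UN_I subsetI)
  have V: "\<phi> (- s + t) \<le> \<phi> (- i + t) + e" if "s \<in> V i" for s i t
    using that by (auto simp: V_def intro: less_imp_le)
  have openV: "V i \<in> sets borel" for i using \<open>open (V i)\<close> by simp
  \<comment> \<open>The set \<open>B\<close> is arbitrary so that removing one cover element leaves
    an instance for the smaller cover. A measurable majorant \<open>w\<close> is carried along,
    which avoids measurability in \<open>t\<close> of the integrals restricted to
    \<open>B\<close>.\<close>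
  have "\<exists>w\<in>borel_measurable m. (\<forall>t. (\<integral>\<^sup>+s. ennreal (\<phi> (- s + t)) * indicator B s \<partial>P) \<le> w t) \<and>
      (\<integral>\<^sup>+t. w t \<partial>m) \<le> emeasure P B * ?J" if "B \<in> sets borel" "B \<subseteq> (\<Union>i\<in>I. V i)" for B
    using I(1) that
  proof (induction I arbitrary: B)
    case empty
    then show ?case by (intro bexI[of _ "\<lambda>_. 0"]) auto
  next
    case (insert i I)
    define B1 B2 where "B1 = B \<inter> V i" and "B2 = B - V i"
    have B: "B1 \<in> sets borel" "B2 \<in> sets borel" "B1 \<inter> B2 = {}" "B = B1 \<union> B2"
      using insert openV by (auto simp: B1_def B2_def)
    have "B2 \<subseteq> (\<Union>i\<in>I. V i)" using insert by (auto simp: B2_def)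
    from insert.IH[OF B(2) this] obtain w2 where w2: "w2 \<in> borel_measurable m"
      "\<And>t. (\<integral>\<^sup>+s. ennreal (\<phi> (- s + t)) * indicator B2 s \<partial>P) \<le> w2 t"
      "(\<integral>\<^sup>+t. w2 t \<partial>m) \<le> emeasure P B2 * ?J" by auto
    \<comment> \<open>On \<open>B1\<close> the translate by \<open>s\<close> is replaced by the
      translate by the centre \<open>i\<close>, at the price \<open>e\<close>. By invariance the
      translate by \<open>i\<close> has the same integral as \<open>\<phi>\<close>, and
      \<open>e\<close> integrates to \<open>e\<close> because \<open>m\<close> has mass 1.\<close>
    define w1 where "w1 t = emeasure P B1 * (ennreal (\<phi> (- i + t)) + ennreal e)" for t
    have trm: "(\<lambda>t. ennreal (\<phi> (- i + t))) \<in> borel_measurable m"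
      using measurable_compose[OF translate_borel_measurable(2)[of "- i"] \<phi>m] by simp
    have w1: "w1 \<in> borel_measurable m" unfolding w1_def using trm by simp
    have "(\<integral>\<^sup>+t. w1 t \<partial>m) = emeasure P B1 * ((\<integral>\<^sup>+t. ennreal (\<phi> (- i + t)) \<partial>m) + ennreal e)"
      unfolding w1_def using trm m.emeasure_space_1 by (simp add: nn_integral_cmult nn_integral_add)
    also have "\<dots> = emeasure P B1 * ?J"
      using \<phi>m by (subst nn_integral_translate[where F="\<lambda>t. ennreal (\<phi> t)"]) auto
    finally have iw1: "(\<integral>\<^sup>+t. w1 t \<partial>m) = emeasure P B1 * ?J" .
    have "(\<integral>\<^sup>+s. ennreal (\<phi> (- s + t)) * indicator B s \<partial>P) \<le> w1 t + w2 t" for t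
    proof -
      have pm: "(\<lambda>s. ennreal (\<phi> (- s + t))) \<in> borel_measurable P"
        using measurable_compose[OF translate_borel_measurable(1)[of t] \<phi>m] by simp
      have "(\<integral>\<^sup>+s. ennreal (\<phi> (- s + t)) * indicator B s \<partial>P) =
        (\<integral>\<^sup>+s. ennreal (\<phi> (- s + t)) * indicator B1 s + ennreal (\<phi> (- s + t)) * indicator B2 s \<partial>P)"
        using B(3,4) by (intro nn_integral_cong) (auto simp: indicator_def)
      also have "\<dots> = (\<integral>\<^sup>+s. ennreal (\<phi> (- s + t)) * indicator B1 s \<partial>P) + (\<integral>\<^sup>+s. ennreal (\<phi> (- s + t)) * indicator B2 s \<partial>P)"
        using pm B by (intro nn_integral_add) auto
      also have "\<dots> \<le> w1 t + w2 t"
      proof (rule add_mono[OF _ w2(2)])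
        have "(\<integral>\<^sup>+s. ennreal (\<phi> (- s + t)) * indicator B1 s \<partial>P) \<le>
          (\<integral>\<^sup>+s. (ennreal (\<phi> (- i + t)) + ennreal e) * indicator B1 s \<partial>P)"
        proof (rule nn_integral_mono)
          fix s
          show "ennreal (\<phi> (- s + t)) * indicator B1 s \<le> (ennreal (\<phi> (- i + t)) + ennreal e) * indicator B1 s"
            using V[of s i t] e \<phi>(2)[of "- i + t"]
            by (auto simp: B1_def indicator_def ennreal_plus[symmetric] simp del: ennreal_plus intro!: ennreal_leI)
        qed
        also have "\<dots> = w1 t"
          using B(1) by (subst nn_integral_cmult_indicator) (simp_all add: w1_def mult.commute)
        finally show "(\<integral>\<^sup>+s. ennreal (\<phi> (- s + t)) * indicator B1 s \<partial>P) \<le> w1 t" .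
      qed
      finally show ?thesis .
    qed
    moreover have "(\<integral>\<^sup>+t. w1 t + w2 t \<partial>m) \<le> emeasure P B * ?J"
    proof -
      have "(\<integral>\<^sup>+t. w1 t + w2 t \<partial>m) = (\<integral>\<^sup>+t. w1 t \<partial>m) + (\<integral>\<^sup>+t. w2 t \<partial>m)"
        by (rule nn_integral_add[OF w1 w2(1)])
      also have "\<dots> \<le> emeasure P B1 * ?J + emeasure P B2 * ?J" using w2(3) iw1 by (simp add: add_left_mono)
      also have "\<dots> = (emeasure P B1 + emeasure P B2) * ?J" by (rule distrib_right[symmetric])
      also have "emeasure P B1 + emeasure P B2 = emeasure P B"
        using B by (simp add: plus_emeasure)
      finally show ?thesis .
    qed
    ultimately show ?case using w1 w2(1)
      by (intro bexI[of _ "\<lambda>t. w1 t + w2 t"]) auto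
  qed
  from this[of UNIV] I(2) obtain w where w: "\<And>t. (\<integral>\<^sup>+s. ennreal (\<phi> (- s + t)) \<partial>P) \<le> w t"
      "(\<integral>\<^sup>+t. w t \<partial>m) \<le> emeasure P UNIV * ?J" by auto
  have "(\<integral>\<^sup>+t. cv (\<lambda>x. ennreal (\<phi> x)) t \<partial>m) \<le> (\<integral>\<^sup>+t. w t \<partial>m)"
    unfolding cv_def by (intro nn_integral_mono w)
  with w(2) show "(\<integral>\<^sup>+t. cv (\<lambda>x. ennreal (\<phi> x)) t \<partial>m) \<le> emeasure P UNIV * ?J" by simp
qed


section \<open>Continuous functions below the indicator of an open set\<close>

definition minorants :: "'g set \<Rightarrow> ('g \<Rightarrow> real) set" where
  "minorants U = {\<phi>. continuous_on UNIV \<phi> \<and> (\<forall>x. 0 \<le> \<phi> x \<and> \<phi> x \<le> 1) \<and> (\<forall>x. x \<notin> U \<longrightarrow> \<phi> x = 0)}"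

text \<open>Directedness of the family: finitely many local choices can be merged into one
  function.\<close>

lemma minorants_max:
  assumes "\<phi> \<in> minorants U" "\<psi> \<in> minorants U"
  shows "(\<lambda>x. max (\<phi> x) (\<psi> x)) \<in> minorants U"
  using assms by (auto simp: minorants_def intro!: continuous_on_max le_max_iff_disj[THEN iffD2])

lemma minorants_le: "\<phi> \<in> minorants U \<Longrightarrow> ennreal (\<phi> x) \<le> indicator U x"
  by (cases "x \<in> U") (auto simp: minorants_def)

lemma minorants_measurable: "\<phi> \<in> minorants U \<Longrightarrow> (\<lambda>x. ennreal (\<phi> x)) \<in> borel_measurable borel"
  unfolding minorants_def by (auto dest: borel_measurable_continuous_onI)

text \<open>Separating with values up to 2 and truncating at 1 makes the function equal to 1 on a
  whole neighbourhood of \<open>C\<close>, so that estimates survive a small translation.\<close>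

lemma urysohn_compact_open:
  assumes C: "compact C" and U: "open U" "C \<subseteq> U"
  obtains \<phi> V where "\<phi> \<in> minorants U" "open V" "C \<subseteq> V" "\<And>x. x \<in> V \<Longrightarrow> \<phi> x = 1"
proof -
  have "Hausdorff_space (euclidean :: 'g topology)"
    unfolding Hausdorff_space_def disjnt_def by simp (metis hausdorff)
  then have "normal_space (euclidean :: 'g topology)"
    using compact_group by (intro compact_Hausdorff_or_regular_imp_normal_space)
      (auto simp: compact_space_def)
  moreover have "closedin euclidean (- U)" "closedin euclidean C" "disjnt (- U) C"
    using U compact_imp_closed[OF C] by (auto simp: disjnt_def)
  ultimately obtain f where f: "continuous_map euclidean (top_of_set {0..2::real}) f"
      "f ` (- U) \<subseteq> {0}" "f ` C \<subseteq> {2}"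
    by (rule Urysohn_lemma[where a=0 and b=2]) auto
  have fc: "continuous_on UNIV f" and f0: "\<And>x. 0 \<le> f x"
    using f(1) by (auto simp: continuous_map_in_subtopology)
  show ?thesis
  proof (rule that)
    show "(\<lambda>x. min 1 (f x)) \<in> minorants U"
      using fc f0 f(2) by (auto simp: minorants_def intro!: continuous_on_min continuous_on_const)
    show "open {x. 1 < f x}" by (intro open_Collect_less fc continuous_on_const)
  qed (use f(3) in auto)
qed

text \<open>Inner regularity is used twice. For \<open>P\<close> it gives a compact set of mass
  above \<open>q\<close>, and one minorant then works on a neighbourhood of the given
  \<open>t\<close>. For \<open>m\<close> it gives a compact \<open>L\<close> of measure above
  \<open>x\<close>, which finitely many such neighbourhoods cover; the maximum of their minorants
  works on all of \<open>L\<close>.\<close>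

lemma level_set_approx:
  fixes q :: ennreal
  assumes U: "open U" and x: "x < emeasure m {t. q < emeasure P {s. - s + t \<in> U}}"
  shows "\<exists>\<phi>\<in>minorants U. x < emeasure m {t. q < cv (\<lambda>x. ennreal (\<phi> x)) t}"
proof -
  let ?O = "{t. q < emeasure P {s. - s + t \<in> U}}"
  let ?c = "\<lambda>\<phi>. cv (\<lambda>x. ennreal (\<phi> x))"
  have ex: "\<exists>\<phi> N. \<phi> \<in> minorants U \<and> open N \<and> t \<in> N \<and> (\<forall>t'\<in>N. q < ?c \<phi> t')" if t: "t \<in> ?O" for t
  proof -
    have o: "open {s. - s + t \<in> U}"
    proof -
      have "continuous_on UNIV (\<lambda>s. - s + t)"
        by (intro continuous_on_add continuous_on_minus continuous_on_id continuous_on_const)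
      from open_vimage[OF U this] show ?thesis by (simp add: vimage_def)
    qed
    from t have "q < emeasure P {s. - s + t \<in> U}" by simp
    with radon_compact_subset[OF radon o] obtain C where C: "compact C" "C \<subseteq> {s. - s + t \<in> U}" "q < emeasure P C"
      by metis
    let ?D = "(\<lambda>s. - s + t) ` C"
    have "compact ?D"
      by (rule compact_continuous_image[OF _ C(1)])
        (intro continuous_on_add continuous_on_minus continuous_on_id continuous_on_const)
    moreover have "?D \<subseteq> U" using C(2) by auto
    ultimately obtain \<phi> V where \<phi>: "\<phi> \<in> minorants U" "open V" "?D \<subseteq> V" "\<And>x. x \<in> V \<Longrightarrow> \<phi> x = 1"
      using urysohn_compact_open[OF _ U] by metis
    \<comment> \<open>For \<open>t'\<close> in \<open>N\<close> every point \<open>- s + t'\<close>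
      with \<open>s \<in> C\<close> lies where \<open>\<phi>\<close> is 1, so the convolution at
      \<open>t'\<close> is at least the mass of \<open>C\<close>.\<close>
    let ?W = "(\<lambda>p::'g \<times> 'g. - snd p + fst p) -` V"
    define N where "N = {t'. \<forall>s\<in>C. (t', s) \<in> ?W}"
    have "open ?W"
      by (intro open_vimage \<phi> continuous_on_add continuous_on_minus continuous_on_fst continuous_on_snd continuous_on_id)
    then have "open N" unfolding N_def by (rule open_Ball_compact[OF C(1)])
    moreover have "t \<in> N" using \<phi>(3) by (auto simp: N_def)
    moreover have "q < ?c \<phi> t'" if "t' \<in> N" for t'
    proof -
      have "emeasure P C = (\<integral>\<^sup>+s. indicator C s \<partial>P)"
        using C(1) by (subst nn_integral_indicator) (auto simp: borel_compact)
      also have "\<dots> \<le> ?c \<phi> t'"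
        unfolding cv_def using that \<phi>(4) by (intro nn_integral_mono) (auto simp: N_def indicator_def)
      finally show ?thesis using C(3) by simp
    qed
    ultimately show ?thesis using \<phi>(1) by blast
  qed
  then obtain \<Phi> N where \<Phi>: "\<And>t. t \<in> ?O \<Longrightarrow> \<Phi> t \<in> minorants U \<and> open (N t) \<and> t \<in> N t \<and> (\<forall>t'\<in>N t. q < ?c (\<Phi> t) t')"
    by metis
  have le: "?c \<phi> t \<le> emeasure P {s. - s + t \<in> U}" if "\<phi> \<in> minorants U" for \<phi> t
    using cv_mono[of "\<lambda>x. ennreal (\<phi> x)" "indicator U" t] minorants_le[OF that] cv_indicator[of U t] U by simp
  \<comment> \<open>The level set is a union of the neighbourhoods \<open>N t\<close>. Its openness
    is what permits inner regularity of \<open>m\<close> to be applied to it.\<close>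
  have "open ?O"
  proof (subst open_subopen, intro ballI)
    fix t assume t: "t \<in> ?O"
    have "N t \<subseteq> ?O" using \<Phi>[OF t] le by (auto intro: less_le_trans)
    then show "\<exists>T. open T \<and> t \<in> T \<and> T \<subseteq> ?O" using \<Phi>[OF t] by blast
  qed
  then obtain L where L: "compact L" "L \<subseteq> ?O" "x < emeasure m L"
    using radon_compact_subset[OF radon_m _ x] by metis
  obtain T where T: "T \<subseteq> ?O" "finite T" "L \<subseteq> (\<Union>t\<in>T. N t)"
  proof (rule compactE_image[OF L(1), of ?O N])
    show "open (N t)" if "t \<in> ?O" for t using \<Phi>[OF that] by blast
    show "L \<subseteq> (\<Union>t\<in>?O. N t)" using L(2) \<Phi> by blast
  qed
  have "\<exists>\<phi>\<in>minorants U. \<forall>t\<in>T. \<forall>y. \<Phi> t y \<le> \<phi> y" using T(2,1)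
  proof (induction T)
    case empty
    have "(\<lambda>_. 0) \<in> minorants U" by (simp add: minorants_def)
    then show ?case by auto
  next
    case (insert t T)
    then obtain \<phi> where \<phi>: "\<phi> \<in> minorants U" "\<forall>t\<in>T. \<forall>y. \<Phi> t y \<le> \<phi> y" by auto
    have "\<Phi> t \<in> minorants U" using \<Phi> insert by blast
    from minorants_max[OF \<phi>(1) this] show ?case
      using \<phi>(2) by (intro bexI[of _ "\<lambda>x. max (\<phi> x) (\<Phi> t x)"]) (auto simp: le_max_iff_disj)
  qed
  then obtain \<phi> where \<phi>: "\<phi> \<in> minorants U" "\<And>t y. t \<in> T \<Longrightarrow> \<Phi> t y \<le> \<phi> y" by blast
  have "L \<subseteq> {t. q < ?c \<phi> t}"
  proof
    fix t assume "t \<in> L"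
    then obtain i where i: "i \<in> T" "t \<in> N i" using T(3) by auto
    then have "q < ?c (\<Phi> i) t" using \<Phi> T(1) by blast
    also have "\<dots> \<le> ?c \<phi> t" using \<phi>(2)[OF i(1)] by (intro cv_mono ennreal_leI)
    finally show "t \<in> {t. q < ?c \<phi> t}" by simp
  qed
  moreover have "{t. q < ?c \<phi> t} \<in> sets m"
    using cv_measurable[OF minorants_measurable[OF \<phi>(1)]] by simp
  ultimately have "emeasure m L \<le> emeasure m {t. q < ?c \<phi> t}" by (rule emeasure_mono)
  with L(3) \<phi>(1) show ?thesis by (auto intro: less_le_trans)
qed

text \<open>For an open set the translation function is the supremum of an upward directed family of
  continuous functions; inner regularity of \<open>m\<close> on its level sets extracts a countable subfamily with
  the same supremum almost everywhere.\<close>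

lemma conv_open_le:
  assumes U: "open U"
  shows "(\<integral>\<^sup>+t. emeasure P {s. - s + t \<in> U} \<partial>m) \<le> emeasure P UNIV * emeasure m U"
proof -
  let ?c = "\<lambda>\<phi>. cv (\<lambda>x. ennreal (\<phi> x))"
  let ?F = "\<lambda>t. emeasure P {s. - s + t \<in> U}"
  have int: "(\<integral>\<^sup>+t. ?c \<phi> t \<partial>m) \<le> emeasure P UNIV * emeasure m U" if \<phi>: "\<phi> \<in> minorants U" for \<phi>
  proof -
    have "(\<integral>\<^sup>+t. ?c \<phi> t \<partial>m) \<le> emeasure P UNIV * (\<integral>\<^sup>+t. ennreal (\<phi> t) \<partial>m)"
      using \<phi> by (intro conv_continuous_le) (auto simp: minorants_def)
    also have "(\<integral>\<^sup>+t. ennreal (\<phi> t) \<partial>m) \<le> (\<integral>\<^sup>+t. indicator U t \<partial>m)"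
      by (intro nn_integral_mono minorants_le[OF \<phi>])
    also have "\<dots> = emeasure m U" using U by simp
    finally show ?thesis by (simp add: mult_left_mono)
  qed
  \<comment> \<open>An enumeration of all pairs consisting of a level \<open>q\<close> and a
    threshold \<open>x\<close> for the measure of the level set; rational pairs keep the subfamily
    countable.\<close>
  define Q :: "nat \<Rightarrow> rat \<times> rat" where "Q = from_nat"
  have "\<exists>\<phi>\<in>minorants U. x < emeasure m {t. q < ?F t} \<longrightarrow> x < emeasure m {t. q < ?c \<phi> t}" for q x :: ennreal
  proof (cases "x < emeasure m {t. q < ?F t}")
    case False
    have "(\<lambda>_. 0) \<in> minorants U" by (simp add: minorants_def)
    with False show ?thesis by auto
  qed (use level_set_approx[OF U] in blast)
  then obtain \<Phi> where \<Phi>: "\<And>q x. \<Phi> q x \<in> minorants U"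
    "\<And>q x. x < emeasure m {t. q < ?F t} \<Longrightarrow> x < emeasure m {t. q < ?c (\<Phi> q x) t}" by metis
  define \<phi> where "\<phi> j = \<Phi> (ennreal (real_of_rat (fst (Q j)))) (ennreal (real_of_rat (snd (Q j))))" for j
  \<comment> \<open>Running maxima turn the countable subfamily into an increasing sequence, as
    monotone convergence requires.\<close>
  define \<psi> where "\<psi> = rec_nat (\<phi> 0) (\<lambda>k f x. max (f x) (\<phi> (Suc k) x))"
  have \<psi>_simps: "\<psi> 0 = \<phi> 0" "\<psi> (Suc k) = (\<lambda>x. max (\<psi> k x) (\<phi> (Suc k) x))" for k
    by (simp_all add: \<psi>_def)
  have \<phi>: "\<phi> j \<in> minorants U" for j unfolding \<phi>_def by (rule \<Phi>)
  have \<psi>: "\<psi> k \<in> minorants U" for k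
    by (induction k) (simp_all add: \<psi>_simps \<phi> minorants_max)
  have \<phi>\<psi>: "\<phi> j x \<le> \<psi> j x" for j x by (cases j) (simp_all add: \<psi>_simps)
  have inc: "incseq (\<lambda>k. ?c (\<psi> k))"
    by (intro incseq_SucI le_funI cv_mono ennreal_leI) (simp add: \<psi>_simps)
  have cm: "?c (\<psi> k) \<in> borel_measurable m" for k
    by (rule cv_measurable_m[OF minorants_measurable[OF \<psi>]])
  define H where "H t = (SUP k. ?c (\<psi> k) t)" for t
  have H[measurable]: "H \<in> borel_measurable m" unfolding H_def using cm by simp
  have F[measurable]: "?F \<in> borel_measurable m" using U by simp
  have HF: "H t \<le> ?F t" for t
    unfolding H_def
  proof (rule SUP_least)
    fix k show "?c (\<psi> k) t \<le> ?F t"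
      using cv_mono[of "\<lambda>x. ennreal (\<psi> k x)" "indicator U" t] minorants_le[OF \<psi>] cv_indicator[of U t] U by simp
  qed
  have null: "AE t in m. q < ?F t \<longrightarrow> q < H t" if q: "q = ennreal (real_of_rat r)" for q r
  proof -
    \<comment> \<open>If the level set of \<open>H\<close> were smaller, a rational \<open>x\<close>
      would lie in the gap. The minorant chosen for the pair \<open>(q, x)\<close> lies below some
      \<open>\<psi> j\<close>, yet its level set has measure above \<open>x\<close>.\<close>
    have le: "emeasure m {t. q < ?F t} \<le> emeasure m {t. q < H t}"
    proof (rule ccontr)
      assume "\<not> ?thesis"
      then obtain x where x: "emeasure m {t. q < H t} < ennreal (real_of_rat x)"
          "ennreal (real_of_rat x) < emeasure m {t. q < ?F t}"
        using ennreal_rat_dense[of "emeasure m {t. q < H t}" "emeasure m {t. q < ?F t}"] by (auto simp: not_le)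
      obtain j where j: "Q j = (r, x)" unfolding Q_def by (metis from_nat_to_nat)
      have "ennreal (real_of_rat x) < emeasure m {t. q < ?c (\<phi> j) t}"
        using \<Phi>(2)[OF x(2)] by (simp add: \<phi>_def j q)
      also have "\<dots> \<le> emeasure m {t. q < H t}"
      proof (rule emeasure_mono)
        have "?c (\<phi> j) t \<le> H t" for t
          unfolding H_def by (rule SUP_upper2[of j]) (auto intro!: cv_mono ennreal_leI \<phi>\<psi>)
        then show "{t. q < ?c (\<phi> j) t} \<subseteq> {t. q < H t}" by (auto intro: less_le_trans)
        have "{t \<in> space m. q < H t} \<in> sets m" by measurable
        then show "{t. q < H t} \<in> sets m" by simp
      qed
      finally show False using x(1) by simp
    qed
    have s: "{t \<in> space m. q < ?F t} \<in> sets m" "{t \<in> space m. q < H t} \<in> sets m" by measurable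
    have "{t. q < H t} \<subseteq> {t. q < ?F t}" using HF by (auto intro: less_le_trans)
    then have "emeasure m ({t. q < ?F t} - {t. q < H t}) = emeasure m {t. q < ?F t} - emeasure m {t. q < H t}"
      using s m.emeasure_finite by (intro emeasure_Diff) simp_all
    also have "\<dots> = 0" 
      by (rule diff_eq_0_ennreal[OF _ le]) (simp add: m.emeasure_finite less_top[symmetric])
    finally have "{t. q < ?F t} - {t. q < H t} \<in> null_sets m" using s by (intro null_setsI) simp_all
    then show ?thesis by (rule AE_I'[where N="{t. q < ?F t} - {t. q < H t}"]) auto
  qed
  \<comment> \<open>Countably many levels share one null set; outside it, a rational strictly
    between \<open>H t\<close> and the larger value would be contradictory.\<close>
  have "AE t in m. \<forall>r. ennreal (real_of_rat r) < ?F t \<longrightarrow> ennreal (real_of_rat r) < H t"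
    using null by (simp add: AE_all_countable)
  then have "AE t in m. ?F t \<le> H t"
  proof eventually_elim
    fix t assume *: "\<forall>r. ennreal (real_of_rat r) < ?F t \<longrightarrow> ennreal (real_of_rat r) < H t"
    show "?F t \<le> H t"
    proof (rule ccontr)
      assume "\<not> ?thesis"
      then obtain r where "H t < ennreal (real_of_rat r)" "ennreal (real_of_rat r) < ?F t"
        using ennreal_rat_dense[of "H t" "?F t"] by (auto simp: not_le)
      with * show False by (meson less_asym)
    qed
  qed
  then have "(\<integral>\<^sup>+t. ?F t \<partial>m) \<le> (\<integral>\<^sup>+t. H t \<partial>m)" by (rule nn_integral_mono_AE)
  also have "\<dots> = (SUP k. \<integral>\<^sup>+t. ?c (\<psi> k) t \<partial>m)"
    unfolding H_def using inc cm by (rule nn_integral_monotone_convergence_SUP)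
  also have "\<dots> \<le> emeasure P UNIV * emeasure m U" by (intro SUP_least int \<psi>)
  finally show ?thesis .
qed

text \<open>Enlarging \<open>A\<close> to an open set only increases the left side, and outer
  regularity of \<open>m\<close> makes the increase on the right arbitrarily small.\<close>

lemma conv_set_le:
  assumes A: "A \<in> sets borel"
  shows "(\<integral>\<^sup>+t. emeasure P {s. - s + t \<in> A} \<partial>m) \<le> emeasure P UNIV * emeasure m A"
proof (rule ennreal_mult_le_epsilon)
  show "emeasure P UNIV < top" using P.emeasure_finite[of UNIV] by (simp add: less_top[symmetric])
  fix e :: real assume e: "e > 0"
  obtain U where U: "open U" "A \<subseteq> U" "measure m U < measure m A + e"
    using radon_open_superset[OF radon_m A e] .
  have "(\<integral>\<^sup>+t. emeasure P {s. - s + t \<in> A} \<partial>m) \<le> (\<integral>\<^sup>+t. emeasure P {s. - s + t \<in> U} \<partial>m)"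
  proof (intro nn_integral_mono emeasure_mono)
    show "{s. - s + t \<in> U} \<in> sets P" for t using translate_set_borel[of U t] U by simp
  qed (use U in auto)
  also have "\<dots> \<le> emeasure P UNIV * emeasure m U" by (rule conv_open_le[OF U(1)])
  also have "emeasure m U \<le> emeasure m A + ennreal e"
    using U e by (simp add: m.emeasure_eq_measure ennreal_plus[symmetric] ennreal_leI del: ennreal_plus)
  finally show "(\<integral>\<^sup>+t. emeasure P {s. - s + t \<in> A} \<partial>m) \<le> emeasure P UNIV * (emeasure m A + ennreal e)"
    by (simp add: mult_left_mono)
qed

text \<open>With weight 1 the bound on sets is an inequality between two measures, and integrals are
  monotone in the measure.\<close>

lemma conv_le:
  assumes F: "F \<in> borel_measurable borel"
  shows "(\<integral>\<^sup>+t. cv F t \<partial>m) \<le> emeasure P UNIV * (\<integral>\<^sup>+t. F t \<partial>m)"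
proof -
  have "weighted_conv m P (\<lambda>_. 1) \<le> scale_measure (emeasure P UNIV) m"
    by (rule le_measureI) (simp_all add: emeasure_weighted_conv conv_set_le)
  from nn_integral_mono_measure[OF _ this, of F]
  have "(\<integral>\<^sup>+t. F t \<partial>weighted_conv m P (\<lambda>_. 1)) \<le> (\<integral>\<^sup>+t. F t \<partial>scale_measure (emeasure P UNIV) m)" by simp
  then show ?thesis
    using F by (simp add: nn_integral_weighted_conv nn_integral_scale_measure)
qed

end

subsection \<open>Young functions and Orlicz spaces\<close>

lemma young_convex:
  "young_function \<Phi> \<Longrightarrow> 0 \<le> x \<Longrightarrow> 0 \<le> y \<Longrightarrow> 0 \<le> t \<Longrightarrow> t \<le> 1 \<Longrightarrow>
    \<Phi> (t * x + (1 - t) * y) \<le> ennreal t * \<Phi> x + ennreal (1 - t) * \<Phi> y"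
  unfolding young_function_def by blast

lemma young_zero: "young_function \<Phi> \<Longrightarrow> \<Phi> 0 = 0"
  unfolding young_function_def by blast

lemma young_scale:
  assumes "young_function \<Phi>" "0 \<le> t" "t \<le> 1" "0 \<le> y"
  shows "\<Phi> (t * y) \<le> ennreal t * \<Phi> y"
  using young_convex[OF assms(1,4) order_refl assms(2,3)] young_zero[OF assms(1)] by simp

lemma young_mono:
  assumes Y: "young_function \<Phi>" and "0 \<le> x" "x \<le> y"
  shows "\<Phi> x \<le> \<Phi> y"
proof (cases "y = 0")
  case False
  then have t: "0 \<le> x / y" "x / y \<le> 1" "0 \<le> y" "x / y * y = x" using assms by auto
  have "\<Phi> x \<le> ennreal (x / y) * \<Phi> y" using young_scale[OF Y t(1-3)] t(4) by simp
  also have "\<dots> \<le> 1 * \<Phi> y" using t(2) by (intro mult_right_mono) auto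
  finally show ?thesis by simp
qed (use assms in simp)

text \<open>By monotonicity the sublevel sets are intervals. The truncation at 0 is there because
  nothing is known about \<open>\<Phi>\<close> on negative arguments.\<close>

lemma young_measurable:
  assumes Y: "young_function \<Phi>" and f: "f \<in> borel_measurable M" "\<And>x. 0 \<le> f x"
  shows "(\<lambda>x. \<Phi> (f x)) \<in> borel_measurable M"
proof -
  have "(\<lambda>x. \<Phi> (max 0 x)) \<in> borel_measurable borel"
  proof (rule borel_measurableI_less)
    fix y
    have "is_interval {x. \<Phi> (max 0 x) < y}"
      unfolding is_interval_1
    proof (intro ballI allI impI)
      fix a b x assume "b \<in> {x. \<Phi> (max 0 x) < y}" and x: "a \<le> x \<and> x \<le> b"
      moreover have "\<Phi> (max 0 x) \<le> \<Phi> (max 0 b)" using x by (intro young_mono[OF Y]) auto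
      ultimately show "x \<in> {x. \<Phi> (max 0 x) < y}" by auto
    qed
    then show "{x \<in> space borel. \<Phi> (max 0 x) < y} \<in> sets borel"
      using real_interval_borel_measurable by simp
  qed
  from measurable_compose[OF f(1) this] show ?thesis using f(2) by (simp add: max_absorb2)
qed

text \<open>Choose \<open>b\<close> with \<open>\<Phi> b > 1\<close> and slope \<open>1 / b\<close>.
  Up to \<open>b\<close> the summand 1 is enough; beyond \<open>b\<close>, convexity and
  \<open>\<Phi> 0 = 0\<close> force growth along the chord from the origin.\<close>

lemma young_linear_lower_bound:
  assumes Y: "young_function \<Phi>"
  obtains a where "a > 0" "\<And>x. 0 \<le> x \<Longrightarrow> ennreal (a * x) \<le> \<Phi> x + 1"
proof -
  have "(\<Phi> \<longlongrightarrow> \<infinity>) at_top" using Y unfolding young_function_def by blast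
  then have "eventually (\<lambda>x. 1 < \<Phi> x) at_top" by (rule order_tendstoD) simp
  moreover have "eventually (\<lambda>x::real. 0 < x) at_top" by (rule eventually_gt_at_top)
  ultimately have "eventually (\<lambda>x. 1 < \<Phi> x \<and> 0 < x) at_top" by (rule eventually_conj)
  then obtain b where b: "1 < \<Phi> b" "0 < b" by (auto dest: eventually_happens)
  show ?thesis
  proof (rule that[of "1 / b"])
    show "1 / b > 0" using b by simp
    fix x :: real assume x: "0 \<le> x"
    show "ennreal (1 / b * x) \<le> \<Phi> x + 1"
    proof (cases "x \<le> b")
      case True
      then have "ennreal (1 / b * x) \<le> 1" using b by simp
      then show ?thesis by (simp add: add_increasing)
    next
      case False
      then have t: "0 \<le> b / x" "b / x \<le> 1" "b / x * x = b" using b by auto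
      have "ennreal (1 / b * x) \<le> ennreal (x / b) * \<Phi> b"
        using b(1) mult_left_mono[of 1 "\<Phi> b" "ennreal (x / b)"] by simp
      also have "\<dots> \<le> ennreal (x / b) * (ennreal (b / x) * \<Phi> x)"
        using young_scale[OF Y t(1,2) x] t(3) by (intro mult_left_mono) simp_all
      also have "\<dots> = \<Phi> x"
        using b x False by (simp add: mult.assoc[symmetric] ennreal_mult'[symmetric])
      finally show ?thesis by (simp add: add_increasing2)
    qed
  qed
qed

lemma complementary_young_ineq:
  assumes "0 \<le> x" shows "ennreal (x * y) \<le> \<Phi> x + complementary_young \<Phi> y"
proof (cases "\<Phi> x = top")
  case False
  have "ennreal (x * y) - \<Phi> x \<le> complementary_young \<Phi> y"
    unfolding complementary_young_def using assms by (intro SUP_upper) simp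
  then show ?thesis using False by (simp add: ennreal_minus_le_iff)
qed simp

text \<open>Were \<open>\<Phi>\<close> infinite at every positive point, all terms of the supremum
  defining the complementary function would be 0, and it could not tend to infinity.\<close>

lemma young_finite_point:
  assumes "young_function (complementary_young \<Phi>)"
  obtains p where "p > 0" "\<Phi> p < top"
proof -
  have "(complementary_young \<Phi> \<longlongrightarrow> \<infinity>) at_top" using assms unfolding young_function_def by blast
  then have "eventually (\<lambda>y. 0 < complementary_young \<Phi> y) at_top" by (rule order_tendstoD) simp
  then obtain y where "0 < complementary_young \<Phi> y" by (auto dest: eventually_happens)
  then obtain x where x: "0 \<le> x" "0 < ennreal (x * y) - \<Phi> x"
    unfolding complementary_young_def by (auto simp: less_SUP_iff)
  show ?thesis
  proof (rule that)
    show "x > 0" using x by (cases "x = 0") auto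
    show "\<Phi> x < top" using x by (cases "\<Phi> x = top") (auto simp: less_top)
  qed
qed

text \<open>Read through the definition of the supremum, the linear lower bound of slope
  \<open>a\<close> is exactly this estimate.\<close>

lemma complementary_young_le_one:
  assumes "young_function \<Phi>"
  obtains a where "a > 0" "complementary_young \<Phi> a \<le> 1"
proof -
  obtain a where a: "a > 0" "\<And>x. 0 \<le> x \<Longrightarrow> ennreal (a * x) \<le> \<Phi> x + 1"
    using young_linear_lower_bound[OF assms] by blast
  have "complementary_young \<Phi> a \<le> 1"
    unfolding complementary_young_def
  proof (rule SUP_least)
    fix x :: real assume "x \<in> {0..}"
    then show "ennreal (x * a) - \<Phi> x \<le> 1" using a(2)[of x] by (simp add: ennreal_minus_le_iff mult.commute)
  qed
  with a(1) show ?thesis by (rule that)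
qed

lemma young_le_one:
  assumes Y: "young_function \<Phi>" and p: "p > 0" "\<Phi> p < top"
  obtains q where "q > 0" "\<Phi> q \<le> 1"
proof -
  obtain r where r: "\<Phi> p = ennreal r" "0 \<le> r" using p by (cases "\<Phi> p") auto
  have "\<Phi> (1 / (r + 1) * p) \<le> ennreal (1 / (r + 1)) * \<Phi> p"
    using r p by (intro young_scale[OF Y]) auto
  also have "\<dots> = ennreal (r / (r + 1))" using r by (simp add: ennreal_mult'[symmetric])
  also have "\<dots> \<le> 1" using r by simp
  finally have "\<Phi> (1 / (r + 1) * p) \<le> 1" .
  moreover have "1 / (r + 1) * p > 0" using r p by simp
  ultimately show ?thesis using that by blast
qed

text \<open>Prepares the real-valued Jensen inequality. Truncation at 0 preserves convexity because
  \<open>max 0\<close> is convex and \<open>\<Phi>\<close> is increasing.\<close>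

lemma young_convex_on:
  assumes Y: "young_function \<Phi>" and I: "convex I" and fin: "\<And>x. x \<in> I \<Longrightarrow> \<Phi> (max 0 x) < top"
  shows "convex_on I (\<lambda>x. enn2real (\<Phi> (max 0 x)))"
proof (rule convex_onI)
  fix t x y :: real assume t: "0 < t" "t < 1" and xy: "x \<in> I" "y \<in> I"
  let ?z = "(1 - t) *\<^sub>R x + t *\<^sub>R y"
  have "max 0 ?z \<le> (1 - t) * max 0 x + (1 - (1 - t)) * max 0 y"
    using t by (auto intro!: add_mono mult_left_mono add_nonneg_nonneg)
  then have "\<Phi> (max 0 ?z) \<le> \<Phi> ((1 - t) * max 0 x + (1 - (1 - t)) * max 0 y)"
    by (intro young_mono[OF Y]) auto
  also have "\<dots> \<le> ennreal (1 - t) * \<Phi> (max 0 x) + ennreal (1 - (1 - t)) * \<Phi> (max 0 y)"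
    using t by (intro young_convex[OF Y]) auto
  also have "\<dots> = ennreal ((1 - t) * enn2real (\<Phi> (max 0 x)) + t * enn2real (\<Phi> (max 0 y)))"
    using t fin[OF xy(1)] fin[OF xy(2)]
    by (simp add: ennreal_plus ennreal_mult' ennreal_enn2real)
  finally have "enn2real (\<Phi> (max 0 ?z)) \<le> enn2real (ennreal ((1 - t) * enn2real (\<Phi> (max 0 x)) + t * enn2real (\<Phi> (max 0 y))))"
    by (rule enn2real_mono) simp
  also have "\<dots> = (1 - t) * enn2real (\<Phi> (max 0 x)) + t * enn2real (\<Phi> (max 0 y))"
    using t by (intro enn2real_ennreal add_nonneg_nonneg mult_nonneg_nonneg) auto
  finally show "enn2real (\<Phi> (max 0 ?z)) \<le> (1 - t) * enn2real (\<Phi> (max 0 x)) + t * enn2real (\<Phi> (max 0 y))" .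
qed (fact I)

text \<open>The factor \<open>r < 1\<close> keeps the argument inside the open interval where \<open>\<Phi>\<close> is finite; \<open>\<Phi>\<close> may
  jump at its right end point.\<close>

lemma (in prob_space) young_jensen:
  assumes Y: "young_function \<Phi>" and p: "p > 0" "\<Phi> p < top"
    and u: "u \<in> borel_measurable M" "\<And>x. 0 \<le> u x" and b: "(\<integral>\<^sup>+x. ennreal (u x) \<partial>M) = ennreal b" "0 \<le> b"
    and r: "0 \<le> r" "r < 1"
  shows "\<Phi> (r * b) \<le> (\<integral>\<^sup>+x. \<Phi> (u x) \<partial>M)"
proof (cases "(\<integral>\<^sup>+x. \<Phi> (u x) \<partial>M) = top")
  case False
  have \<Phi>u: "(\<lambda>x. \<Phi> (u x)) \<in> borel_measurable M" by (rule young_measurable[OF Y u])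
  have finu: "AE x in M. \<Phi> (u x) \<noteq> \<infinity>"
    using False by (intro nn_integral_PInf_AE \<Phi>u) simp
  \<comment> \<open>\<open>I\<close> is the open half line to the left of the first infinite value,
    or the whole line if there is none; Jensen needs an open interval on which the convex function
    is finite.\<close>
  define S where "S = {x. 0 \<le> x \<and> \<Phi> x = top}"
  define I where "I = (if S = {} then UNIV else {..< Inf S})"
  have bdd: "bdd_below S" unfolding S_def by (rule bdd_belowI[of _ 0]) auto
  have pS: "p \<le> x" if "x \<in> S" for x
    using that p young_mono[OF Y, of x p] unfolding S_def by (cases "p \<le> x") auto
  \<comment> \<open>A point where \<open>\<Phi>\<close> is finite may equal \<open>Inf S\<close>;
    multiplying by \<open>r < 1\<close> moves it strictly inside, since
    \<open>Inf S \<ge> p > 0\<close>.\<close>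
  have ruI: "r * y \<in> I" if y: "0 \<le> y" "\<Phi> y \<noteq> \<infinity>" for y
  proof (cases "S = {}")
    case False
    have "y \<le> x" if "x \<in> S" for x
      using that y young_mono[OF Y, of x y] unfolding S_def by (cases "y \<le> x") (auto simp: top_unique)
    then have "y \<le> Inf S" by (intro cInf_greatest[OF False])
    moreover have "p \<le> Inf S" using pS by (intro cInf_greatest[OF False])
    ultimately have "r * y < Inf S"
      using r p y(1) mult_strict_right_mono[of r 1 "Inf S"] mult_left_mono[of y "Inf S" r] by linarith
    then show ?thesis using False by (simp add: I_def)
  qed (simp add: I_def)
  have finI: "\<Phi> (max 0 x) < top" if "x \<in> I" for x
  proof (cases "S = {}")
    case True
    then show ?thesis unfolding S_def by (auto simp: less_top[symmetric])
  next
    case False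
    have "p \<le> Inf S" using pS by (intro cInf_greatest[OF False])
    then have "max 0 x < Inf S" using that False p by (simp add: I_def)
    then have "max 0 x \<notin> S" using cInf_lower[OF _ bdd] by (meson not_less)
    then show ?thesis unfolding S_def by (auto simp: less_top[symmetric])
  qed
  let ?q = "\<lambda>x. enn2real (\<Phi> (max 0 x))"
  have ru: "(\<lambda>x. r * u x) \<in> borel_measurable M" "\<And>x. 0 \<le> r * u x" using u r by auto
  have iu: "integrable M u" using u b by (intro integrableI_nonneg) auto
  have bu: "expectation u = b" using integral_eq_nn_integral[of u M] u b by simp
  have le: "\<Phi> (r * u x) \<le> \<Phi> (u x)" for x
    using r u(2)[of x] by (intro young_mono[OF Y]) (auto intro: mult_left_le_one_le)
  have nnru: "(\<integral>\<^sup>+x. \<Phi> (r * u x) \<partial>M) \<le> (\<integral>\<^sup>+x. \<Phi> (u x) \<partial>M)" by (intro nn_integral_mono le)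
  have AEf: "AE x in M. ennreal (?q (r * u x)) = \<Phi> (r * u x)"
    using finu
  proof eventually_elim
    fix x assume "\<Phi> (u x) \<noteq> \<infinity>"
    then have "\<Phi> (r * u x) < top" using le[of x] by (auto simp: less_top intro: order.strict_trans1)
    then show "ennreal (?q (r * u x)) = \<Phi> (r * u x)" using ru(2)[of x] by (simp add: max_absorb2)
  qed
  have qm: "(\<lambda>x. ?q (r * u x)) \<in> borel_measurable M"
    using young_measurable[OF Y ru] ru(2) by (simp add: max_absorb2)
  have nnq: "(\<integral>\<^sup>+x. ennreal (?q (r * u x)) \<partial>M) = (\<integral>\<^sup>+x. \<Phi> (r * u x) \<partial>M)"
    by (rule nn_integral_cong_AE[OF AEf])
  have iq: "integrable M (\<lambda>x. ?q (r * u x))"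
    using qm nnq nnru False by (intro integrableI_nonneg) (auto simp: less_top[symmetric] top_unique)
  have "?q (expectation (\<lambda>x. r * u x)) \<le> expectation (\<lambda>x. ?q (r * u x))"
  proof (rule jensens_inequality[where I=I])
    show "integrable M (\<lambda>x. r * u x)" using iu by simp
    show "AE x in M. r * u x \<in> I" using finu by eventually_elim (use ruI u in auto)
    show "I = {a<..<d} \<or> I = {a<..} \<or> I = {..<Inf S} \<or> I = UNIV" for a d by (simp add: I_def)
    show "convex_on I ?q" by (rule young_convex_on[OF Y _ finI]) (simp_all add: I_def)
  qed fact
  then have "?q (r * b) \<le> expectation (\<lambda>x. ?q (r * u x))" by (simp add: bu)
  then have "ennreal (?q (r * b)) \<le> ennreal (expectation (\<lambda>x. ?q (r * u x)))" by (rule ennreal_leI)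
  also have "\<dots> = (\<integral>\<^sup>+x. ennreal (?q (r * u x)) \<partial>M)"
    by (rule nn_integral_eq_integral[symmetric, OF iq]) simp
  also have "\<dots> \<le> (\<integral>\<^sup>+x. \<Phi> (u x) \<partial>M)" using nnq nnru by simp
  finally have *: "ennreal (?q (r * b)) \<le> (\<integral>\<^sup>+x. \<Phi> (u x) \<partial>M)" .
  \<comment> \<open>Because \<open>enn2real\<close> sends infinity to 0, the inequality just proved
    says nothing about \<open>\<Phi> (r * b)\<close> until finiteness is known.\<close>
  have "\<Phi> (r * b) < top"
  proof -
    have "r * b \<in> I"
    proof (cases "S = {}")
      case False
      have "AE x in M. u x \<le> Inf S" using finu
      proof eventually_elim
        fix x assume "\<Phi> (u x) \<noteq> \<infinity>"
        then have "u x \<le> y" if "y \<in> S" for y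
          using that young_mono[OF Y, of y "u x"] unfolding S_def by (cases "u x \<le> y") (auto simp: top_unique)
        then show "u x \<le> Inf S" by (intro cInf_greatest[OF False])
      qed
      then have "expectation u \<le> expectation (\<lambda>x. Inf S)" using iu by (intro integral_mono_AE) auto
      then have "b \<le> Inf S" by (simp add: bu prob_space)
      moreover have "p \<le> Inf S" using pS by (intro cInf_greatest[OF False])
      ultimately have "r * b < Inf S"
        using r p b(2) mult_strict_right_mono[of r 1 "Inf S"] mult_left_mono[of b "Inf S" r] by linarith
      then show ?thesis using False by (simp add: I_def)
    qed (simp add: I_def)
    from finI[OF this] show ?thesis using r b(2) by (simp add: max_absorb2)
  qed
  with * show ?thesis using r b(2) by (simp add: max_absorb2)
qed simp

text \<open>A bound valid for every admissible \<open>k\<close> passes to the infimum after division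
  by \<open>c\<close>. Membership of \<open>f\<close> makes the set of admissible \<open>k\<close>
  nonempty, so that \<open>Inf\<close> is a true infimum and \<open>X\<close> is finite.\<close>

lemma luxemburg_lower_bound:
  assumes c: "0 < c" and f: "f \<in> orlicz_space \<Phi> m"
    and X: "\<And>k. k > 0 \<Longrightarrow> (\<integral>\<^sup>+ x. \<Phi> (cmod (f x) / k) \<partial>m) \<le> 1 \<Longrightarrow> X \<le> ennreal (k * c)"
  shows "X \<le> ennreal (luxemburg_norm \<Phi> m f * c)"
proof -
  let ?K = "{k. k > 0 \<and> (\<integral>\<^sup>+ x. \<Phi> (cmod (f x) / k) \<partial>m) \<le> 1}"
  have ne: "?K \<noteq> {}" using f by (auto simp: orlicz_space_def)
  then obtain k where "k \<in> ?K" by auto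
  then have "X \<noteq> top" using X[of k] by (auto simp: top_unique)
  then obtain x where x: "X = ennreal x" "0 \<le> x" by (cases X) auto
  have "x / c \<le> Inf ?K"
  proof (rule cInf_greatest[OF ne])
    fix k assume "k \<in> ?K"
    then have "ennreal x \<le> ennreal (k * c)" "0 < k" using X[of k] x by auto
    then have "x \<le> k * c" using c by (simp add: ennreal_le_iff)
    then show "x / c \<le> k" using c by (simp add: field_simps)
  qed
  then show ?thesis using c by (auto simp: luxemburg_norm_def x field_simps intro!: ennreal_leI)
qed

section \<open>Orlicz spaces of a complementary pair\<close>

locale complementary_pair =
  fixes \<Phi> \<Psi> :: "real \<Rightarrow> ennreal"
  assumes young: "young_function \<Phi>" and compl: "\<Psi> = complementary_young \<Phi>" and young': "young_function \<Psi>"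
begin

lemma finite_point: obtains p where "p > 0" "\<Phi> p < top"
  using young_finite_point[of \<Phi>] young' unfolding compl by blast

text \<open>At least linear growth of \<open>\<Phi>\<close> suffices on a probability space; the
  additive 1 in the lower bound integrates to 1.\<close>

lemma orlicz_integrable:
  assumes m: "prob_space m" and f: "f \<in> orlicz_space \<Phi> m"
  shows "integrable m f"
proof -
  interpret prob_space m by fact
  obtain a where a: "a > 0" "\<And>x. 0 \<le> x \<Longrightarrow> ennreal (a * x) \<le> \<Phi> x + 1"
    using young_linear_lower_bound[OF young] by blast
  from f obtain k where k: "k > 0" "(\<integral>\<^sup>+ x. \<Phi> (cmod (f x) / k) \<partial>m) \<le> 1" and fm: "f \<in> borel_measurable m"
    by (auto simp: orlicz_space_def)
  have \<Phi>m: "(\<lambda>x. \<Phi> (cmod (f x) / k)) \<in> borel_measurable m"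
    using fm k by (intro young_measurable[OF young]) auto
  have "(\<integral>\<^sup>+x. ennreal (cmod (f x)) \<partial>m) = (\<integral>\<^sup>+x. ennreal (k / a) * ennreal (a * (cmod (f x) / k)) \<partial>m)"
    using a k by (intro nn_integral_cong) (simp add: ennreal_mult'[symmetric])
  also have "\<dots> \<le> (\<integral>\<^sup>+x. ennreal (k / a) * (\<Phi> (cmod (f x) / k) + 1) \<partial>m)"
    using a k by (intro nn_integral_mono mult_left_mono a) auto
  also have "\<dots> = ennreal (k / a) * ((\<integral>\<^sup>+x. \<Phi> (cmod (f x) / k) \<partial>m) + 1)"
    using \<Phi>m by (simp add: nn_integral_cmult nn_integral_add emeasure_space_1)
  also have "\<dots> \<le> ennreal (k / a) * (1 + 1)" using k by (intro mult_left_mono add_right_mono) auto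
  also have "\<dots> < \<infinity>" by (simp add: ennreal_mult_less_top)
  finally show ?thesis using fm by (intro integrableI_bounded) auto
qed

lemma dual_space_bounded:
  assumes m: "prob_space m" and g: "g \<in> borel_measurable m" "\<And>x. cmod (g x) \<le> B"
  shows "g \<in> dual_space \<Phi> m"
proof -
  interpret prob_space m by fact
  obtain a where a: "a > 0" "\<Psi> a \<le> 1" using complementary_young_le_one[OF young] unfolding compl by blast
  \<comment> \<open>Chosen so that dividing by \<open>k\<close> brings \<open>|g|\<close> below
    \<open>a\<close>, where \<open>\<Psi>\<close> is at most 1; the added 1 keeps \<open>k\<close>
    positive.\<close>
  define k where "k = (\<bar>B\<bar> + 1) / a"
  have k: "k > 0" using a by (simp add: k_def)
  have "cmod (g x) / k \<le> a" for x
  proof -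
    have "a * k = \<bar>B\<bar> + 1" using a by (simp add: k_def)
    then have "cmod (g x) \<le> a * k" using g(2)[of x] by linarith
    then show ?thesis using k by (simp add: pos_divide_le_eq)
  qed
  then have "(\<integral>\<^sup>+ x. \<Psi> (cmod (g x) / k) \<partial>m) \<le> (\<integral>\<^sup>+ x. \<Psi> a \<partial>m)"
    using k by (intro nn_integral_mono young_mono[OF young']) auto
  also have "\<dots> \<le> 1" using a by (simp add: emeasure_space_1)
  finally show ?thesis using g k unfolding dual_space_def orlicz_space_def compl by auto
qed

text \<open>Young's inequality for \<open>|h|\<close> and \<open>|g| / k\<close> bounds every
  pairing by \<open>2 * k\<close>.\<close>

lemma orlicz_norm_finite:
  assumes g: "g \<in> dual_space \<Phi> m"
  shows "orlicz_norm \<Phi> m g < \<infinity>"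
proof -
  from g obtain k where k: "k > 0" "(\<integral>\<^sup>+ x. \<Psi> (cmod (g x) / k) \<partial>m) \<le> 1" and gm: "g \<in> borel_measurable m"
    by (auto simp: dual_space_def orlicz_space_def compl)
  have \<Psi>m: "(\<lambda>x. \<Psi> (cmod (g x) / k)) \<in> borel_measurable m"
    using gm k by (intro young_measurable[OF young']) auto
  have "orlicz_norm \<Phi> m g \<le> ennreal k * (1 + 1)"
    unfolding orlicz_norm_def
  proof (rule SUP_least)
    fix h assume "h \<in> {h \<in> borel_measurable m. (\<integral>\<^sup>+ x. \<Phi> (cmod (h x)) \<partial>m) \<le> 1}"
    then have h: "h \<in> borel_measurable m" "(\<integral>\<^sup>+ x. \<Phi> (cmod (h x)) \<partial>m) \<le> 1" by auto
    have \<Phi>m: "(\<lambda>x. \<Phi> (cmod (h x))) \<in> borel_measurable m"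
      using h by (intro young_measurable[OF young]) auto
    have "(\<integral>\<^sup>+ x. ennreal (cmod (g x * h x)) \<partial>m) = (\<integral>\<^sup>+ x. ennreal k * ennreal (cmod (h x) * (cmod (g x) / k)) \<partial>m)"
      using k by (intro nn_integral_cong) (simp add: ennreal_mult'[symmetric] norm_mult mult.commute)
    also have "\<dots> \<le> (\<integral>\<^sup>+ x. ennreal k * (\<Phi> (cmod (h x)) + \<Psi> (cmod (g x) / k)) \<partial>m)"
      unfolding compl by (intro nn_integral_mono mult_left_mono complementary_young_ineq) auto
    also have "\<dots> = ennreal k * ((\<integral>\<^sup>+ x. \<Phi> (cmod (h x)) \<partial>m) + (\<integral>\<^sup>+ x. \<Psi> (cmod (g x) / k) \<partial>m))"
      using \<Phi>m \<Psi>m by (simp add: nn_integral_cmult nn_integral_add)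
    also have "\<dots> \<le> ennreal k * (1 + 1)" using h k by (intro mult_left_mono add_mono) auto
    finally show "(\<integral>\<^sup>+ x. ennreal (cmod (g x * h x)) \<partial>m) \<le> ennreal k * (1 + 1)" .
  qed
  also have "\<dots> < \<infinity>" by (simp add: ennreal_mult_less_top)
  finally show ?thesis .
qed

text \<open>A positive constant \<open>q\<close> with \<open>\<Phi> q \<le> 1\<close> is an
  admissible test function, and the finite Orlicz norm bounds the pairing with it.\<close>

lemma dual_space_integrable:
  assumes m: "prob_space m" and g: "g \<in> dual_space \<Phi> m"
  shows "integrable m g"
proof -
  interpret prob_space m by fact
  have gm: "g \<in> borel_measurable m" using g by (auto simp: dual_space_def orlicz_space_def)
  obtain p where p: "p > 0" "\<Phi> p < top" using finite_point .
  obtain q where q: "q > 0" "\<Phi> q \<le> 1" using young_le_one[OF young p] .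
  have "(\<integral>\<^sup>+ x. ennreal (cmod (g x * complex_of_real q)) \<partial>m) \<le> orlicz_norm \<Phi> m g"
    unfolding orlicz_norm_def by (rule SUP_upper) (use q emeasure_space_1 in auto)
  then have "(\<integral>\<^sup>+ x. ennreal (cmod (g x * complex_of_real q)) \<partial>m) < \<infinity>"
    using orlicz_norm_finite[OF g] by simp
  then have "integrable m (\<lambda>x. g x * complex_of_real q)" using gm by (intro integrableI_bounded) auto
  then have "integrable m (\<lambda>x. g x * complex_of_real q / complex_of_real q)" by (rule integrable_divide)
  then show ?thesis using q by simp
qed

end

subsection \<open>The vector measure of a convolution operator\<close>

lemma ennreal_le_mult_one_interval:
  fixes X Y :: ennreal
  assumes "\<And>r. 0 < r \<Longrightarrow> r < 1 \<Longrightarrow> ennreal r * X \<le> Y"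
  shows "X \<le> Y"
proof (cases "Y = top")
  case False
  then obtain y where y: "Y = ennreal y" "0 \<le> y" by (cases Y) auto
  have "X \<noteq> top"
  proof
    assume "X = top"
    then have "Y = top" using assms[of "1/2"] by (simp add: ennreal_mult_top top_unique)
    with False show False by simp
  qed
  then obtain x where x: "X = ennreal x" "0 \<le> x" by (cases X) auto
  have "x \<le> y"
  proof (rule field_le_mult_one_interval)
    fix r :: real assume "0 < r" "r < 1"
    with assms[of r] show "r * x \<le> y" by (simp add: x y ennreal_mult'[symmetric])
  qed
  then show ?thesis by (simp add: x y ennreal_leI)
qed simp

locale orlicz_conv = haar_radon m "cm_var borel \<mu>" + complementary_pair \<Phi> \<Psi>
  for m :: "'g::{topological_group_add, t2_space} measure" and \<mu> :: "'g set \<Rightarrow> complex" and \<Phi> \<Psi> +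
  assumes cm_\<mu>: "complex_measure borel \<mu>" and \<mu>_nonzero: "\<mu> UNIV \<noteq> 0"
begin

abbreviation "P \<equiv> cm_var borel \<mu>"
abbreviation "c \<equiv> cm_norm borel \<mu>"

lemma dominated_\<mu>: "dominated_cm borel \<mu> P"
  by (rule dominated_cm.intro) (simp_all add: cm_\<mu> P.finite_measure_axioms cmod_le_cm_var[OF cm_\<mu>])

lemma cm_norm_eq_measure: "c = measure P UNIV" and emeasure_P_UNIV: "emeasure P UNIV = ennreal c"
  by (simp_all add: cm_norm_def P.emeasure_eq_measure)

lemma cmod_\<mu>_le: "A \<in> sets borel \<Longrightarrow> cmod (\<mu> A) \<le> measure P A"
  by (rule complex_measure_bounded[OF cm_\<mu> P.finite_measure_axioms])

lemma cmod_\<mu>_le_c: "A \<in> sets borel \<Longrightarrow> cmod (\<mu> A) \<le> c"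
  using cmod_\<mu>_le[of A] P.bounded_measure[of A] by (simp add: cm_norm_eq_measure)

lemma c_pos: "0 < c"
  using cmod_\<mu>_le_c[of UNIV] \<mu>_nonzero by (simp add: less_le_trans[of 0 "cmod (\<mu> UNIV)"])

lemma vmeasure_eq:
  assumes A: "A \<in> sets borel" shows "vmeasure \<mu> A t = \<mu> {s. - s + t \<in> A}"
proof -
  have "(\<lambda>s. indicator A (- s + t) :: complex) = indicator {s. - s + t \<in> A}"
    by (auto simp: indicator_def)
  then show ?thesis
    unfolding vmeasure_def Defs.convolution_def
    using dominated_cm.cm_integral_indicator[OF dominated_\<mu> translate_set_borel[OF A]] by simp
qed

lemma measurable_m_borel: "f \<in> borel_measurable m \<longleftrightarrow> f \<in> borel_measurable borel"
  by (simp add: measurable_cong_sets[OF sets_m refl])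

lemma convolution_measurable:
  assumes F: "F \<in> borel_measurable borel" shows "Defs.convolution \<mu> F \<in> borel_measurable m"
proof -
  note pl = dominated_cm.parts_le[OF dominated_\<mu>]
  have "Defs.convolution \<mu> F \<in> borel_measurable borel"
    unfolding Defs.convolution_def[abs_def] cm_integral_def
    using conv_integral_measurable[OF compact_group radon pl(1) _ F]
      conv_integral_measurable[OF compact_group radon pl(2) _ F]
      conv_integral_measurable[OF compact_group radon pl(3) _ F]
      conv_integral_measurable[OF compact_group radon pl(4) _ F]
    by (intro borel_measurable_add borel_measurable_diff borel_measurable_times borel_measurable_const) simp_all
  then show ?thesis by (simp add: measurable_m_borel)
qed

lemma vmeasure_measurable: "A \<in> sets borel \<Longrightarrow> vmeasure \<mu> A \<in> borel_measurable m"
  unfolding vmeasure_def[abs_def] by (rule convolution_measurable) simp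

lemma cmod_vmeasure_le: "A \<in> sets borel \<Longrightarrow> cmod (vmeasure \<mu> A t) \<le> c"
  using cmod_\<mu>_le_c translate_set_borel[of A t] by (simp add: vmeasure_eq)

lemma cmod_convolution_le: "ennreal (cmod (Defs.convolution \<mu> F t)) \<le> 4 * cv (\<lambda>x. ennreal (cmod (F x))) t"
  unfolding Defs.convolution_def cv_def by (rule dominated_cm.cmod_cm_integral_le[OF dominated_\<mu>])

lemma vmeasure_mult_integrable:
  assumes g: "integrable m g" and A: "A \<in> sets borel"
  shows "integrable m (\<lambda>t. vmeasure \<mu> A t * g t)"
proof (rule Bochner_Integration.integrable_bound)
  show "integrable m (\<lambda>t. c * norm (g t))" using g by simp
  show "(\<lambda>t. vmeasure \<mu> A t * g t) \<in> borel_measurable m"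
    using vmeasure_measurable[OF A] g by simp
  show "AE t in m. norm (vmeasure \<mu> A t * g t) \<le> norm (c * norm (g t))"
    using cmod_vmeasure_le[OF A] c_pos by (auto simp: norm_mult intro!: mult_right_mono)
qed

lemma complex_measure_scalar_vmeasure:
  assumes g: "integrable m g"
  shows "complex_measure borel (scalar_vmeasure m \<mu> g)"
  unfolding complex_measure_def
proof (intro allI impI)
  fix A :: "nat \<Rightarrow> 'g set"
  assume A: "range A \<subseteq> sets borel" "disjoint_family A"
  have Ai: "A i \<in> sets borel" for i using A(1) by auto
  have Au: "(\<Union>i. A i) \<in> sets borel" using A(1) by auto
  let ?S = "\<lambda>B t. {s. - s + t \<in> B}"
  have dj: "disjoint_family (\<lambda>i. ?S (A i) t)" for t
    using A(2) by (auto simp: disjoint_family_on_def)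
  have Si: "?S (A i) t \<in> sets borel" for i t using Ai by (rule translate_set_borel)
  have "(\<lambda>n. \<integral>t. (\<Sum>i<n. vmeasure \<mu> (A i) t) * g t \<partial>m) \<longlonglongrightarrow> (\<integral>t. vmeasure \<mu> (\<Union>i. A i) t * g t \<partial>m)"
  proof (rule integral_dominated_convergence[where w="\<lambda>t. c * norm (g t)"])
    show "(\<lambda>t. vmeasure \<mu> (\<Union>i. A i) t * g t) \<in> borel_measurable m"
      using vmeasure_measurable[OF Au] g by simp
    show "(\<lambda>t. (\<Sum>i<n. vmeasure \<mu> (A i) t) * g t) \<in> borel_measurable m" for n
      using vmeasure_measurable[OF Ai] g by simp
    show "integrable m (\<lambda>t. c * norm (g t))" using g by simp
    show "AE t in m. (\<lambda>n. (\<Sum>i<n. vmeasure \<mu> (A i) t) * g t) \<longlonglongrightarrow> vmeasure \<mu> (\<Union>i. A i) t * g t"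
    proof (rule AE_I2)
      fix t
      have "(\<lambda>i. \<mu> (?S (A i) t)) sums \<mu> (\<Union>i. ?S (A i) t)"
        using Si dj by (intro complex_measureD[OF cm_\<mu>]) auto
      also have "(\<Union>i. ?S (A i) t) = ?S (\<Union>i. A i) t" by auto
      finally have "(\<lambda>i. vmeasure \<mu> (A i) t) sums vmeasure \<mu> (\<Union>i. A i) t"
        by (simp only: vmeasure_eq[OF Ai] vmeasure_eq[OF Au])
      then show "(\<lambda>n. (\<Sum>i<n. vmeasure \<mu> (A i) t) * g t) \<longlonglongrightarrow> vmeasure \<mu> (\<Union>i. A i) t * g t"
        unfolding sums_def by (intro tendsto_mult tendsto_const)
    qed
    \<comment> \<open>A termwise bound by \<open>c\<close> would grow with \<open>n\<close>;
      disjointness keeps the whole partial sum below the total variation.\<close>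
    show "AE t in m. norm ((\<Sum>i<n. vmeasure \<mu> (A i) t) * g t) \<le> c * norm (g t)" for n
    proof (rule AE_I2)
      fix t
      have "cmod (\<Sum>i<n. vmeasure \<mu> (A i) t) \<le> (\<Sum>i<n. measure P (?S (A i) t))"
        using Si by (intro sum_norm_le) (simp add: vmeasure_eq[OF Ai] cmod_\<mu>_le)
      also have "\<dots> = measure P (\<Union>i<n. ?S (A i) t)"
        using Si dj by (intro P.finite_measure_finite_Union[symmetric])
          (auto intro: disjoint_family_on_mono[OF subset_UNIV])
      also have "\<dots> \<le> c" using P.bounded_measure by (simp add: cm_norm_eq_measure)
      finally show "norm ((\<Sum>i<n. vmeasure \<mu> (A i) t) * g t) \<le> c * norm (g t)"
        by (simp add: norm_mult mult_right_mono)
    qed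
  qed
  moreover have "(\<integral>t. (\<Sum>i<n. vmeasure \<mu> (A i) t) * g t \<partial>m) = (\<Sum>i<n. scalar_vmeasure m \<mu> g (A i))" for n
    unfolding scalar_vmeasure_def sum_distrib_right
    using vmeasure_mult_integrable[OF g Ai] by (intro Bochner_Integration.integral_sum)
  ultimately show "(\<lambda>n. scalar_vmeasure m \<mu> g (A n)) sums scalar_vmeasure m \<mu> g (\<Union>n. A n)"
    unfolding sums_def by (simp add: scalar_vmeasure_def[of m \<mu> g "\<Union>n. A n"])
qed

lemma dominated_scalar_vmeasure:
  assumes g: "integrable m g"
    and w: "w \<in> borel_measurable m" "\<And>t. ennreal (cmod (g t)) \<le> w t" "(\<integral>\<^sup>+t. w t \<partial>m) < \<infinity>"
  shows "dominated_cm borel (scalar_vmeasure m \<mu> g) (weighted_conv m P w)"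
proof (rule dominated_cm.intro)
  show "complex_measure borel (scalar_vmeasure m \<mu> g)" by (rule complex_measure_scalar_vmeasure[OF g])
  show "finite_measure (weighted_conv m P w)"
  proof (rule finite_measureI)
    have "emeasure (weighted_conv m P w) UNIV = (\<integral>\<^sup>+t. w t \<partial>m) * ennreal c"
      using w by (simp add: emeasure_weighted_conv emeasure_P_UNIV nn_integral_multc)
    also have "\<dots> \<noteq> \<infinity>" using w(3) by (simp add: ennreal_mult_eq_top_iff)
    finally show "emeasure (weighted_conv m P w) (space (weighted_conv m P w)) \<noteq> \<infinity>" by simp
  qed
  fix A :: "'g set" assume A: "A \<in> sets borel"
  have "ennreal (cmod (scalar_vmeasure m \<mu> g A)) \<le> (\<integral>\<^sup>+t. ennreal (cmod (vmeasure \<mu> A t * g t)) \<partial>m)"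
    unfolding scalar_vmeasure_def by (rule integral_norm_bound_ennreal[OF vmeasure_mult_integrable[OF g A]])
  also have "\<dots> \<le> (\<integral>\<^sup>+t. w t * emeasure P {s. - s + t \<in> A} \<partial>m)"
  proof (rule nn_integral_mono)
    fix t
    have "ennreal (cmod (vmeasure \<mu> A t * g t)) = ennreal (cmod (g t)) * ennreal (cmod (\<mu> {s. - s + t \<in> A}))"
      by (simp add: norm_mult ennreal_mult' vmeasure_eq[OF A] mult.commute)
    also have "\<dots> \<le> w t * emeasure P {s. - s + t \<in> A}"
      by (intro mult_mono w(2) cmod_le_cm_var[OF cm_\<mu>] translate_set_borel[OF A]) auto
    finally show "ennreal (cmod (vmeasure \<mu> A t * g t)) \<le> w t * emeasure P {s. - s + t \<in> A}" .
  qed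
  finally show "ennreal (cmod (scalar_vmeasure m \<mu> g A)) \<le> emeasure (weighted_conv m P w) A"
    by (simp add: emeasure_weighted_conv[OF w(1) A])
qed simp

lemma prob_scaled: "prob_space (scale_measure (ennreal (1 / c)) P)"
  by (rule prob_spaceI) (use c_pos in \<open>simp add: space_scale_measure emeasure_P_UNIV ennreal_mult'[symmetric]\<close>)

text \<open>The Fubini bound applied to \<open>|f|\<close>. Outside this null set
  \<open>enn2real\<close> leaves the convolution unchanged, so Jensen and the test functions may use
  real values.\<close>

lemma cv_finite_AE:
  assumes f: "f \<in> orlicz_space \<Phi> m"
  shows "AE t in m. cv (\<lambda>x. ennreal (cmod (f x))) t \<noteq> \<infinity>"
proof (rule nn_integral_PInf_AE)
  have fi: "integrable m f" by (rule orlicz_integrable[OF m.prob_space_axioms f])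
  then have fm: "f \<in> borel_measurable borel" by (simp add: measurable_m_borel[symmetric])
  then have Fm: "(\<lambda>x. ennreal (cmod (f x))) \<in> borel_measurable borel" by simp
  then show "cv (\<lambda>x. ennreal (cmod (f x))) \<in> borel_measurable m" by (rule cv_measurable_m)
  have "(\<integral>\<^sup>+t. cv (\<lambda>x. ennreal (cmod (f x))) t \<partial>m) \<le> ennreal c * (\<integral>\<^sup>+x. ennreal (cmod (f x)) \<partial>m)"
    using conv_le[OF Fm] by (simp add: emeasure_P_UNIV)
  also have "\<dots> < \<infinity>" using fi by (simp add: integrable_iff_bounded ennreal_mult_less_top)
  finally show "(\<integral>\<^sup>+t. cv (\<lambda>x. ennreal (cmod (f x))) t \<partial>m) \<noteq> \<infinity>" by simp
qed

text \<open>Jensen for the probability measure \<open>|\<mu>| / \<parallel>\<mu>\<parallel>\<close>, then Fubini.\<close>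

lemma young_cv_le_one:
  assumes fm: "f \<in> borel_measurable m" and k: "k > 0" "(\<integral>\<^sup>+ x. \<Phi> (cmod (f x) / k) \<partial>m) \<le> 1" and r: "0 \<le> r" "r < 1"
  shows "(\<integral>\<^sup>+t. \<Phi> (r * (enn2real (cv (\<lambda>x. ennreal (cmod (f x))) t) / (k * c))) \<partial>m) \<le> 1"
proof -
  let ?F = "\<lambda>x. ennreal (cmod (f x))"
  let ?G = "\<lambda>x. \<Phi> (cmod (f x) / k)"
  have f: "f \<in> orlicz_space \<Phi> m" using fm k by (auto simp: orlicz_space_def)
  have fb: "f \<in> borel_measurable borel" using fm by (simp add: measurable_m_borel)
  have Gm: "?G \<in> borel_measurable borel" using fb k by (intro young_measurable[OF young]) auto
  obtain p where p: "p > 0" "\<Phi> p < top" using finite_point .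
  interpret Q: prob_space "scale_measure (ennreal (1 / c)) P" by (rule prob_scaled)
  have "AE t in m. \<Phi> (r * (enn2real (cv ?F t) / (k * c))) \<le> ennreal (1 / c) * cv ?G t"
    using cv_finite_AE[OF f]
  proof eventually_elim
    fix t assume fin: "cv ?F t \<noteq> \<infinity>"
    have um: "(\<lambda>s. cmod (f (- s + t)) / k) \<in> borel_measurable P"
      using measurable_compose[OF translate_P[of t] fb] by simp
    have Gt: "(\<lambda>s. ?G (- s + t)) \<in> borel_measurable P"
      using measurable_compose[OF translate_P[of t] Gm] by simp
    \<comment> \<open>The function of \<open>s\<close> has mean \<open>cv ?F t / (k * c)\<close>
      under the normalised variation, which is finite at this \<open>t\<close>.\<close>
    have "\<Phi> (r * (enn2real (cv ?F t) / (k * c))) \<le>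
        (\<integral>\<^sup>+s. \<Phi> (cmod (f (- s + t)) / k) \<partial>scale_measure (ennreal (1 / c)) P)"
    proof (rule Q.young_jensen[OF young p _ _ _ _ r])
      show "(\<lambda>s. cmod (f (- s + t)) / k) \<in> borel_measurable (scale_measure (ennreal (1 / c)) P)"
        using um by (simp cong: measurable_cong_sets)
      have "(\<integral>\<^sup>+s. ennreal (cmod (f (- s + t)) / k) \<partial>scale_measure (ennreal (1 / c)) P)
          = ennreal (1 / c) * (\<integral>\<^sup>+s. ennreal (1 / k) * ?F (- s + t) \<partial>P)"
        using um k by (simp add: nn_integral_scale_measure ennreal_mult'[symmetric])
      also have "(\<integral>\<^sup>+s. ennreal (1 / k) * ?F (- s + t) \<partial>P) = ennreal (1 / k) * cv ?F t"
        unfolding cv_def using measurable_compose[OF translate_P[of t] fb] by (intro nn_integral_cmult) simp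
      also have "cv ?F t = ennreal (enn2real (cv ?F t))" using fin by (simp add: less_top[symmetric])
      finally show "(\<integral>\<^sup>+s. ennreal (cmod (f (- s + t)) / k) \<partial>scale_measure (ennreal (1 / c)) P)
          = ennreal (enn2real (cv ?F t) / (k * c))"
        using k c_pos by (simp add: ennreal_mult'[symmetric] mult.commute)
    qed (use k c_pos in auto)
    also have "\<dots> = ennreal (1 / c) * cv ?G t"
      using Gt by (simp add: nn_integral_scale_measure cv_def)
    finally show "\<Phi> (r * (enn2real (cv ?F t) / (k * c))) \<le> ennreal (1 / c) * cv ?G t" .
  qed
  then have "(\<integral>\<^sup>+t. \<Phi> (r * (enn2real (cv ?F t) / (k * c))) \<partial>m) \<le> (\<integral>\<^sup>+t. ennreal (1 / c) * cv ?G t \<partial>m)"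
    by (rule nn_integral_mono_AE)
  also have "\<dots> = ennreal (1 / c) * (\<integral>\<^sup>+t. cv ?G t \<partial>m)"
    using cv_measurable_m[OF Gm] by (rule nn_integral_cmult)
  also have "\<dots> \<le> ennreal (1 / c) * (ennreal c * 1)"
    using order_trans[OF conv_le[OF Gm] mult_left_mono[OF k(2)]]
    by (intro mult_left_mono) (simp_all add: emeasure_P_UNIV)
  also have "\<dots> = 1" using c_pos by (simp add: ennreal_mult'[symmetric])
  finally show ?thesis .
qed

lemma weighted_cv_le:
  assumes fm: "f \<in> borel_measurable m" and k: "k > 0" "(\<integral>\<^sup>+ x. \<Phi> (cmod (f x) / k) \<partial>m) \<le> 1"
    and gm: "g \<in> borel_measurable m"
  shows "(\<integral>\<^sup>+t. ennreal (cmod (g t)) * cv (\<lambda>x. ennreal (cmod (f x))) t \<partial>m) \<le> ennreal (k * c) * orlicz_norm \<Phi> m g"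
proof (rule ennreal_le_mult_one_interval)
  fix r :: real assume r: "0 < r" "r < 1"
  let ?F = "\<lambda>x. ennreal (cmod (f x))"
  have f: "f \<in> orlicz_space \<Phi> m" using fm k by (auto simp: orlicz_space_def)
  have Fm: "?F \<in> borel_measurable borel" using fm by (simp add: measurable_m_borel)
  note cvm = cv_measurable_m[OF Fm]
  \<comment> \<open>The factor \<open>r\<close> makes \<open>h\<close> admissible through Jensen and
    is removed at the end by letting it tend to 1. The cast is needed because the Orlicz norm tests
    against complex functions.\<close>
  define h where "h t = complex_of_real (r * (enn2real (cv ?F t) / (k * c)))" for t
  have "h \<in> borel_measurable m" unfolding h_def using cvm by simp
  moreover have "cmod (h t) = r * (enn2real (cv ?F t) / (k * c))" for t
    unfolding h_def norm_of_real using r k c_pos by simp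
  ultimately have "(\<integral>\<^sup>+t. ennreal (cmod (g t * h t)) \<partial>m) \<le> orlicz_norm \<Phi> m g"
    unfolding orlicz_norm_def using young_cv_le_one[OF fm k, of r] r by (intro SUP_upper) simp
  then have "ennreal (k * c) * (\<integral>\<^sup>+t. ennreal (cmod (g t * h t)) \<partial>m) \<le> ennreal (k * c) * orlicz_norm \<Phi> m g"
    by (rule mult_left_mono) simp
  also have "ennreal (k * c) * (\<integral>\<^sup>+t. ennreal (cmod (g t * h t)) \<partial>m)
      = (\<integral>\<^sup>+t. ennreal (k * c) * ennreal (cmod (g t * h t)) \<partial>m)"
    using gm \<open>h \<in> borel_measurable m\<close> by (intro nn_integral_cmult[symmetric]) simp
  also have "\<dots> = (\<integral>\<^sup>+t. ennreal r * (ennreal (cmod (g t)) * cv ?F t) \<partial>m)"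
  proof (rule nn_integral_cong_AE)
    show "AE t in m. ennreal (k * c) * ennreal (cmod (g t * h t)) = ennreal r * (ennreal (cmod (g t)) * cv ?F t)"
      using cv_finite_AE[OF f]
    proof eventually_elim
      fix t assume "cv ?F t \<noteq> \<infinity>"
      then obtain b where b: "cv ?F t = ennreal b" "0 \<le> b" by (cases "cv ?F t") auto
      have "k * c * cmod (g t * h t) = r * (cmod (g t) * b)"
        using r k c_pos b unfolding h_def norm_mult norm_of_real by simp
      then show "ennreal (k * c) * ennreal (cmod (g t * h t)) = ennreal r * (ennreal (cmod (g t)) * cv ?F t)"
        using r k c_pos b by (simp add: ennreal_mult'[symmetric] ennreal_mult''[symmetric] del: norm_mult)
    qed
  qed
  also have "\<dots> = ennreal r * (\<integral>\<^sup>+t. ennreal (cmod (g t)) * cv ?F t \<partial>m)"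
    using gm cvm by (intro nn_integral_cmult) simp
  finally show "ennreal r * (\<integral>\<^sup>+t. ennreal (cmod (g t)) * cv ?F t \<partial>m) \<le> ennreal (k * c) * orlicz_norm \<Phi> m g" .
qed

section \<open>Upper bound for the norm of the inclusion\<close>

lemma nn_integral_cm_var_le:
  assumes g: "g \<in> dual_space \<Phi> m"
    and fm: "f \<in> borel_measurable m" and k: "k > 0" "(\<integral>\<^sup>+ x. \<Phi> (cmod (f x) / k) \<partial>m) \<le> 1"
  shows "(\<integral>\<^sup>+ x. ennreal (cmod (f x)) \<partial>cm_var borel (scalar_vmeasure m \<mu> g)) \<le> ennreal (k * c) * orlicz_norm \<Phi> m g"
proof -
  have gi: "integrable m g" by (rule dual_space_integrable[OF m.prob_space_axioms g])
  then have wm: "(\<lambda>t. ennreal (cmod (g t))) \<in> borel_measurable m" by simp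
  have "cm_var borel (scalar_vmeasure m \<mu> g) \<le> weighted_conv m P (\<lambda>t. ennreal (cmod (g t)))"
    by (rule dominated_cm.cm_var_le[OF dominated_scalar_vmeasure[OF gi wm]])
      (use gi in \<open>auto simp: integrable_iff_bounded\<close>)
  then have "(\<integral>\<^sup>+ x. ennreal (cmod (f x)) \<partial>cm_var borel (scalar_vmeasure m \<mu> g)) \<le>
      (\<integral>\<^sup>+ x. ennreal (cmod (f x)) \<partial>weighted_conv m P (\<lambda>t. ennreal (cmod (g t))))"
    by (intro nn_integral_mono_measure) simp_all
  also have "\<dots> = (\<integral>\<^sup>+t. ennreal (cmod (g t)) * cv (\<lambda>x. ennreal (cmod (f x))) t \<partial>m)"
    using fm by (intro nn_integral_weighted_conv[OF wm]) (simp add: measurable_m_borel)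
  also have "\<dots> \<le> ennreal (k * c) * orlicz_norm \<Phi> m g"
    using gi by (intro weighted_cv_le[OF fm k]) simp
  finally show ?thesis .
qed

lemma vm_norm_le:
  assumes f: "f \<in> orlicz_space \<Phi> m"
  shows "vm_norm \<Phi> m \<mu> f \<le> ennreal (luxemburg_norm \<Phi> m f * c)"
proof (rule luxemburg_lower_bound[OF c_pos f])
  fix k assume k: "k > 0" "(\<integral>\<^sup>+ x. \<Phi> (cmod (f x) / k) \<partial>m) \<le> 1"
  have fm: "f \<in> borel_measurable m" using f by (simp add: orlicz_space_def)
  show "vm_norm \<Phi> m \<mu> f \<le> ennreal (k * c)"
    unfolding vm_norm_def
  proof (rule SUP_least)
    fix g assume "g \<in> dual_ball \<Phi> m"
    then have g: "g \<in> dual_space \<Phi> m" "orlicz_norm \<Phi> m g \<le> 1" by (auto simp: dual_ball_def)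
    have "ennreal (k * c) * orlicz_norm \<Phi> m g \<le> ennreal (k * c) * 1" by (rule mult_left_mono[OF g(2)]) simp
    with nn_integral_cm_var_le[OF g(1) fm k]
    show "(\<integral>\<^sup>+ x. ennreal (cmod (f x)) \<partial>cm_var borel (scalar_vmeasure m \<mu> g)) \<le> ennreal (k * c)" by simp
  qed
qed

lemma inclusion_norm_le: "inclusion_norm \<Phi> m \<mu> \<le> ennreal c"
  unfolding inclusion_norm_def
proof (rule SUP_least)
  fix f assume "f \<in> {f \<in> orlicz_space \<Phi> m. luxemburg_norm \<Phi> m f \<le> 1}"
  then have f: "f \<in> orlicz_space \<Phi> m" "luxemburg_norm \<Phi> m f \<le> 1" by auto
  have "ennreal (luxemburg_norm \<Phi> m f * c) \<le> ennreal (1 * c)"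
    using f(2) c_pos by (intro ennreal_leI mult_right_mono) auto
  with vm_norm_le[OF f(1)] show "vm_norm \<Phi> m \<mu> f \<le> ennreal c" by simp
qed

end

section \<open>Integration against the scalar measures and membership in \<open>L1\<close> of the
  vector measure\<close>

context orlicz_conv
begin

text \<open>The bound \<open>1 \<le> w\<close> turns finiteness of the weighted integral into
  finiteness of the convolution almost everywhere; a weight \<open>|g|\<close> would say nothing
  where \<open>g\<close> vanishes.\<close>

lemma integrable_cv_AE:
  assumes w: "w \<in> borel_measurable m" "\<And>t. 1 \<le> w t" and F: "integrable (weighted_conv m P w) F"
  shows "(\<integral>\<^sup>+t. w t * cv (\<lambda>x. ennreal (cmod (F x))) t \<partial>m) < \<infinity>"
    and "AE t in m. integrable P (\<lambda>s. F (- s + t))"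
proof -
  have Fm: "F \<in> borel_measurable borel"
    using borel_measurable_integrable[OF F] by (simp add: measurable_cong_sets[OF sets_weighted_conv refl])
  then have nF: "(\<lambda>x. ennreal (cmod (F x))) \<in> borel_measurable borel" by simp
  let ?c = "cv (\<lambda>x. ennreal (cmod (F x)))"
  show fin: "(\<integral>\<^sup>+t. w t * ?c t \<partial>m) < \<infinity>"
    using F nn_integral_weighted_conv[OF w(1) nF] by (simp add: integrable_iff_bounded)
  have "AE t in m. w t * ?c t \<noteq> \<infinity>"
    using fin cv_measurable_m[OF nF] w(1) by (intro nn_integral_PInf_AE) auto
  then show "AE t in m. integrable P (\<lambda>s. F (- s + t))"
  proof eventually_elim
    fix t assume *: "w t * ?c t \<noteq> \<infinity>"
    have "?c t \<le> w t * ?c t" using mult_right_mono[OF w(2)[of t], of "?c t"] by simp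
    with * have "?c t < \<infinity>" by (auto simp: less_top[symmetric] top_unique)
    then show "integrable P (\<lambda>s. F (- s + t))"
      unfolding cv_def by (intro integrableI_bounded measurable_compose[OF translate_P Fm])
  qed
qed

lemma convolution_mult_integrable:
  assumes g: "g \<in> borel_measurable m" and w: "w \<in> borel_measurable m" "\<And>t. 1 \<le> w t" "\<And>t. ennreal (cmod (g t)) \<le> w t"
    and F: "integrable (weighted_conv m P w) F"
  shows "integrable m (\<lambda>t. Defs.convolution \<mu> F t * g t)"
proof (rule integrableI_bounded)
  have Fm: "F \<in> borel_measurable borel"
    using borel_measurable_integrable[OF F] by (simp add: measurable_cong_sets[OF sets_weighted_conv refl])
  let ?c = "cv (\<lambda>x. ennreal (cmod (F x)))"
  show "(\<lambda>t. Defs.convolution \<mu> F t * g t) \<in> borel_measurable m"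
    using convolution_measurable[OF Fm] g by simp
  have "(\<integral>\<^sup>+t. ennreal (norm (Defs.convolution \<mu> F t * g t)) \<partial>m) \<le> (\<integral>\<^sup>+t. 4 * (w t * ?c t) \<partial>m)"
  proof (rule nn_integral_mono)
    fix t
    have "ennreal (norm (Defs.convolution \<mu> F t * g t)) = ennreal (cmod (g t)) * ennreal (cmod (Defs.convolution \<mu> F t))"
      by (simp add: norm_mult ennreal_mult' mult.commute)
    also have "\<dots> \<le> w t * (4 * ?c t)" by (intro mult_mono w(3) cmod_convolution_le) auto
    finally show "ennreal (norm (Defs.convolution \<mu> F t * g t)) \<le> 4 * (w t * ?c t)"
      by (simp add: mult.left_commute)
  qed
  also have "\<dots> = 4 * (\<integral>\<^sup>+t. w t * ?c t \<partial>m)"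
    using cv_measurable_m[of "\<lambda>x. ennreal (cmod (F x))"] Fm w(1) by (intro nn_integral_cmult) simp
  also have "\<dots> < \<infinity>" using integrable_cv_AE(1)[OF w(1,2) F] by (simp add: ennreal_mult_less_top)
  finally show "(\<integral>\<^sup>+t. ennreal (norm (Defs.convolution \<mu> F t * g t)) \<partial>m) < \<infinity>" .
qed

text \<open>On indicators this is the definition of the scalar measure. Both sides are additive in
  \<open>F\<close> and respect dominated limits in \<open>L1\<close> of the weighted measure, so the
  equation extends without interchanging complex integrals.\<close>

lemma cm_integral_scalar_vmeasure:
  assumes g: "integrable m g"
    and w: "w \<in> borel_measurable m" "\<And>t. 1 \<le> w t" "\<And>t. ennreal (cmod (g t)) \<le> w t" "(\<integral>\<^sup>+t. w t \<partial>m) < \<infinity>"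
    and F: "integrable (weighted_conv m P w) F"
  shows "cm_integral borel (scalar_vmeasure m \<mu> g) F = (\<integral>t. Defs.convolution \<mu> F t * g t \<partial>m)"
proof -
  interpret N: dominated_cm borel "scalar_vmeasure m \<mu> g" "weighted_conv m P w"
    by (rule dominated_scalar_vmeasure[OF g w(1,3,4)])
  interpret U: dominated_cm borel \<mu> P by (rule dominated_\<mu>)
  have gm: "g \<in> borel_measurable m" using g by simp
  note ci = convolution_mult_integrable[OF gm w(1-3)]
  have cM: "H \<in> borel_measurable borel" if "integrable (weighted_conv m P w) H" for H :: "'g \<Rightarrow> complex"
    using borel_measurable_integrable[OF that] by (simp add: measurable_cong_sets[OF sets_weighted_conv refl])
  show ?thesis using F
  proof (induction rule: integrable_induct)
    case (base A a)
    then have A: "A \<in> sets borel" by simp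
    have e: "(\<lambda>x. indicator A x *\<^sub>R a) = (\<lambda>x. indicator A x * a)"
      by (auto simp: indicator_def)
    have "Defs.convolution \<mu> (\<lambda>x. indicator A x * a) t = vmeasure \<mu> A t * a" for t
      unfolding vmeasure_def Defs.convolution_def by (rule U.cm_integral_mult_right)
    moreover have "(\<integral>t. vmeasure \<mu> A t * a * g t \<partial>m) = (\<integral>t. vmeasure \<mu> A t * g t * a \<partial>m)"
      by (simp add: mult.commute mult.left_commute)
    ultimately show ?case
      unfolding e N.cm_integral_mult_right N.cm_integral_indicator[OF A]
      by (simp add: scalar_vmeasure_def)
  next
    case (add f h)
    \<comment> \<open>Additivity is available only where both translates are integrable; elsewhere
      the convolutions may be default values.\<close>
    have "AE t in m. Defs.convolution \<mu> (\<lambda>x. f x + h x) t * g t =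
        Defs.convolution \<mu> f t * g t + Defs.convolution \<mu> h t * g t"
      using integrable_cv_AE(2)[OF w(1,2) add(1)] integrable_cv_AE(2)[OF w(1,2) add(2)]
    proof eventually_elim
      fix t assume "integrable P (\<lambda>s. f (- s + t))" "integrable P (\<lambda>s. h (- s + t))"
      from U.cm_integral_add[OF this]
      show "Defs.convolution \<mu> (\<lambda>x. f x + h x) t * g t = Defs.convolution \<mu> f t * g t + Defs.convolution \<mu> h t * g t"
        by (simp add: Defs.convolution_def distrib_right)
    qed
    moreover have "integrable (weighted_conv m P w) (\<lambda>x. f x + h x)" using add by simp
    ultimately have "(\<integral>t. Defs.convolution \<mu> (\<lambda>x. f x + h x) t * g t \<partial>m) =
        (\<integral>t. Defs.convolution \<mu> f t * g t + Defs.convolution \<mu> h t * g t \<partial>m)"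
      using ci[of "\<lambda>x. f x + h x"] ci[OF add(1)] ci[OF add(2)]
      by (intro integral_cong_AE) auto
    also have "\<dots> = (\<integral>t. Defs.convolution \<mu> f t * g t \<partial>m) + (\<integral>t. Defs.convolution \<mu> h t * g t \<partial>m)"
      by (rule Bochner_Integration.integral_add[OF ci[OF add(1)] ci[OF add(2)]])
    finally show ?case using N.cm_integral_add[OF add(1,2)] add(3,4) by simp
  next
    case (lim f s)
    let ?c = "cv (\<lambda>x. ennreal (cmod (f x)))"
    have sm: "s i \<in> borel_measurable borel" for i using cM[OF lim(1)] .
    have fm: "f \<in> borel_measurable borel" using cM[OF lim(4)] .
    have L: "(\<lambda>i. s i x) \<longlonglongrightarrow> f x" "norm (s i x) \<le> 2 * norm (f x)" for x i
      using lim(2,3)[of x] by simp_all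
    have "(\<lambda>i. cm_integral borel (scalar_vmeasure m \<mu> g) (s i)) \<longlonglongrightarrow> cm_integral borel (scalar_vmeasure m \<mu> g) f"
      by (rule N.cm_integral_dominated_convergence[OF fm sm _ L(1) L(2)]) (use lim(4) in simp)
    \<comment> \<open>In the majorant, 8 is 4 for the Jordan parts times 2 from the bound of the
      approximants by \<open>2 * norm (f x)\<close>.\<close>
    moreover have "(\<lambda>i. \<integral>t. Defs.convolution \<mu> (s i) t * g t \<partial>m) \<longlonglongrightarrow> (\<integral>t. Defs.convolution \<mu> f t * g t \<partial>m)"
    proof (rule integral_dominated_convergence[where w="\<lambda>t. 8 * enn2real (w t * ?c t)"])
      show "(\<lambda>t. Defs.convolution \<mu> f t * g t) \<in> borel_measurable m"
        using convolution_measurable[OF fm] gm by simp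
      show "(\<lambda>t. Defs.convolution \<mu> (s i) t * g t) \<in> borel_measurable m" for i
        using convolution_measurable[OF sm] gm by simp
      have cm: "?c \<in> borel_measurable m" using fm by (intro cv_measurable_m) simp
      note fin = integrable_cv_AE(1)[OF w(1,2) lim(4)]
      have AEfin: "AE t in m. w t * ?c t \<noteq> \<infinity>"
        using fin cm w(1) by (intro nn_integral_PInf_AE) auto
      have "(\<integral>\<^sup>+t. ennreal (enn2real (w t * ?c t)) \<partial>m) = (\<integral>\<^sup>+t. w t * ?c t \<partial>m)"
        using AEfin by (intro nn_integral_cong_AE) (auto simp: less_top[symmetric])
      then have "integrable m (\<lambda>t. enn2real (w t * ?c t))"
        using fin cm w(1) by (intro integrableI_nonneg) auto
      then show "integrable m (\<lambda>t. 8 * enn2real (w t * ?c t))" by simp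
      show "AE t in m. (\<lambda>i. Defs.convolution \<mu> (s i) t * g t) \<longlonglongrightarrow> Defs.convolution \<mu> f t * g t"
        using integrable_cv_AE(2)[OF w(1,2) lim(4)]
      proof eventually_elim
        fix t assume it: "integrable P (\<lambda>s. f (- s + t))"
        have tb: "(\<lambda>s. - s + t) \<in> borel_measurable borel" by (rule translate_borel_measurable)
        have "(\<lambda>i. cm_integral borel \<mu> (\<lambda>x. s i (- x + t))) \<longlonglongrightarrow> cm_integral borel \<mu> (\<lambda>x. f (- x + t))"
          by (rule U.cm_integral_dominated_convergence[where w="\<lambda>x. 2 * norm (f (- x + t))"])
            (use it L measurable_compose[OF tb fm] measurable_compose[OF tb sm] in simp_all)
        then show "(\<lambda>i. Defs.convolution \<mu> (s i) t * g t) \<longlonglongrightarrow> Defs.convolution \<mu> f t * g t"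
          unfolding Defs.convolution_def by (intro tendsto_mult tendsto_const)
      qed
      show "AE t in m. norm (Defs.convolution \<mu> (s i) t * g t) \<le> 8 * enn2real (w t * ?c t)" for i
        using AEfin
      proof eventually_elim
        fix t assume fint: "w t * ?c t \<noteq> \<infinity>"
        have "cv (\<lambda>x. ennreal (cmod (s i x))) t \<le> cv (\<lambda>x. 2 * ennreal (cmod (f x))) t"
        proof (rule cv_mono)
          fix x
          have "ennreal (cmod (s i x)) \<le> ennreal (2 * cmod (f x))" by (rule ennreal_leI[OF L(2)])
          then show "ennreal (cmod (s i x)) \<le> 2 * ennreal (cmod (f x))" by (simp add: ennreal_mult')
        qed
        also have "\<dots> = 2 * ?c t"
          unfolding cv_def using measurable_compose[OF translate_P[of t] fm] by (intro nn_integral_cmult) simp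
        finally have le: "cv (\<lambda>x. ennreal (cmod (s i x))) t \<le> 2 * ?c t" .
        have "ennreal (norm (Defs.convolution \<mu> (s i) t * g t)) =
            ennreal (cmod (g t)) * ennreal (cmod (Defs.convolution \<mu> (s i) t))"
          by (simp add: norm_mult ennreal_mult' mult.commute)
        also have "\<dots> \<le> w t * (4 * (2 * ?c t))"
          using order_trans[OF cmod_convolution_le[of "s i" t] mult_left_mono[OF le, of 4]]
          by (intro mult_mono w(3)) auto
        also have "\<dots> = 8 * (w t * ?c t)" by (simp add: mult.left_commute mult.assoc[symmetric])
        also have "\<dots> = ennreal (8 * enn2real (w t * ?c t))"
          using fint by (simp add: ennreal_mult' less_top[symmetric])
        finally show "norm (Defs.convolution \<mu> (s i) t * g t) \<le> 8 * enn2real (w t * ?c t)"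
          by (subst (asm) ennreal_le_iff) auto
      qed
    qed
    ultimately show ?case using lim(5) LIMSEQ_unique by simp
  qed
qed

lemma integrable_cm_var:
  assumes f: "f \<in> orlicz_space \<Phi> m" and g: "g \<in> dual_space \<Phi> m"
  shows "integrable (cm_var borel (scalar_vmeasure m \<mu> g)) f"
proof (rule integrableI_bounded)
  from f obtain k where k: "k > 0" "(\<integral>\<^sup>+ x. \<Phi> (cmod (f x) / k) \<partial>m) \<le> 1" and fm: "f \<in> borel_measurable m"
    by (auto simp: orlicz_space_def)
  show "f \<in> borel_measurable (cm_var borel (scalar_vmeasure m \<mu> g))"
    using fm by (simp add: measurable_m_borel measurable_cong_sets[OF sets_cm_var refl])
  have "(\<integral>\<^sup>+ x. ennreal (cmod (f x)) \<partial>cm_var borel (scalar_vmeasure m \<mu> g)) \<le> ennreal (k * c) * orlicz_norm \<Phi> m g"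
    by (rule nn_integral_cm_var_le[OF g fm k])
  also have "\<dots> < \<infinity>" using orlicz_norm_finite[OF g] by (simp add: ennreal_mult_less_top)
  finally show "(\<integral>\<^sup>+ x. ennreal (norm (f x)) \<partial>cm_var borel (scalar_vmeasure m \<mu> g)) < \<infinity>" .
qed

text \<open>In the divisor \<open>8 * k * c\<close>, a factor 4 pays for the Jordan parts and the
  remaining 2 supplies the value \<open>r = 1/2\<close> for the Jensen estimate.\<close>

lemma convolution_orlicz:
  assumes f: "f \<in> orlicz_space \<Phi> m"
  shows "Defs.convolution \<mu> f \<in> orlicz_space \<Phi> m"
proof -
  from f obtain k where k: "k > 0" "(\<integral>\<^sup>+ x. \<Phi> (cmod (f x) / k) \<partial>m) \<le> 1" and fm: "f \<in> borel_measurable m"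
    by (auto simp: orlicz_space_def)
  let ?c = "cv (\<lambda>x. ennreal (cmod (f x)))"
  have "(\<integral>\<^sup>+ t. \<Phi> (cmod (Defs.convolution \<mu> f t) / (8 * k * c)) \<partial>m) \<le>
    (\<integral>\<^sup>+t. \<Phi> (1 / 2 * (enn2real (?c t) / (k * c))) \<partial>m)"
  proof (rule nn_integral_mono_AE)
    show "AE t in m. \<Phi> (cmod (Defs.convolution \<mu> f t) / (8 * k * c)) \<le> \<Phi> (1 / 2 * (enn2real (?c t) / (k * c)))"
      using cv_finite_AE[OF f]
    proof eventually_elim
      fix t assume "?c t \<noteq> \<infinity>"
      then obtain b where b: "?c t = ennreal b" "0 \<le> b" by (cases "?c t") auto
      have "ennreal (cmod (Defs.convolution \<mu> f t)) \<le> ennreal (4 * b)"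
        using cmod_convolution_le[of f t] b by (simp add: ennreal_mult')
      then have "cmod (Defs.convolution \<mu> f t) \<le> 4 * b" using b by simp
      then have "cmod (Defs.convolution \<mu> f t) / (8 * k * c) \<le> 4 * b / (8 * k * c)"
        using k c_pos by (intro divide_right_mono) auto
      then show "\<Phi> (cmod (Defs.convolution \<mu> f t) / (8 * k * c)) \<le> \<Phi> (1 / 2 * (enn2real (?c t) / (k * c)))"
        using k c_pos b by (intro young_mono[OF young]) auto
    qed
  qed
  also have "\<dots> \<le> 1" by (rule young_cv_le_one[OF fm k]) auto
  finally have "(\<integral>\<^sup>+ t. \<Phi> (cmod (Defs.convolution \<mu> f t) / (8 * k * c)) \<partial>m) \<le> 1" .
  moreover have "0 < 8 * k * c" using k c_pos by simp
  moreover have "Defs.convolution \<mu> f \<in> borel_measurable m"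
    using fm by (intro convolution_measurable) (simp add: measurable_m_borel)
  ultimately show ?thesis unfolding orlicz_space_def by blast
qed

lemma orlicz_space_mono:
  assumes f: "f \<in> orlicz_space \<Phi> m" and h: "h \<in> borel_measurable m" "\<And>x. cmod (h x) \<le> cmod (f x)"
  shows "h \<in> orlicz_space \<Phi> m"
proof -
  from f obtain k where k: "k > 0" "(\<integral>\<^sup>+ x. \<Phi> (cmod (f x) / k) \<partial>m) \<le> 1" by (auto simp: orlicz_space_def)
  have "(\<integral>\<^sup>+ x. \<Phi> (cmod (h x) / k) \<partial>m) \<le> (\<integral>\<^sup>+ x. \<Phi> (cmod (f x) / k) \<partial>m)"
    using k h by (intro nn_integral_mono young_mono[OF young] divide_right_mono) auto
  with k have "(\<integral>\<^sup>+ x. \<Phi> (cmod (h x) / k) \<partial>m) \<le> 1" by simp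
  with k(1) h(1) show ?thesis by (auto simp: orlicz_space_def)
qed

lemma cm_integral_orlicz:
  assumes f: "f \<in> orlicz_space \<Phi> m" and g: "g \<in> dual_space \<Phi> m"
  shows "cm_integral borel (scalar_vmeasure m \<mu> g) f = (\<integral>t. Defs.convolution \<mu> f t * g t \<partial>m)"
proof -
  from f obtain k where k: "k > 0" "(\<integral>\<^sup>+ x. \<Phi> (cmod (f x) / k) \<partial>m) \<le> 1" and fm: "f \<in> borel_measurable m"
    by (auto simp: orlicz_space_def)
  have fb: "f \<in> borel_measurable borel" using fm by (simp add: measurable_m_borel)
  then have nf: "(\<lambda>x. ennreal (cmod (f x))) \<in> borel_measurable borel" by simp
  have gi: "integrable m g" by (rule dual_space_integrable[OF m.prob_space_axioms g])
  have fi: "integrable m f" by (rule orlicz_integrable[OF m.prob_space_axioms f])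
  \<comment> \<open>The summand 1 is handled by the Fubini bound for \<open>f\<close>, the summand
    \<open>|g|\<close> by the Orlicz pairing.\<close>
  let ?w = "\<lambda>t. 1 + ennreal (cmod (g t))"
  have w: "?w \<in> borel_measurable m" using gi by simp
  show ?thesis
  proof (rule cm_integral_scalar_vmeasure[OF gi w])
    show "(\<integral>\<^sup>+t. ?w t \<partial>m) < \<infinity>"
    proof -
      have "(\<integral>\<^sup>+t. ?w t \<partial>m) = (\<integral>\<^sup>+t. 1 \<partial>m) + (\<integral>\<^sup>+t. ennreal (cmod (g t)) \<partial>m)"
        using gi by (intro nn_integral_add) simp_all
      then show ?thesis
        using gi m.emeasure_space_1 by (simp add: integrable_iff_bounded)
    qed
    let ?c = "cv (\<lambda>x. ennreal (cmod (f x)))"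
    have "(\<integral>\<^sup>+x. ennreal (cmod (f x)) \<partial>weighted_conv m P ?w) = (\<integral>\<^sup>+t. ?w t * ?c t \<partial>m)"
      by (rule nn_integral_weighted_conv[OF w nf])
    also have "\<dots> = (\<integral>\<^sup>+t. ?c t + ennreal (cmod (g t)) * ?c t \<partial>m)" by (simp add: distrib_right)
    also have "\<dots> = (\<integral>\<^sup>+t. ?c t \<partial>m) + (\<integral>\<^sup>+t. ennreal (cmod (g t)) * ?c t \<partial>m)"
      using cv_measurable_m[OF nf] gi by (intro nn_integral_add) simp_all
    also have "\<dots> \<le> ennreal c * (\<integral>\<^sup>+x. ennreal (cmod (f x)) \<partial>m) + ennreal (k * c) * orlicz_norm \<Phi> m g"
      using conv_le[OF nf] weighted_cv_le[OF fm k] gi by (intro add_mono) (simp_all add: emeasure_P_UNIV)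
    also have "\<dots> < \<infinity>"
      using fi orlicz_norm_finite[OF g] by (simp add: integrable_iff_bounded ennreal_mult_less_top)
    finally show "integrable (weighted_conv m P ?w) f"
      using fb by (intro integrableI_bounded) (simp_all add: measurable_cong_sets[OF sets_weighted_conv refl])
  qed simp_all
qed

text \<open>Indicators are bounded, hence in the dual space. Testing against them equates the
  integrals over all measurable sets, which determine an integrable function almost
  everywhere.\<close>

lemma orlicz_eqI:
  assumes y: "y \<in> orlicz_space \<Phi> m" and x: "x \<in> orlicz_space \<Phi> m"
    and eq: "\<And>g. g \<in> dual_space \<Phi> m \<Longrightarrow> (\<integral>t. y t * g t \<partial>m) = (\<integral>t. x t * g t \<partial>m)"
  shows "AE t in m. y t = x t"
proof (rule m.density_unique_banach)
  show "integrable m y" "integrable m x" using orlicz_integrable[OF m.prob_space_axioms] y x by auto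
  fix B assume B: "B \<in> sets m"
  then have "(indicator B :: 'g \<Rightarrow> complex) \<in> dual_space \<Phi> m"
    by (intro dual_space_bounded[OF m.prob_space_axioms, of _ 1]) (auto simp: indicator_def)
  from eq[OF this] show "set_lebesgue_integral m B y = set_lebesgue_integral m B x"
    by (simp add: set_lebesgue_integral_def scaleR_conv_of_real of_real_indicator mult.commute)
qed

lemma vm_L1_orlicz:
  assumes f: "f \<in> orlicz_space \<Phi> m"
  shows "vm_L1 \<Phi> m \<mu> f"
  unfolding vm_L1_def
proof (intro conjI ballI)
  have fb: "f \<in> borel_measurable borel" using f by (simp add: orlicz_space_def measurable_m_borel)
  then show "f \<in> borel_measurable borel" .
  show "integrable (cm_var borel (scalar_vmeasure m \<mu> g)) f" if "g \<in> dual_space \<Phi> m" for g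
    by (rule integrable_cm_var[OF f that])
  fix A :: "'g set" assume A: "A \<in> sets borel"
  let ?F = "\<lambda>x. indicator A x * f x"
  have F: "?F \<in> orlicz_space \<Phi> m"
    using fb A by (intro orlicz_space_mono[OF f]) (auto simp: measurable_m_borel norm_mult indicator_def)
  let ?x = "Defs.convolution \<mu> ?F"
  note x = convolution_orlicz[OF F] and eq = cm_integral_orlicz[OF F]
  have "AE t in m. y t = ?x t" if "y \<in> orlicz_space \<Phi> m"
    "\<forall>g\<in>dual_space \<Phi> m. cm_integral borel (scalar_vmeasure m \<mu> g) ?F = (\<integral>t. y t * g t \<partial>m)" for y
    using that eq by (intro orlicz_eqI[OF that(1) x]) metis
  then show "\<exists>xA\<in>orlicz_space \<Phi> m.
        (\<forall>g\<in>dual_space \<Phi> m. cm_integral borel (scalar_vmeasure m \<mu> g) ?F = (\<integral>t. xA t * g t \<partial>m)) \<and>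
        (\<forall>y\<in>orlicz_space \<Phi> m.
            (\<forall>g\<in>dual_space \<Phi> m. cm_integral borel (scalar_vmeasure m \<mu> g) ?F = (\<integral>t. y t * g t \<partial>m))
            \<longrightarrow> (AE t in m. y t = xA t))"
    using x eq by (intro bexI[of _ ?x]) auto
qed

text \<open>The lower bound is attained on constants: with \<open>d = sup {x. \<Phi> x \<le> 1}\<close>, the function \<open>d\<close> lies in the unit
  ball of the Orlicz space and \<open>1 / d\<close> in that of its dual.\<close>

lemma inclusion_norm_ge: "ennreal (cmod (\<mu> UNIV)) \<le> inclusion_norm \<Phi> m \<mu>"
proof -
  obtain a where a: "a > 0" "\<And>x. 0 \<le> x \<Longrightarrow> ennreal (a * x) \<le> \<Phi> x + 1"
    using young_linear_lower_bound[OF young] by blast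
  obtain p where p: "p > 0" "\<Phi> p < top" using finite_point .
  obtain q where q: "q > 0" "\<Phi> q \<le> 1" using young_le_one[OF young p] .
  define S where "S = {x. 0 \<le> x \<and> \<Phi> x \<le> 1}"
  define d where "d = Sup S"
  have "x \<le> 2 / a" if "x \<in> S" for x
  proof -
    have "ennreal (a * x) \<le> \<Phi> x + 1" using a(2)[of x] that by (simp add: S_def)
    also have "\<dots> \<le> 1 + 1" using that by (intro add_right_mono) (simp add: S_def)
    finally have "ennreal (a * x) \<le> 1 + 1" .
    then have "ennreal (a * x) \<le> ennreal 2" by simp
    then have "a * x \<le> 2" by (subst (asm) ennreal_le_iff) auto
    then show ?thesis using a by (simp add: field_simps)
  qed
  then have bdd: "bdd_above S" by (rule bdd_aboveI)
  have qS: "q \<in> S" using q by (simp add: S_def)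
  then have d: "d > 0" using cSup_upper[OF qS bdd] q by (simp add: d_def)
  \<comment> \<open>The supremum need not be attained, since \<open>\<Phi>\<close> may jump at
    \<open>d\<close>. Hence the constant \<open>d\<close> is tested only after division by
    \<open>k > 1\<close>, and its norm bound 1 arises as an infimum.\<close>
  have below: "\<Phi> x \<le> 1" if "0 \<le> x" "x < d" for x
  proof -
    have "S \<noteq> {}" using qS by blast
    moreover have "x < Sup S" using that(2) by (simp add: d_def)
    ultimately obtain z where z: "z \<in> S" "x < z" using less_cSup_iff[OF _ bdd] by blast
    then have "\<Phi> x \<le> \<Phi> z" using that by (intro young_mono[OF young]) auto
    also have "\<dots> \<le> 1" using z by (simp add: S_def)
    finally show ?thesis .
  qed
  let ?f = "\<lambda>_::'g. complex_of_real d" and ?g = "\<lambda>_::'g. complex_of_real (1 / d)"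
  have fk: "(\<integral>\<^sup>+ x. \<Phi> (cmod (?f x) / k) \<partial>m) \<le> 1" if "k > 1" for k
  proof -
    have "\<Phi> (d / k) \<le> 1" using that d by (intro below) (auto simp: field_simps)
    then show ?thesis using d m.emeasure_space_1 by simp
  qed
  have f: "?f \<in> orlicz_space \<Phi> m" using fk[of 2] by (auto simp: orlicz_space_def intro!: exI[of _ 2])
  have "luxemburg_norm \<Phi> m ?f \<le> 1"
  proof (rule field_le_epsilon)
    fix e :: real assume "e > 0"
    then show "luxemburg_norm \<Phi> m ?f \<le> 1 + e"
      unfolding luxemburg_norm_def using fk[of "1 + e"]
      by (intro cInf_lower) (auto intro: bdd_belowI[of _ 0])
  qed
  then have le1: "vm_norm \<Phi> m \<mu> ?f \<le> inclusion_norm \<Phi> m \<mu>"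
    unfolding inclusion_norm_def using f by (intro SUP_upper) simp
  have g: "?g \<in> dual_space \<Phi> m" by (rule dual_space_bounded[OF m.prob_space_axioms _ order_refl]) simp
  have "orlicz_norm \<Phi> m ?g \<le> 1"
    unfolding orlicz_norm_def
  proof (rule SUP_least)
    fix h assume "h \<in> {h \<in> borel_measurable m. (\<integral>\<^sup>+ x. \<Phi> (cmod (h x)) \<partial>m) \<le> 1}"
    then have h: "h \<in> borel_measurable m" "(\<integral>\<^sup>+ x. \<Phi> (cmod (h x)) \<partial>m) \<le> 1" by auto
    then have "h \<in> orlicz_space \<Phi> m" by (auto simp: orlicz_space_def intro!: exI[of _ 1])
    then have "integrable m h" by (rule orlicz_integrable[OF m.prob_space_axioms])
    then have "(\<integral>\<^sup>+ x. ennreal (cmod (h x)) \<partial>m) < \<infinity>" by (simp add: integrable_iff_bounded)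
    then obtain b where b: "(\<integral>\<^sup>+ x. ennreal (cmod (h x)) \<partial>m) = ennreal b" "0 \<le> b"
      by (cases "\<integral>\<^sup>+ x. ennreal (cmod (h x)) \<partial>m") auto
    \<comment> \<open>Jensen puts \<open>r * b\<close> into \<open>S\<close> for every
      \<open>r < 1\<close>, so the mean of \<open>|h|\<close> cannot exceed \<open>d\<close>; this
      is why \<open>1 / d\<close> has Orlicz norm at most 1.\<close>
    have "b \<le> d"
    proof (rule field_le_mult_one_interval)
      fix r :: real assume r: "0 < r" "r < 1"
      have "\<Phi> (r * b) \<le> (\<integral>\<^sup>+ x. \<Phi> (cmod (h x)) \<partial>m)"
        using h r by (intro m.young_jensen[OF young p _ _ b]) auto
      then have "r * b \<in> S" using h(2) r b by (simp add: S_def)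
      then show "r * b \<le> d" unfolding d_def by (rule cSup_upper[OF _ bdd])
    qed
    have "(\<integral>\<^sup>+ x. ennreal (cmod (?g x * h x)) \<partial>m) = (\<integral>\<^sup>+ x. ennreal (1 / d) * ennreal (cmod (h x)) \<partial>m)"
      using d by (intro nn_integral_cong) (simp add: norm_mult norm_divide ennreal_mult'[symmetric])
    also have "\<dots> = ennreal (1 / d) * ennreal b"
      using h(1) b(1) by (simp add: nn_integral_cmult)
    also have "\<dots> \<le> 1" using d \<open>b \<le> d\<close> b by (simp add: ennreal_mult'[symmetric])
    finally show "(\<integral>\<^sup>+ x. ennreal (cmod (?g x * h x)) \<partial>m) \<le> 1" .
  qed
  with g have gb: "?g \<in> dual_ball \<Phi> m" by (simp add: dual_ball_def)
  have gi: "integrable m ?g" by simp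
  \<comment> \<open>The convolution of \<open>\<mu>\<close> with the constant 1 is the constant
    \<open>\<mu> UNIV\<close>, and \<open>m\<close> has mass 1. The factors \<open>d\<close> and
    \<open>1 / d\<close> then cancel in the final estimate.\<close>
  have "scalar_vmeasure m \<mu> ?g UNIV = \<mu> UNIV * complex_of_real (1 / d)"
    unfolding scalar_vmeasure_def by (simp add: vmeasure_eq m.prob_space[simplified])
  then have "cmod (\<mu> UNIV) = d * cmod (scalar_vmeasure m \<mu> ?g UNIV)"
    using d by (simp add: norm_mult norm_divide)
  then have "ennreal (cmod (\<mu> UNIV)) = ennreal d * ennreal (cmod (scalar_vmeasure m \<mu> ?g UNIV))"
    using d by (simp add: ennreal_mult')
  also have "\<dots> \<le> ennreal d * emeasure (cm_var borel (scalar_vmeasure m \<mu> ?g)) UNIV"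
    using cmod_le_cm_var[OF complex_measure_scalar_vmeasure[OF gi]] by (intro mult_left_mono) auto
  also have "\<dots> = (\<integral>\<^sup>+ x. ennreal (cmod (?f x)) \<partial>cm_var borel (scalar_vmeasure m \<mu> ?g))"
    using d by simp
  also have "\<dots> \<le> vm_norm \<Phi> m \<mu> ?f" unfolding vm_norm_def by (rule SUP_upper[OF gb])
  finally show ?thesis using le1 by (rule order_trans)
qed

end

theorem theorem4p10:
  fixes m :: "'g::{topological_group_add, t2_space} measure"
    and \<Phi> \<Psi> :: "real \<Rightarrow> ennreal"
    and \<mu> :: "'g set \<Rightarrow> complex"
  assumes "compact (UNIV :: 'g set)"
    and "normalized_haar_measure m"
    and "young_function \<Phi>" and "\<Psi> = complementary_young \<Phi>" and "young_function \<Psi>"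
    and "delta2 \<Phi>" and "delta2 \<Psi>"
    and "complex_measure borel \<mu>" and "radon_measure (cm_var borel \<mu>)"
    and "\<mu> UNIV \<noteq> 0"
  shows "(\<forall>f\<in>orlicz_space \<Phi> m.
            vm_norm \<Phi> m \<mu> f \<le> ennreal (luxemburg_norm \<Phi> m f * cm_norm borel \<mu>))
       \<and> (\<forall>f\<in>orlicz_space \<Phi> m. vm_L1 \<Phi> m \<mu> f)
       \<and> inclusion_norm \<Phi> m \<mu> < \<infinity>
       \<and> ennreal (cmod (\<mu> UNIV)) \<le> inclusion_norm \<Phi> m \<mu>
       \<and> inclusion_norm \<Phi> m \<mu> \<le> ennreal (cm_norm borel \<mu>)"
proof -
  interpret orlicz_conv m \<mu> \<Phi> \<Psi>
    by (intro orlicz_conv.intro haar_radon.intro complementary_pair.intro orlicz_conv_axioms.intro assms)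
  have "inclusion_norm \<Phi> m \<mu> < \<infinity>"
    using inclusion_norm_le by (rule order.strict_trans1) simp
  then show ?thesis
    using vm_norm_le vm_L1_orlicz inclusion_norm_ge inclusion_norm_le by blast
qed

end
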